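(* Let $k\geq2$ be fixed. For each $p$ let $n_i=n_i(p)$, $1\le i\le k$, be integers with $\min_{1\le i\le k}n_i>p+1$ and $\lim_{p\to\infty}p/n_i=y_i\in(0,1]$. For $1\le i\le k$ let $\mathbf{x}_{i1},\dots,\mathbf{x}_{in_i}$ be i.i.d. $N_p(\boldsymbol\mu_i,\boldsymbol\Sigma_i)$ with $\boldsymbol\Sigma_i$ positive definite, the $k$ samples independent. Put $\bar{\mathbf{x}}_i=\frac1{n_i}\sum_{j=1}^{n_i}\mathbf{x}_{ij}$, $\mathbf{A}_i=\sum_{j=1}^{n_i}(\mathbf{x}_{ij}-\bar{\mathbf{x}}_i)(\mathbf{x}_{ij}-\bar{\mathbf{x}}_i)'$, $\mathbf{A}=\mathbf{A}_1+\dots+\mathbf{A}_k$, $n=n_1+\dots+n_k$, and $$\Lambda_n^*=\frac{\prod_{i=1}^k(\det\mathbf{A}_i)^{(n_i-1)/2}}{(\det\mathbf{A})^{(n-k)/2}}\cdot\frac{(n-k)^{(n-k)p/2}}{\prod_{i=1}^k(n_i-1)^{(n_i-1)p/2}}.$$ Assume $H_0:\boldsymbol\Sigma_1=\dots=\boldsymbol\Sigma_k$. Then $(\log\Lambda_n^*-\mu_n)/((n-k)\sigma_n)$ converges in distribution to $N(0,1)$ as $p\to\infty$, where $$\mu_n=\frac14\Big[(n-k)(2n-2p-2k-1)\log\Big(1-\frac{p}{n-k}\Big)-\sum_{i=1}^k(n_i-1)(2n_i-2p-3)\log\Big(1-\frac{p}{n_i-1}\Big)\Big],$$ $$\sigm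a_n^2=\frac12\Big[\log\Big(1-\frac{p}{n-k}\Big)-\sum_{i=1}^k\Big(\frac{n_i-1}{n-k}\Big)^2\log\Big(1-\frac{p}{n_i-1}\Big)\Big]>0.$$
   Context: $\Lambda_n^*$ is Bartlett's modified likelihood ratio statistic for testing equality of $k$ covariance matrices. *)

theory Defs
  imports "HOL-Probability.Probability"
    "Jordan_Normal_Form.Gauss_Jordan_Elimination"
    "Jordan_Normal_Form.Determinant"
begin

text \<open>Matrices of varying size p are Jordan_Normal_Form matrices (type real mat with explicit
  dimensions). Random p-vectors are modelled as elements of the product measure space
  PiM {..<p} (\<lambda>_. lborel) (extensional functions on {..<p}).\<close>

definition pos_def_mat :: "nat \<Rightarrow> real mat \<Rightarrow> bool" where
  "pos_def_mat p S \<longleftrightarrow> S \<in> carrier_mat p p \<and> S\<^sup>T = S \<and>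
     (\<forall>v \<in> carrier_vec p. v \<noteq> 0\<^sub>v p \<longrightarrow> scalar_prod v (mult_mat_vec S v) > 0)"

definition rvec_space :: "nat \<Rightarrow> (nat \<Rightarrow> real) measure" where
  "rvec_space p = PiM {..<p} (\<lambda>_. lborel)"

definition mvn_density :: "nat \<Rightarrow> real vec \<Rightarrow> real mat \<Rightarrow> (nat \<Rightarrow> real) \<Rightarrow> real" where
  "mvn_density p m S x =
     exp (- (1/2) * scalar_prod (vec p x - m) (mult_mat_vec (the (mat_inverse S)) (vec p x - m)))
     / sqrt ((2 * pi) ^ p * Determinant.det S)"

definition mvnormal :: "nat \<Rightarrow> real vec \<Rightarrow> real mat \<Rightarrow> (nat \<Rightarrow> real) measure" where
  "mvnormal p m S = density (rvec_space p) (\<lambda>x. ennreal (mvn_density p m S x))"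

definition sample_mean :: "nat \<Rightarrow> (nat \<Rightarrow> nat \<Rightarrow> real) \<Rightarrow> nat \<Rightarrow> real" where
  "sample_mean N x a = (\<Sum>j<N. x j a) / real N"

definition sscp_mat :: "nat \<Rightarrow> nat \<Rightarrow> (nat \<Rightarrow> nat \<Rightarrow> real) \<Rightarrow> real mat" where
  "sscp_mat p N x = mat p p (\<lambda>(a, b).
     \<Sum>j<N. (x j a - sample_mean N x a) * (x j b - sample_mean N x b))"

definition bartlett_Lambda ::
  "nat \<Rightarrow> nat \<Rightarrow> (nat \<Rightarrow> nat) \<Rightarrow> (nat \<Rightarrow> nat \<Rightarrow> nat \<Rightarrow> real) \<Rightarrow> real" where
  "bartlett_Lambda p k N x =
     (let A = (\<lambda>i. sscp_mat p (N i) (x i));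
          n = (\<Sum>i<k. N i) in
      ((\<Prod>i<k. Determinant.det (A i) powr ((real (N i) - 1) / 2))
        / Determinant.det (mat p p (\<lambda>(a, b). \<Sum>i<k. A i $$ (a, b))) powr ((real n - real k) / 2))
      * ((real n - real k) powr ((real n - real k) * real p / 2)
        / (\<Prod>i<k. (real (N i) - 1) powr ((real (N i) - 1) * real p / 2))))"

definition bartlett_mu :: "nat \<Rightarrow> nat \<Rightarrow> (nat \<Rightarrow> nat) \<Rightarrow> real" where
  "bartlett_mu p k N =
     (let n = real (\<Sum>i<k. N i); kk = real k; pp = real p in
      (1/4) * ((n - kk) * (2*n - 2*pp - 2*kk - 1) * ln (1 - pp / (n - kk))
        - (\<Sum>i<k. (real (N i) - 1) * (2 * real (N i) - 2*pp - 3) * ln (1 - pp / (real (N i) - 1)))))"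

definition bartlett_sigma2 :: "nat \<Rightarrow> nat \<Rightarrow> (nat \<Rightarrow> nat) \<Rightarrow> real" where
  "bartlett_sigma2 p k N =
     (let n = real (\<Sum>i<k. N i); kk = real k; pp = real p in
      (1/2) * (ln (1 - pp / (n - kk))
        - (\<Sum>i<k. ((real (N i) - 1) / (n - kk))\<^sup>2 * ln (1 - pp / (real (N i) - 1)))))"

end

theory Submission
  imports Defs "HOL-Complex_Analysis.Complex_Analysis" "HOL-Real_Asymp.Real_Asymp"
begin

text \<open>Invariance of the Gaussian law under reflections (a Haar-measure argument: a
  translation-invariant measure on \<open>\<real>\<^sup>I\<close> is a multiple of Lebesgue measure) reduces \<open>\<Lambda>\<^sub>n\<^sup>*\<close> to a ratio
  of Gram determinants of independent standard normal columns. Peeling off the last column, with one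
  Householder reflection per sample and one for the pooled sample, splits off a factor
  \<open>\<Prod>\<^sub>i q\<^sub>i powr a\<^sub>i / (\<Sum>\<^sub>i q\<^sub>i + q\<^sub>e) powr \<Sum>\<^sub>i a\<^sub>i\<close> of independent chi-square variables whose law
  does not depend on the remaining columns. This gives all real moments of \<open>\<Lambda>\<^sub>n\<^sup>*\<close> as products of
  Gamma quotients; the moments of order \<open>0\<close> show that the determinants are almost surely nonzero.

  With \<open>\<delta>\<^sub>i = s (n\<^sub>i - 1) / (2 (n - k) \<sigma>\<^sub>n)\<close>, Stirling's formula expands the logarithm of the moment
  generating function as \<open>s\<^sup>2 / 2\<close> up to an error of order \<open>\<Sum>\<^sub>i \<bar>\<delta>\<^sub>i\<bar> / (n\<^sub>i - 1 - p)\<close>. The error tends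
  to \<open>0\<close> even when \<open>y\<^sub>i = 1\<close>, because \<open>\<sigma>\<^sub>n\<close> is then at least of order
  \<open>\<surd>(- ln (1 - p / (n\<^sub>i - 1)))\<close>. Convergence of moment generating functions near \<open>0\<close> extends to
  characteristic functions by Vitali's theorem, and Levy's continuity theorem concludes.\<close>


subsection \<open>Gaussian measures on finite products\<close>

text \<open>The obstacle is that the block determinants and the pooled determinant are computed from
  the same rows, while each asks for its own rotation. After the blockwise reflections the peeled
  column is supported on one pivot row per sample and on the rows outside all samples. The vector of
  the pooled reflection therefore vanishes on the other rows of every sample, and the block
  determinants do not notice it. The pooled step deletes one row only, whereas every block loses its
  pivot: \<open>k - 1\<close> pivots stay in the pooled matrix without belonging to a block. They
  are the source of \<open>q\<^sub>e\<close>, and they force an induction in which the pooled row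
  set may be larger than the union of the blocks.

  Wishart densities and Jacobians are avoided: an unknown normalising constant is always removed by
  comparison with an integral of known value, often a total mass 1.

  As \<open>n\<^sub>i - 1 - p\<close> may stay bounded, the smallest Gamma arguments need not grow.
  The moment generating function is thus controlled only for \<open>s\<close> in a fixed bounded
  interval, from which the passage to the imaginary axis has to start.\<close>

definition lborel_Pi :: "'i set \<Rightarrow> ('i \<Rightarrow> real) measure" where
  "lborel_Pi I = PiM I (\<lambda>_. lborel)"

definition gauss :: "'i set \<Rightarrow> ('i \<Rightarrow> real) measure" where
  "gauss I = PiM I (\<lambda>_. std_normal_distribution)"

lemma sets_lborel_Pi [measurable_cong, simp]: "sets (lborel_Pi I) = sets (PiM I (\<lambda>_. borel))"
  unfolding lborel_Pi_def by (rule sets_PiM_cong) auto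

lemma sets_gauss [measurable_cong, simp]: "sets (gauss I) = sets (PiM I (\<lambda>_. borel))"
  unfolding gauss_def by (rule sets_PiM_cong) auto

lemma space_lborel_Pi [simp]: "space (lborel_Pi I) = extensional I"
  by (auto simp: lborel_Pi_def space_PiM PiE_def)

lemma space_gauss [simp]: "space (gauss I) = extensional I"
  by (auto simp: gauss_def space_PiM PiE_def)

lemma sigma_finite_lborel_Pi: "finite I \<Longrightarrow> sigma_finite_measure (lborel_Pi I)"
  unfolding lborel_Pi_def
  by (intro product_sigma_finite.sigma_finite product_sigma_finite.intro sigma_finite_lborel)

lemma product_prob_space_std_normal: "product_prob_space (\<lambda>_. std_normal_distribution)"
  by (intro product_prob_spaceI prob_space_normal_density) simp

lemma prob_space_gauss: "prob_space (gauss I)"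
  unfolding gauss_def by (intro prob_space_PiM prob_space_normal_density) simp

lemma product_sigma_finite_lborel: "product_sigma_finite (\<lambda>_. lborel :: real measure)"
  by (intro product_sigma_finite.intro sigma_finite_lborel)

lemma product_sigma_finite_std_normal: "product_sigma_finite (\<lambda>_. std_normal_distribution)"
  using product_prob_space_std_normal unfolding product_prob_space_def by blast

lemma prod_std_normal_density:
  "(\<Prod>i\<in>I. std_normal_density (x i)) = exp (- (\<Sum>i\<in>I. (x i)\<^sup>2) / 2) / sqrt (2 * pi) ^ card I"
proof (cases "finite I")
  case True
  have "(\<Prod>i\<in>I. std_normal_density (x i)) = (\<Prod>i\<in>I. exp (- (x i)\<^sup>2 / 2)) * (\<Prod>i\<in>I. 1 / sqrt (2 * pi))"
    unfolding normal_density_def prod.distrib[symmetric] by (intro prod.cong) auto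
  also have "(\<Prod>i\<in>I. exp (- (x i)\<^sup>2 / 2)) = exp (- (\<Sum>i\<in>I. (x i)\<^sup>2) / 2)"
    using True by (simp add: exp_sum[symmetric] sum_negf sum_divide_distrib)
  finally show ?thesis by (simp add: power_one_over)
qed simp

lemma gauss_eq_density:
  assumes I: "finite I"
  shows "gauss I = density (lborel_Pi I) (\<lambda>x. ennreal (\<Prod>i\<in>I. std_normal_density (x i)))"
proof -
  interpret L: product_sigma_finite "\<lambda>_::'a. lborel :: real measure"
    by (rule product_sigma_finite_lborel)
  interpret N: product_sigma_finite "\<lambda>_::'a. std_normal_distribution"
    by (rule product_sigma_finite_std_normal)
  have "density (lborel_Pi I) (\<lambda>x. ennreal (\<Prod>i\<in>I. std_normal_density (x i))) = PiM I (\<lambda>_. std_normal_distribution)"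
  proof (rule N.PiM_eqI[OF I])
    show "sets (density (lborel_Pi I) (\<lambda>x. ennreal (\<Prod>i\<in>I. std_normal_density (x i))))
      = sets (PiM I (\<lambda>_. std_normal_distribution))"
      unfolding sets_density by (simp add: sets_PiM_cong[of I I "\<lambda>_. std_normal_distribution" "\<lambda>_. borel"])
  next
    fix A :: "'a \<Rightarrow> real set" assume A: "\<And>i. i \<in> I \<Longrightarrow> A i \<in> sets std_normal_distribution"
    have [measurable]: "Pi\<^sub>E I A \<in> sets (PiM I (\<lambda>_. borel))"
      using A I by (intro sets_PiM_I_finite) auto
    have ind: "indicator (Pi\<^sub>E I A) x = (\<Prod>i\<in>I. indicator (A i) (x i) :: ennreal)" if "x \<in> extensional I" for x
      using that I by (auto simp: indicator_def PiE_def Pi_def intro!: prod_zero[symmetric] prod.neutral[symmetric])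
    have "emeasure (density (lborel_Pi I) (\<lambda>x. ennreal (\<Prod>i\<in>I. std_normal_density (x i)))) (Pi\<^sub>E I A)
      = (\<integral>\<^sup>+x. (\<Prod>i\<in>I. ennreal (std_normal_density (x i)) * indicator (A i) (x i)) \<partial>lborel_Pi I)"
      by (subst emeasure_density) (auto intro!: nn_integral_cong simp: ind prod.distrib prod_ennreal)
    also have "\<dots> = (\<Prod>i\<in>I. \<integral>\<^sup>+x. ennreal (std_normal_density x) * indicator (A i) x \<partial>lborel)"
      unfolding lborel_Pi_def using A by (intro L.product_nn_integral_prod I) auto
    also have "\<dots> = (\<Prod>i\<in>I. emeasure std_normal_distribution (A i))"
      using A by (intro prod.cong refl) (simp add: emeasure_density)
    finally show "emeasure (density (lborel_Pi I) (\<lambda>x. ennreal (\<Prod>i\<in>I. std_normal_density (x i)))) (Pi\<^sub>E I A)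
      = (\<Prod>i\<in>I. emeasure std_normal_distribution (A i))" .
  qed
  then show ?thesis by (simp add: gauss_def)
qed

lemma nn_integral_gauss:
  assumes "finite I" and [measurable]: "f \<in> borel_measurable (PiM I (\<lambda>_. borel))"
  shows "(\<integral>\<^sup>+x. f x \<partial>gauss I) =
    (\<integral>\<^sup>+x. ennreal (exp (- (\<Sum>i\<in>I. (x i)\<^sup>2) / 2) / sqrt (2 * pi) ^ card I) * f x \<partial>lborel_Pi I)"
  unfolding prod_std_normal_density[symmetric] by (simp add: gauss_eq_density[OF assms(1)] nn_integral_density)

section \<open>Translation invariance of Lebesgue measure and uniqueness up to a factor\<close>

lemma nn_integral_lborel_Pi_add:
  assumes I: "finite I" and [measurable]: "f \<in> borel_measurable (PiM I (\<lambda>_. borel))"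
  shows "(\<integral>\<^sup>+x. f (\<lambda>i\<in>I. x i + c i) \<partial>lborel_Pi I) = (\<integral>\<^sup>+x. f x \<partial>lborel_Pi I)"
proof -
  interpret L: product_sigma_finite "\<lambda>_::'a. lborel :: real measure"
    by (rule product_sigma_finite_lborel)
  let ?T = "\<lambda>x. \<lambda>i\<in>I. x i + c i"
  have T[measurable]: "?T \<in> PiM I (\<lambda>_. borel) \<rightarrow>\<^sub>M PiM I (\<lambda>_. borel)" by measurable
  have "distr (lborel_Pi I) (PiM I (\<lambda>_. borel)) ?T = PiM I (\<lambda>_. lborel)"
  proof (rule L.PiM_eqI[OF I])
    show "sets (distr (lborel_Pi I) (PiM I (\<lambda>_. borel)) ?T) = sets (PiM I (\<lambda>_. lborel))"
      by (simp add: sets_PiM_cong[of I I "\<lambda>_. lborel" "\<lambda>_. borel"])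
  next
    fix A :: "'a \<Rightarrow> real set" assume A: "\<And>i. i \<in> I \<Longrightarrow> A i \<in> sets lborel"
    have [measurable]: "Pi\<^sub>E I A \<in> sets (PiM I (\<lambda>_. borel))"
      using A I by (intro sets_PiM_I_finite) auto
    have eq: "?T -` Pi\<^sub>E I A \<inter> extensional I = Pi\<^sub>E I (\<lambda>i. (\<lambda>x. c i + x) -` A i)"
      by (auto simp: PiE_def Pi_def add.commute)
    have "emeasure (distr (lborel_Pi I) (PiM I (\<lambda>_. borel)) ?T) (Pi\<^sub>E I A)
      = emeasure (PiM I (\<lambda>_. lborel)) (Pi\<^sub>E I (\<lambda>i. (\<lambda>x. c i + x) -` A i))"
      by (subst emeasure_distr) (auto simp: eq, simp add: lborel_Pi_def)
    also have "\<dots> = (\<Prod>i\<in>I. emeasure lborel ((\<lambda>x. c i + x) -` A i))"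
      proof (intro L.emeasure_PiM I)
      fix i assume "i \<in> I"
      then have [measurable]: "A i \<in> sets borel" using A by auto
      have "(+) (c i) -` A i \<inter> space borel \<in> sets borel" by measurable
      then show "(+) (c i) -` A i \<in> sets lborel" by simp
    qed
    also have "\<dots> = (\<Prod>i\<in>I. emeasure lborel (A i))"
    proof (rule prod.cong[OF refl])
      fix i assume i: "i \<in> I"
      have "emeasure lborel (A i) = emeasure (distr lborel borel ((+) (c i))) (A i)"
        by (simp add: lborel_distr_plus)
      also have "\<dots> = emeasure lborel ((\<lambda>x. c i + x) -` A i)"
        using A[OF i] by (subst emeasure_distr) auto
      finally show "emeasure lborel ((\<lambda>x. c i + x) -` A i) = emeasure lborel (A i)" ..
    qed
    finally show "emeasure (distr (lborel_Pi I) (PiM I (\<lambda>_. borel)) ?T) (Pi\<^sub>E I A)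
      = (\<Prod>i\<in>I. emeasure lborel (A i))" .
  qed
  then have "(\<integral>\<^sup>+x. f x \<partial>lborel_Pi I) = (\<integral>\<^sup>+x. f x \<partial>distr (lborel_Pi I) (PiM I (\<lambda>_. borel)) ?T)"
    by (simp add: lborel_Pi_def)
  also have "\<dots> = (\<integral>\<^sup>+x. f (?T x) \<partial>lborel_Pi I)"
    by (rule nn_integral_distr) auto
  finally show ?thesis ..
qed

lemma nn_integral_lborel_Pi_add':
  assumes I: "finite I" and f: "f \<in> borel_measurable (PiM I (\<lambda>_. borel))"
    and eq: "\<And>x. x \<in> extensional I \<Longrightarrow> g x = f (\<lambda>i\<in>I. x i + c i)"
  shows "(\<integral>\<^sup>+x. g x \<partial>lborel_Pi I) = (\<integral>\<^sup>+x. f x \<partial>lborel_Pi I)"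
  unfolding nn_integral_lborel_Pi_add[OF I f, of c, symmetric]
  by (intro nn_integral_cong eq) simp

text \<open>This is the uniqueness proof for Haar measure in integral form. Hypothesis
  \<open>add\<close> absorbs a translation of \<open>T x\<close> into a translation of
  \<open>x\<close>, so the image of Lebesgue measure under \<open>T\<close> is translation
  invariant; evaluating the double integral of \<open>f (T x + y) * g y\<close> in both orders gives
  proportionality. As \<open>g\<close> is free, each application can choose a test function that
  reveals the constant without a determinant.\<close>

lemma nn_integral_lborel_Pi_linear:
  assumes I: "finite I"
    and T[measurable]: "T \<in> PiM I (\<lambda>_. borel) \<rightarrow>\<^sub>M PiM I (\<lambda>_. borel)"
    and add: "\<And>c. c \<in> extensional I \<Longrightarrow> \<exists>c'. \<forall>x\<in>extensional I. (\<lambda>i\<in>I. T x i + c i) = T (\<lambda>i\<in>I. x i + c' i)"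
    and [measurable]: "f \<in> borel_measurable (PiM I (\<lambda>_. borel))" "g \<in> borel_measurable (PiM I (\<lambda>_. borel))"
  shows "(\<integral>\<^sup>+x. f (T x) \<partial>lborel_Pi I) * (\<integral>\<^sup>+x. g x \<partial>lborel_Pi I) =
         (\<integral>\<^sup>+x. f x \<partial>lborel_Pi I) * (\<integral>\<^sup>+x. g (\<lambda>i\<in>I. - T x i) \<partial>lborel_Pi I)"
proof -
  interpret S: sigma_finite_measure "lborel_Pi I" by (rule sigma_finite_lborel_Pi[OF I])
  interpret P: pair_sigma_finite "lborel_Pi I" "lborel_Pi I" ..
  have Te: "T x \<in> extensional I" if "x \<in> extensional I" for x
    using measurable_space[OF T, of x] that by (auto simp: space_PiM PiE_def)
  have tr: "(\<integral>\<^sup>+x. h (\<lambda>i\<in>I. T x i + c i) \<partial>lborel_Pi I) = (\<integral>\<^sup>+x. h (T x) \<partial>lborel_Pi I)"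
    if h[measurable]: "h \<in> borel_measurable (PiM I (\<lambda>_. borel))" and c: "c \<in> extensional I" for h c
  proof -
    obtain c' where c': "\<And>x. x \<in> extensional I \<Longrightarrow> (\<lambda>i\<in>I. T x i + c i) = T (\<lambda>i\<in>I. x i + c' i)"
      using add[OF c] by blast
    show ?thesis
      by (rule nn_integral_lborel_Pi_add'[OF I, where c = c']) (use c' in auto)
  qed
  have "(\<integral>\<^sup>+x. f (T x) \<partial>lborel_Pi I) * (\<integral>\<^sup>+x. g x \<partial>lborel_Pi I)
      = (\<integral>\<^sup>+y. (\<integral>\<^sup>+x. f (T x) \<partial>lborel_Pi I) * g y \<partial>lborel_Pi I)"
    by (subst nn_integral_cmult) auto
  also have "\<dots> = (\<integral>\<^sup>+y. (\<integral>\<^sup>+x. f (\<lambda>i\<in>I. T x i + y i) \<partial>lborel_Pi I) * g y \<partial>lborel_Pi I)"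
    by (intro nn_integral_cong) (subst tr, auto)
  also have "\<dots> = (\<integral>\<^sup>+y. (\<integral>\<^sup>+x. f (\<lambda>i\<in>I. T x i + y i) * g y \<partial>lborel_Pi I) \<partial>lborel_Pi I)"
    by (intro nn_integral_cong nn_integral_multc[symmetric]) measurable
  also have "\<dots> = (\<integral>\<^sup>+x. (\<integral>\<^sup>+y. f (\<lambda>i\<in>I. T x i + y i) * g y \<partial>lborel_Pi I) \<partial>lborel_Pi I)"
    by (rule P.Fubini') measurable
  also have "\<dots> = (\<integral>\<^sup>+x. (\<integral>\<^sup>+y. f y * g (\<lambda>i\<in>I. y i - T x i) \<partial>lborel_Pi I) \<partial>lborel_Pi I)"
  proof (rule nn_integral_cong)
    fix x :: "'a \<Rightarrow> real" assume x: "x \<in> space (lborel_Pi I)"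
    show "(\<integral>\<^sup>+y. f (\<lambda>i\<in>I. T x i + y i) * g y \<partial>lborel_Pi I) = (\<integral>\<^sup>+y. f y * g (\<lambda>i\<in>I. y i - T x i) \<partial>lborel_Pi I)"
    proof (rule nn_integral_lborel_Pi_add'[OF I, where c = "T x"])
      fix y :: "'a \<Rightarrow> real" assume y: "y \<in> extensional I"
      have "(\<lambda>i\<in>I. T x i + y i) = (\<lambda>i\<in>I. y i + T x i)" "y = (\<lambda>i\<in>I. (\<lambda>i\<in>I. y i + T x i) i - T x i)"
        using y by (auto simp: fun_eq_iff extensional_def)
      then show "f (\<lambda>i\<in>I. T x i + y i) * g y = f (\<lambda>i\<in>I. y i + T x i) * g (\<lambda>i\<in>I. (\<lambda>i\<in>I. y i + T x i) i - T x i)"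
        by simp
    qed measurable
  qed
  also have "\<dots> = (\<integral>\<^sup>+y. (\<integral>\<^sup>+x. f y * g (\<lambda>i\<in>I. y i - T x i) \<partial>lborel_Pi I) \<partial>lborel_Pi I)"
    by (rule P.Fubini') measurable
  also have "\<dots> = (\<integral>\<^sup>+y. f y * (\<integral>\<^sup>+x. g (\<lambda>i\<in>I. y i - T x i) \<partial>lborel_Pi I) \<partial>lborel_Pi I)"
    by (intro nn_integral_cong nn_integral_cmult) measurable
  also have "\<dots> = (\<integral>\<^sup>+y. f y * (\<integral>\<^sup>+x. g (\<lambda>i\<in>I. - T x i) \<partial>lborel_Pi I) \<partial>lborel_Pi I)"
  proof (rule nn_integral_cong)
    fix y :: "'a \<Rightarrow> real" assume y: "y \<in> space (lborel_Pi I)"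
    \<comment> \<open>Translating \<open>T x\<close> by \<open>y\<close> cancels the
      \<open>y\<close> in the argument; only \<open>- T x\<close> is left, which explains the minus
      sign in the conclusion.\<close>
    have "(\<integral>\<^sup>+x. g (\<lambda>i\<in>I. y i - T x i) \<partial>lborel_Pi I) = (\<integral>\<^sup>+x. g (\<lambda>i\<in>I. y i - (\<lambda>i\<in>I. T x i + y i) i) \<partial>lborel_Pi I)"
      using y by (subst tr[where h = "\<lambda>u. g (\<lambda>i\<in>I. y i - u i)"]) auto
    also have "\<dots> = (\<integral>\<^sup>+x. g (\<lambda>i\<in>I. - T x i) \<partial>lborel_Pi I)"
      by (intro nn_integral_cong arg_cong[where f = g]) auto
    finally show "f y * (\<integral>\<^sup>+x. g (\<lambda>i\<in>I. y i - T x i) \<partial>lborel_Pi I) = f y * (\<integral>\<^sup>+x. g (\<lambda>i\<in>I. - T x i) \<partial>lborel_Pi I)"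
      by simp
  qed
  also have "\<dots> = (\<integral>\<^sup>+x. f x \<partial>lborel_Pi I) * (\<integral>\<^sup>+x. g (\<lambda>i\<in>I. - T x i) \<partial>lborel_Pi I)"
    by (rule nn_integral_multc) measurable
  finally show ?thesis .
qed


text \<open>The Gaussian density serves as the test function: both \<open>T\<close> and its negative
  preserve the sum of squares, so the density is unchanged and the proportionality constant is
  1.\<close>

lemma nn_integral_gauss_isometry:
  assumes I: "finite I"
    and T[measurable]: "T \<in> PiM I (\<lambda>_. borel) \<rightarrow>\<^sub>M PiM I (\<lambda>_. borel)"
    and add: "\<And>c. c \<in> extensional I \<Longrightarrow> \<exists>c'. \<forall>x\<in>extensional I. (\<lambda>i\<in>I. T x i + c i) = T (\<lambda>i\<in>I. x i + c' i)"
    and iso: "\<And>x. x \<in> extensional I \<Longrightarrow> (\<Sum>i\<in>I. (T x i)\<^sup>2) = (\<Sum>i\<in>I. (x i)\<^sup>2)"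
    and [measurable]: "f \<in> borel_measurable (PiM I (\<lambda>_. borel))"
  shows "(\<integral>\<^sup>+x. f (T x) \<partial>gauss I) = (\<integral>\<^sup>+x. f x \<partial>gauss I)"
proof -
  let ?d = "\<lambda>x. ennreal (exp (- (\<Sum>i\<in>I. (x i)\<^sup>2) / 2) / sqrt (2 * pi) ^ card I)"
  interpret G: prob_space "gauss I" by (rule prob_space_gauss)
  have one: "(\<integral>\<^sup>+x. ?d x \<partial>lborel_Pi I) = 1"
    using nn_integral_gauss[OF I, of "\<lambda>_. 1"] G.emeasure_space_1 by simp
  have "(\<integral>\<^sup>+x. f (T x) \<partial>gauss I) = (\<integral>\<^sup>+x. ?d (T x) * f (T x) \<partial>lborel_Pi I)"
    by (subst nn_integral_gauss[OF I]) (auto intro!: nn_integral_cong simp: iso)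
  also have "\<dots> = (\<integral>\<^sup>+x. ?d (T x) * f (T x) \<partial>lborel_Pi I) * (\<integral>\<^sup>+x. ?d x \<partial>lborel_Pi I)"
    by (simp only: one mult_1_right)
  also have "\<dots> = (\<integral>\<^sup>+x. ?d x * f x \<partial>lborel_Pi I) * (\<integral>\<^sup>+x. ?d (\<lambda>i\<in>I. - T x i) \<partial>lborel_Pi I)"
    by (rule nn_integral_lborel_Pi_linear[OF I T add, where f = "\<lambda>x. ?d x * f x"]) auto
  also have "(\<integral>\<^sup>+x. ?d (\<lambda>i\<in>I. - T x i) \<partial>lborel_Pi I) = (\<integral>\<^sup>+x. ?d x \<partial>lborel_Pi I)"
    by (intro nn_integral_cong) (simp add: iso)
  finally show ?thesis by (simp only: one mult_1_right) (simp add: nn_integral_gauss[OF I])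
qed

text \<open>Testing with a product of Gaussian densities reduces the proportionality constant to a
  one-dimensional affine substitution.\<close>

lemma nn_integral_lborel_Pi_scale:
  assumes I: "finite I" and u: "u > 0" and f[measurable]: "f \<in> borel_measurable (PiM I (\<lambda>_. borel))"
  shows "(\<integral>\<^sup>+x. f (\<lambda>i\<in>I. u * x i) \<partial>lborel_Pi I) * ennreal (u ^ card I) = (\<integral>\<^sup>+x. f x \<partial>lborel_Pi I)"
proof -
  interpret L: product_sigma_finite "\<lambda>_::'a. lborel :: real measure"
    by (rule product_sigma_finite_lborel)
  let ?d = "\<lambda>x. \<Prod>i\<in>I. ennreal (std_normal_density (x i))"
  let ?T = "\<lambda>x. \<lambda>i\<in>I. u * x i"
  have prod: "(\<integral>\<^sup>+x. (\<Prod>i\<in>I. ennreal (std_normal_density (t * x i))) \<partial>lborel_Pi I)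
      = ennreal (1 / t ^ card I)" if t: "t > 0" for t
  proof -
    have "(\<integral>\<^sup>+x. (\<Prod>i\<in>I. ennreal (std_normal_density (t * x i))) \<partial>lborel_Pi I)
      = (\<Prod>i\<in>I. \<integral>\<^sup>+x. ennreal (std_normal_density (t * x)) \<partial>lborel)"
      unfolding lborel_Pi_def by (rule L.product_nn_integral_prod[OF I]) auto
    also have "(\<integral>\<^sup>+x. ennreal (std_normal_density (t * x)) \<partial>lborel) = ennreal (1 / t)"
    proof -
      have "1 = (\<integral>\<^sup>+x. ennreal (std_normal_density x) \<partial>lborel)"
        by (subst nn_integral_eq_integral) auto
      also have "\<dots> = ennreal t * (\<integral>\<^sup>+x. ennreal (std_normal_density (t * x)) \<partial>lborel)"
        using nn_integral_real_affine[of "\<lambda>x. ennreal (std_normal_density x)" t 0] t by simp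
      finally have "ennreal (1 / t) * (ennreal t * (\<integral>\<^sup>+x. ennreal (std_normal_density (t * x)) \<partial>lborel)) = ennreal (1 / t)"
        by simp
      then show ?thesis using t by (simp add: mult.assoc[symmetric] ennreal_mult[symmetric])
    qed
    finally show ?thesis using t by (simp add: prod_ennreal power_one_over ennreal_power)
  qed
  have "(\<integral>\<^sup>+x. f (?T x) \<partial>lborel_Pi I) * (\<integral>\<^sup>+x. ?d x \<partial>lborel_Pi I)
    = (\<integral>\<^sup>+x. f x \<partial>lborel_Pi I) * (\<integral>\<^sup>+x. ?d (\<lambda>i\<in>I. - ?T x i) \<partial>lborel_Pi I)"
  proof (rule nn_integral_lborel_Pi_linear[OF I])
    fix c :: "'a \<Rightarrow> real"
    have "\<forall>x\<in>extensional I. (\<lambda>i\<in>I. ?T x i + c i) = ?T (\<lambda>i\<in>I. x i + c i / u)"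
      using u by (auto simp: fun_eq_iff field_simps)
    then show "\<exists>c'. \<forall>x\<in>extensional I. (\<lambda>i\<in>I. ?T x i + c i) = ?T (\<lambda>i\<in>I. x i + c' i)"
      by (rule exI[where x = "\<lambda>i. c i / u"])
  qed measurable
  also have "(\<integral>\<^sup>+x. ?d x \<partial>lborel_Pi I) = 1"
    using prod[of 1] by simp
  also have "(\<integral>\<^sup>+x. ?d (\<lambda>i\<in>I. - ?T x i) \<partial>lborel_Pi I) = (\<integral>\<^sup>+x. (\<Prod>i\<in>I. ennreal (std_normal_density (u * x i))) \<partial>lborel_Pi I)"
    by (intro nn_integral_cong prod.cong) (auto simp: normal_density_def)
  also have "\<dots> = ennreal (1 / u ^ card I)" by (rule prod[OF u])
  finally have "(\<integral>\<^sup>+x. f (?T x) \<partial>lborel_Pi I) = (\<integral>\<^sup>+x. f x \<partial>lborel_Pi I) * ennreal (1 / u ^ card I)"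
    by (simp only: mult_1_right)
  then have "(\<integral>\<^sup>+x. f (?T x) \<partial>lborel_Pi I) * ennreal (u ^ card I)
     = (\<integral>\<^sup>+x. f x \<partial>lborel_Pi I) * (ennreal (1 / u ^ card I) * ennreal (u ^ card I))"
    by (simp only: mult.assoc)
  also have "ennreal (1 / u ^ card I) * ennreal (u ^ card I) = 1"
    using u by (simp add: ennreal_mult[symmetric])
  finally show ?thesis by (simp only: mult_1_right)
qed

section \<open>Null sets and the radial decomposition\<close>

lemma AE_lborel_Pi_component_neq_0:
  assumes I: "finite I" and i: "i \<in> I"
  shows "AE x in lborel_Pi I. x i \<noteq> 0"
proof -
  interpret L: product_sigma_finite "\<lambda>_::'a. lborel :: real measure"
    by (rule product_sigma_finite_lborel)
  have ins: "insert i (I - {i}) = I" using i by auto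
  have meas[measurable]: "(\<lambda>x. x i) \<in> borel_measurable (PiM I (\<lambda>_. borel))" using i by measurable
  have "(\<lambda>x. indicator {0::real} (x i) :: ennreal) \<in> borel_measurable (PiM (insert i (I - {i})) (\<lambda>_. lborel))"
    unfolding ins using i by measurable
  from L.product_nn_integral_insert[OF _ _ this] I
  have "(\<integral>\<^sup>+x. indicator {0::real} (x i) \<partial>lborel_Pi I)
    = (\<integral>\<^sup>+(x::'a \<Rightarrow> real). \<integral>\<^sup>+(y::real). indicator {0} y \<partial>lborel \<partial>lborel_Pi (I - {i}))"
    unfolding ins lborel_Pi_def by simp
  also have "\<dots> = 0" by simp
  finally have "AE x in lborel_Pi I. (indicator {0} (x i) :: ennreal) = 0"
    by (subst (asm) nn_integral_0_iff_AE) auto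
  then show ?thesis by eventually_elim (auto simp: indicator_def split: if_splits)
qed

lemma AE_lborel_Pi_sum_squares_pos:
  assumes I: "finite I" and B: "B \<subseteq> I" "B \<noteq> {}"
  shows "AE x in lborel_Pi I. (\<Sum>i\<in>B. (x i)\<^sup>2) > 0"
proof -
  obtain b where b: "b \<in> B" using B by auto
  with B have "b \<in> I" by auto
  from AE_lborel_Pi_component_neq_0[OF I this] show ?thesis
  proof (rule AE_mp, intro AE_I2 impI)
    fix x :: "'a \<Rightarrow> real" assume "x b \<noteq> 0"
    then have "0 < (x b)\<^sup>2" by simp
    also have "\<dots> \<le> (\<Sum>i\<in>B. (x i)\<^sup>2)"
      using b finite_subset[OF B(1) I] by (intro member_le_sum) auto
    finally show "(\<Sum>i\<in>B. (x i)\<^sup>2) > 0" .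
  qed
qed

lemma AE_gauss_sum_squares_pos:
  assumes I: "finite I" and B: "B \<subseteq> I" "B \<noteq> {}"
  shows "AE x in gauss I. (\<Sum>i\<in>B. (x i)\<^sup>2) > 0"
  using AE_lborel_Pi_sum_squares_pos[OF assms]
  unfolding gauss_eq_density[OF I] by (subst AE_density) auto

text \<open>Polar coordinates without spheres: inserting the constant
  \<open>ln 2 = \<integral>\<^sub>q\<^sub>/\<^sub>2\<^sup>q du/u\<close> for \<open>q = \<bar>x\<bar>\<^sup>2\<close> and rescaling \<open>x\<close> by \<open>\<surd>u\<close> separates the
  radial variable \<open>u\<close> from the angular part.\<close>

lemma nn_integral_lborel_Pi_radial:
  assumes I: "finite I" "I \<noteq> {}" and f[measurable]: "f \<in> borel_measurable (PiM I (\<lambda>_. borel))"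
    and hom: "\<And>u x. u > 0 \<Longrightarrow> f (\<lambda>i\<in>I. u * x i) = f x"
  shows "\<exists>K. \<forall>h\<in>borel_measurable borel. (\<integral>\<^sup>+x. f x * h (\<Sum>i\<in>I. (x i)\<^sup>2) \<partial>lborel_Pi I)
    = K * (\<integral>\<^sup>+v. ennreal (v powr (real (card I) / 2 - 1)) * indicator {0<..} v * h v \<partial>lborel)"
proof -
  interpret S: sigma_finite_measure "lborel_Pi I" by (rule sigma_finite_lborel_Pi[OF I(1)])
  interpret P: pair_sigma_finite "lborel_Pi I" "lborel :: real measure" ..
  interpret P': pair_sigma_finite "lborel :: real measure" "lborel_Pi I" ..
  let ?q = "\<lambda>x::'a \<Rightarrow> real. \<Sum>i\<in>I. (x i)\<^sup>2"
  let ?D = "real (card I)"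
  \<comment> \<open>An integral over the shell from 1 to 2 in the squared radius, weighted by the
    power that the final substitution \<open>v = u * q\<close> produces. It depends on
    \<open>f\<close> alone; the value \<infinity> is permitted.\<close>
  define K where "K = (\<integral>\<^sup>+x. f x * indicator {1..2} (?q x) * ennreal (?q x powr (- ?D / 2)) \<partial>lborel_Pi I)"
  have q_pos: "AE x in lborel_Pi I. ?q x > 0"
    using I by (intro AE_lborel_Pi_sum_squares_pos) auto
  have ln2: "(\<integral>\<^sup>+u. indicator {q/2..q} u * ennreal (1 / u) \<partial>lborel) = ennreal (ln 2)" if q: "q > 0" for q :: real
  proof -
    have "(\<integral>\<^sup>+u. ennreal (1 / u) * indicator {q/2..q} u \<partial>lborel) = ennreal (ln q - ln (q / 2))"
      using q by (intro nn_integral_FTC_Icc) (auto intro!: derivative_eq_intros)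
    also have "ln q - ln (q / 2) = ln 2" using q by (simp add: ln_div)
    finally show ?thesis by (simp add: mult.commute)
  qed
  have key: "(\<integral>\<^sup>+x. f x * h (?q x) \<partial>lborel_Pi I) * ennreal (ln 2)
    = K * (\<integral>\<^sup>+v. ennreal (v powr (?D / 2 - 1)) * indicator {0<..} v * h v \<partial>lborel)"
    if h[measurable]: "h \<in> borel_measurable borel" for h :: "real \<Rightarrow> ennreal"
  proof -
    let ?J = "\<integral>\<^sup>+v. ennreal (v powr (?D / 2 - 1)) * indicator {0<..} v * h v \<partial>lborel"
    have "(\<integral>\<^sup>+x. f x * h (?q x) \<partial>lborel_Pi I) * ennreal (ln 2)
      = (\<integral>\<^sup>+x. f x * h (?q x) * ennreal (ln 2) \<partial>lborel_Pi I)"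
      by (rule nn_integral_multc[symmetric]) measurable
    \<comment> \<open>The window for \<open>u\<close> is written as a condition on
      \<open>?q x\<close>, because rescaling \<open>x\<close> by \<open>sqrt u\<close> then turns it
      into the shell condition \<open>1 \<le> ?q x \<le> 2\<close>, which no longer involves
      \<open>u\<close>.\<close>
    also have "\<dots> = (\<integral>\<^sup>+x. f x * h (?q x) * (\<integral>\<^sup>+u. indicator {0<..} u * (if u \<le> ?q x \<and> ?q x \<le> 2 * u then 1 else 0) * ennreal (1 / u) \<partial>lborel) \<partial>lborel_Pi I)"
    proof (rule nn_integral_cong_AE, rule AE_mp[OF q_pos], rule AE_I2, rule impI)
      fix x assume elim: "?q x > 0"
      have "ennreal (ln 2) = (\<integral>\<^sup>+u. indicator {?q x/2..?q x} u * ennreal (1 / u) \<partial>lborel)"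
        using ln2[OF elim] by simp
      also have "\<dots> = (\<integral>\<^sup>+u. indicator {0<..} u * (if u \<le> ?q x \<and> ?q x \<le> 2 * u then 1 else 0) * ennreal (1 / u) \<partial>lborel)"
        using elim by (intro nn_integral_cong) (auto simp: indicator_def)
      finally show "f x * h (?q x) * ennreal (ln 2)
        = f x * h (?q x) * (\<integral>\<^sup>+u. indicator {0<..} u * (if u \<le> ?q x \<and> ?q x \<le> 2 * u then 1 else 0) * ennreal (1 / u) \<partial>lborel)"
        by simp
    qed
    also have "\<dots> = (\<integral>\<^sup>+x. (\<integral>\<^sup>+u. f x * h (?q x) * (indicator {0<..} u * (if u \<le> ?q x \<and> ?q x \<le> 2 * u then 1 else 0) * ennreal (1 / u)) \<partial>lborel) \<partial>lborel_Pi I)"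
      by (intro nn_integral_cong, subst nn_integral_cmult) auto
    also have "\<dots> = (\<integral>\<^sup>+u. (\<integral>\<^sup>+x. f x * h (?q x) * (indicator {0<..} u * (if u \<le> ?q x \<and> ?q x \<le> 2 * u then 1 else 0) * ennreal (1 / u)) \<partial>lborel_Pi I) \<partial>lborel)"
      by (rule P'.Fubini') measurable
    also have "\<dots> = (\<integral>\<^sup>+u. (\<integral>\<^sup>+x. f x * indicator {1..2} (?q x) * (ennreal (u powr (?D / 2 - 1)) * indicator {0<..} u * h (u * ?q x)) \<partial>lborel_Pi I) \<partial>lborel)"
    proof (rule nn_integral_cong)
      fix u :: real
      show "(\<integral>\<^sup>+x. f x * h (?q x) * (indicator {0<..} u * (if u \<le> ?q x \<and> ?q x \<le> 2 * u then 1 else 0) * ennreal (1 / u)) \<partial>lborel_Pi I)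
        = (\<integral>\<^sup>+x. f x * indicator {1..2} (?q x) * (ennreal (u powr (?D / 2 - 1)) * indicator {0<..} u * h (u * ?q x)) \<partial>lborel_Pi I)"
      proof (cases "u > 0")
        case u: True
        let ?F = "\<lambda>x. f x * h (?q x) * ((if u \<le> ?q x \<and> ?q x \<le> 2 * u then 1 else 0) * ennreal (1 / u))"
        have F: "?F \<in> borel_measurable (PiM I (\<lambda>_. borel))" by measurable
        have T: "(\<lambda>x. \<lambda>i\<in>I. sqrt u * x i) \<in> lborel_Pi I \<rightarrow>\<^sub>M PiM I (\<lambda>_. borel)" by measurable
        have su: "sqrt u > 0" "(sqrt u)\<^sup>2 = u" using u by auto
        have qs: "?q (\<lambda>i\<in>I. sqrt u * x i) = u * ?q x" for x
          using su by (simp add: power_mult_distrib sum_distrib_left)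
        have "(\<integral>\<^sup>+x. ?F x \<partial>lborel_Pi I) = (\<integral>\<^sup>+x. ?F (\<lambda>i\<in>I. sqrt u * x i) \<partial>lborel_Pi I) * ennreal (sqrt u ^ card I)"
          by (rule nn_integral_lborel_Pi_scale[OF I(1) su(1), symmetric]) measurable
        also have "\<dots> = (\<integral>\<^sup>+x. ?F (\<lambda>i\<in>I. sqrt u * x i) * ennreal (sqrt u ^ card I) \<partial>lborel_Pi I)"
          by (rule nn_integral_multc[symmetric], rule measurable_compose[OF T F])
        also have "\<dots> = (\<integral>\<^sup>+x. f x * indicator {1..2} (?q x) * (ennreal (u powr (?D / 2 - 1)) * indicator {0<..} u * h (u * ?q x)) \<partial>lborel_Pi I)"
        proof (rule nn_integral_cong)
          fix x :: "'a \<Rightarrow> real"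
          have "sqrt u ^ card I = u powr (?D / 2)"
            using u by (simp add: powr_half_sqrt[symmetric] powr_powr powr_realpow[symmetric])
          then have "1 / u * sqrt u ^ card I = u powr (?D / 2 - 1)"
            using u by (simp add: powr_diff)
          then have e: "ennreal (1 / u) * ennreal (sqrt u ^ card I) = ennreal (u powr (?D / 2 - 1))"
            using u by (subst ennreal_mult[symmetric]) auto
          have ind: "(if u \<le> u * ?q x \<and> u * ?q x \<le> 2 * u then 1 else 0) = (indicator {1..2} (?q x) :: ennreal)"
            using u by (auto simp: indicator_def)
          show "?F (\<lambda>i\<in>I. sqrt u * x i) * ennreal (sqrt u ^ card I)
            = f x * indicator {1..2} (?q x) * (ennreal (u powr (?D / 2 - 1)) * indicator {0<..} u * h (u * ?q x))"
            unfolding qs hom[OF su(1)] ind e[symmetric] using u by (simp add: mult_ac)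
        qed
        finally show ?thesis using u by simp
      qed simp
    qed
    also have "\<dots> = (\<integral>\<^sup>+x. (\<integral>\<^sup>+u. f x * indicator {1..2} (?q x) * (ennreal (u powr (?D / 2 - 1)) * indicator {0<..} u * h (u * ?q x)) \<partial>lborel) \<partial>lborel_Pi I)"
      by (rule P.Fubini') measurable
    also have "\<dots> = (\<integral>\<^sup>+x. f x * indicator {1..2} (?q x) * ennreal (?q x powr (- ?D / 2)) * ?J \<partial>lborel_Pi I)"
    proof (rule nn_integral_cong)
      fix x :: "'a \<Rightarrow> real"
      show "(\<integral>\<^sup>+u. f x * indicator {1..2} (?q x) * (ennreal (u powr (?D / 2 - 1)) * indicator {0<..} u * h (u * ?q x)) \<partial>lborel)
        = f x * indicator {1..2} (?q x) * ennreal (?q x powr (- ?D / 2)) * ?J"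
      proof (cases "?q x \<in> {1..2}")
        case True
        define q where "q = ?q x"
        have q: "q > 0" using True by (auto simp: q_def)
        have "?J = ennreal q * (\<integral>\<^sup>+u. ennreal ((q * u) powr (?D / 2 - 1)) * indicator {0<..} (q * u) * h (q * u) \<partial>lborel)"
          using nn_integral_real_affine[of "\<lambda>v. ennreal (v powr (?D / 2 - 1)) * indicator {0<..} v * h v" q 0] q
          by simp
        also have "\<dots> = (\<integral>\<^sup>+u. ennreal (q powr (?D / 2)) * (ennreal (u powr (?D / 2 - 1)) * indicator {0<..} u * h (u * q)) \<partial>lborel)"
        proof (subst nn_integral_cmult[symmetric], measurable, rule nn_integral_cong)
          fix u :: real
          have "ennreal q * ennreal ((q * u) powr (?D / 2 - 1)) = ennreal (q powr (?D / 2)) * ennreal (u powr (?D / 2 - 1))" if "u > 0"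
            using q that by (subst (1 2) ennreal_mult[symmetric]) (auto simp: powr_mult powr_diff)
          then show "ennreal q * (ennreal ((q * u) powr (?D / 2 - 1)) * indicator {0<..} (q * u) * h (q * u))
            = ennreal (q powr (?D / 2)) * (ennreal (u powr (?D / 2 - 1)) * indicator {0<..} u * h (u * q))"
            using q by (cases "u > 0") (simp_all add: mult.assoc[symmetric] zero_less_mult_iff, simp only: mult.commute[of q u])
        qed
        also have "\<dots> = ennreal (q powr (?D / 2)) * (\<integral>\<^sup>+u. (ennreal (u powr (?D / 2 - 1)) * indicator {0<..} u * h (u * q)) \<partial>lborel)"
          by (rule nn_integral_cmult) measurable
        finally have "ennreal (q powr (- ?D / 2)) * ?J = (\<integral>\<^sup>+u. (ennreal (u powr (?D / 2 - 1)) * indicator {0<..} u * h (u * q)) \<partial>lborel)"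
          using q by (simp add: mult.assoc[symmetric] ennreal_mult[symmetric] powr_add[symmetric])
        then show ?thesis
          unfolding q_def[symmetric] by (subst nn_integral_cmult) (measurable, simp only: mult.assoc)
      qed simp
    qed
    also have "\<dots> = K * ?J"
      unfolding K_def by (rule nn_integral_multc) measurable
    finally show ?thesis .
  qed
  have "(\<integral>\<^sup>+x. f x * h (?q x) \<partial>lborel_Pi I)
    = (K * ennreal (1 / ln 2)) * (\<integral>\<^sup>+v. ennreal (v powr (?D / 2 - 1)) * indicator {0<..} v * h v \<partial>lborel)"
    if h: "h \<in> borel_measurable borel" for h :: "real \<Rightarrow> ennreal"
  proof -
    have "ennreal (ln 2) * ennreal (1 / ln 2) = 1"
      by (subst ennreal_mult[symmetric]) auto
    then have "(\<integral>\<^sup>+x. f x * h (?q x) \<partial>lborel_Pi I) = (\<integral>\<^sup>+x. f x * h (?q x) \<partial>lborel_Pi I) * ennreal (ln 2) * ennreal (1 / ln 2)"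
      by (simp add: mult.assoc)
    then show ?thesis unfolding key[OF h] by (simp add: mult_ac)
  qed
  then show ?thesis by blast
qed

text \<open>Under the Gaussian law a function of the direction is independent of the radius, so the
  power of the squared radius contributes its chi-square moment as a factor. The angular constant
  \<open>K\<close> is unknown and possibly infinite; it disappears on comparing the exponent
  \<open>a\<close> with the exponent 0.\<close>

lemma nn_integral_gauss_radial:
  assumes I: "finite I" "I \<noteq> {}" and f[measurable]: "f \<in> borel_measurable (PiM I (\<lambda>_. borel))"
    and hom: "\<And>u x. u > 0 \<Longrightarrow> f (\<lambda>i\<in>I. u * x i) = f x"
    and a: "real (card I) / 2 + a > 0"
  shows "(\<integral>\<^sup>+x. f x * ennreal ((\<Sum>i\<in>I. (x i)\<^sup>2) powr a) \<partial>gauss I)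
    = ennreal (2 powr a * Gamma (real (card I) / 2 + a) / Gamma (real (card I) / 2)) * (\<integral>\<^sup>+x. f x \<partial>gauss I)"
proof -
  let ?q = "\<lambda>x::'a \<Rightarrow> real. \<Sum>i\<in>I. (x i)\<^sup>2"
  let ?D = "real (card I)"
  have D: "?D > 0" using I by (simp add: card_gt_0_iff)
  obtain K where K: "\<And>h. h \<in> borel_measurable borel \<Longrightarrow> (\<integral>\<^sup>+x. f x * h (?q x) \<partial>lborel_Pi I)
    = K * (\<integral>\<^sup>+v. ennreal (v powr (?D / 2 - 1)) * indicator {0<..} v * h v \<partial>lborel)"
    using nn_integral_lborel_Pi_radial[OF I f hom] by blast
  have mom: "(\<integral>\<^sup>+x. f x * ennreal (?q x powr b) \<partial>gauss I)
    = K * ennreal (2 powr (?D / 2 + b) * Gamma (?D / 2 + b) / sqrt (2 * pi) ^ card I)"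
    if b: "?D / 2 + b > 0" for b
  proof -
    let ?z = "?D / 2 + b"
    let ?h = "\<lambda>v. ennreal (exp (- v / 2) / sqrt (2 * pi) ^ card I * v powr b)"
    have "(\<integral>\<^sup>+x. f x * ennreal (?q x powr b) \<partial>gauss I) = (\<integral>\<^sup>+x. f x * ?h (?q x) \<partial>lborel_Pi I)"
    proof (subst nn_integral_gauss[OF I(1)], measurable, rule nn_integral_cong)
      fix x :: "'a \<Rightarrow> real"
      show "ennreal (exp (- ?q x / 2) / sqrt (2 * pi) ^ card I) * (f x * ennreal (?q x powr b)) = f x * ?h (?q x)"
        by (subst ennreal_mult) (simp_all add: mult_ac)
    qed
    also have "\<dots> = K * (\<integral>\<^sup>+v. ennreal (v powr (?D / 2 - 1)) * indicator {0<..} v * ?h v \<partial>lborel)"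
      by (rule K) measurable
    also have "(\<integral>\<^sup>+v. ennreal (v powr (?D / 2 - 1)) * indicator {0<..} v * ?h v \<partial>lborel)
      = ennreal 2 * (\<integral>\<^sup>+v. ennreal ((2 * v) powr (?D / 2 - 1)) * indicator {0<..} (2 * v) * ?h (2 * v) \<partial>lborel)"
      using nn_integral_real_affine[of "\<lambda>v. ennreal (v powr (?D / 2 - 1)) * indicator {0<..} v * ?h v" 2 0]
      by simp
    also have "\<dots> = ennreal 2 * (\<integral>\<^sup>+v. ennreal (2 powr (?z - 1) / sqrt (2 * pi) ^ card I) * ennreal (indicator {0..} v * v powr (?z - 1) / exp v) \<partial>lborel)"
    proof (intro arg_cong[where f = "(*) (ennreal 2)"] nn_integral_cong)
      fix v :: real
      have "(2 * v) powr (?D / 2 - 1) * (exp (- (2 * v) / 2) / sqrt (2 * pi) ^ card I * (2 * v) powr b)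
        = 2 powr (?z - 1) / sqrt (2 * pi) ^ card I * (v powr (?z - 1) / exp v)" if "v > 0"
      proof -
        have "(2 * v) powr (?D / 2 - 1) * (2 * v) powr b = 2 powr (?z - 1) * v powr (?z - 1)"
          using that unfolding powr_mult[of 2 v, symmetric] powr_add[symmetric] by (simp add: algebra_simps)
        then show ?thesis by (simp add: exp_minus field_simps)
      qed
      then show "ennreal ((2 * v) powr (?D / 2 - 1)) * indicator {0<..} (2 * v) * ?h (2 * v)
        = ennreal (2 powr (?z - 1) / sqrt (2 * pi) ^ card I) * ennreal (indicator {0..} v * v powr (?z - 1) / exp v)"
        by (cases "v > 0"; cases "v = 0") (auto simp: ennreal_mult[symmetric] indicator_def)
    qed
    also have "\<dots> = ennreal 2 * (ennreal (2 powr (?z - 1) / sqrt (2 * pi) ^ card I) * ennreal (Gamma ?z))"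
      using b by (subst nn_integral_cmult) (auto simp: Gamma_conv_nn_integral_real)
    also have "\<dots> = ennreal (2 powr ?z * Gamma ?z / sqrt (2 * pi) ^ card I)"
    proof -
      have "ennreal 2 * (ennreal (2 powr (?z - 1) / sqrt (2 * pi) ^ card I) * ennreal (Gamma ?z))
        = ennreal (2 * (2 powr (?z - 1) / sqrt (2 * pi) ^ card I * Gamma ?z))"
        by (subst ennreal_mult', simp, subst ennreal_mult', simp, rule refl)
      also have "2 * (2 powr (?z - 1) / sqrt (2 * pi) ^ card I * Gamma ?z) = 2 powr ?z * Gamma ?z / sqrt (2 * pi) ^ card I"
        by (simp add: powr_diff)
      finally show ?thesis .
    qed
    finally show ?thesis .
  qed
  have "2 powr (?D / 2 + a) * Gamma (?D / 2 + a) / sqrt (2 * pi) ^ card I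
    = (2 powr a * Gamma (?D / 2 + a) / Gamma (?D / 2)) * (2 powr (?D / 2) * Gamma (?D / 2) / sqrt (2 * pi) ^ card I)"
  proof -
    have "Gamma (?D / 2) \<noteq> 0" using Gamma_real_pos[OF half_gt_zero[OF D]] by linarith
    then show ?thesis by (simp only: powr_add) (simp add: field_simps)
  qed
  then have c: "ennreal (2 powr (?D / 2 + a) * Gamma (?D / 2 + a) / sqrt (2 * pi) ^ card I)
    = ennreal (2 powr a * Gamma (?D / 2 + a) / Gamma (?D / 2)) * ennreal (2 powr (?D / 2) * Gamma (?D / 2) / sqrt (2 * pi) ^ card I)"
    using D a Gamma_real_pos[of "?D / 2"] Gamma_real_pos[of "?D / 2 + a"]
    by (subst ennreal_mult'[symmetric]) auto
  \<comment> \<open>Since \<open>0 powr 0 = 0\<close>, the factor \<open>?q x powr 0\<close> may be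
    inserted only off the origin.\<close>
  have "AE x in gauss I. ?q x > 0"
    using I by (intro AE_gauss_sum_squares_pos) auto
  then have "(\<integral>\<^sup>+x. f x \<partial>gauss I) = (\<integral>\<^sup>+x. f x * ennreal (?q x powr 0) \<partial>gauss I)"
    by (intro nn_integral_cong_AE) auto
  also have "\<dots> = K * ennreal (2 powr (?D / 2) * Gamma (?D / 2) / sqrt (2 * pi) ^ card I)"
    using mom[of 0] D by simp
  finally show ?thesis unfolding mom[OF a] c by (simp add: mult_ac)
qed

subsection \<open>Gram determinants and reflections\<close>

text \<open>The matrix is a unipotent upper block triangular matrix times a lower block triangular
  one that carries the Schur complement of the corner entry.\<close>

lemma det_mat_Suc_Schur:
  fixes f :: "nat \<times> nat \<Rightarrow> real"
  assumes q: "f (p, p) \<noteq> 0"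
  shows "Determinant.det (mat (Suc p) (Suc p) f) =
    f (p, p) * Determinant.det (mat p p (\<lambda>(a, b). f (a, b) - f (a, p) * f (p, b) / f (p, p)))"
proof -
  define S where "S = mat p p (\<lambda>(a, b). f (a, b) - f (a, p) * f (p, b) / f (p, p))"
  define v where "v = mat p 1 (\<lambda>(a, _). f (a, p) / f (p, p))"
  define c where "c = mat 1 p (\<lambda>(_, b). f (p, b))"
  define Q where "Q = mat 1 1 (\<lambda>_. f (p, p))"
  have [simp]: "S \<in> carrier_mat p p" "v \<in> carrier_mat p 1" "c \<in> carrier_mat 1 p" "Q \<in> carrier_mat 1 1"
    "v \<in> carrier_mat p (Suc 0)" "c \<in> carrier_mat (Suc 0) p" "Q \<in> carrier_mat (Suc 0) (Suc 0)"
    by (auto simp: S_def v_def c_def Q_def)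
  have S_Q: "S \<in> carrier_mat p p" "Q \<in> carrier_mat 1 1"
    by (auto simp: S_def Q_def)
  let ?L = "four_block_mat (1\<^sub>m p) v (0\<^sub>m 1 p) (1\<^sub>m 1)"
  let ?D = "four_block_mat S (0\<^sub>m p 1) c Q"
  have car: "?L \<in> carrier_mat (Suc p) (Suc p)" "?D \<in> carrier_mat (Suc p) (Suc p)"
    using four_block_carrier_mat[of "1\<^sub>m p" p p "1\<^sub>m 1" 1 1 v "0\<^sub>m 1 p", OF one_carrier_mat one_carrier_mat]
      four_block_carrier_mat[of S p p Q 1 1 "0\<^sub>m p 1" c, OF S_Q]
    by simp_all
  have "?L * ?D = four_block_mat (S + v * c) (v * Q) c Q"
    by (subst mult_four_block_mat[of _ p p _ 1 _ 1 _ _ p _ 1]) 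
      (auto simp: left_mult_one_mat[of S p p] left_mult_one_mat[of c _ p] left_mult_one_mat[of Q _ 1]
        left_mult_zero_mat[of S p p] left_add_zero_mat[of c _ p] left_add_zero_mat[of Q _ 1]
        left_add_zero_mat[OF mult_carrier_mat, of v p 1 Q])
  also have "\<dots> = mat (Suc p) (Suc p) f"
  proof (rule eq_matI)
    fix i j assume "i < dim_row (mat (Suc p) (Suc p) f)" "j < dim_col (mat (Suc p) (Suc p) f)"
    then show "four_block_mat (S + v * c) (v * Q) c Q $$ (i, j) = mat (Suc p) (Suc p) f $$ (i, j)"
      using q by (auto simp: S_def v_def c_def Q_def scalar_prod_def less_Suc_eq)
  qed (auto simp: S_def v_def c_def Q_def)
  finally have "Determinant.det (mat (Suc p) (Suc p) f) = Determinant.det ?L * Determinant.det ?D"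
    using det_mult[OF car] by simp
  also have "Determinant.det ?L = 1"
    by (subst det_four_block_mat_lower_left_zero[where n = p and m = 1]) auto
  also have "Determinant.det ?D = Determinant.det S * f (p, p)"
    by (subst det_four_block_mat_upper_right_zero_col[where n = p]) (auto simp: Q_def det_single)
  finally show ?thesis by (simp add: S_def)
qed

definition gram :: "nat \<Rightarrow> 'r set \<Rightarrow> ('r \<times> nat \<Rightarrow> real) \<Rightarrow> real mat" where
  "gram p B Z = mat p p (\<lambda>(a, b). \<Sum>r\<in>B. Z (r, a) * Z (r, b))"

text \<open>This is the identity when \<open>u\<close> vanishes on \<open>B\<close>, since \<open>x / 0 = 0\<close>.\<close>

definition reflect :: "'r set \<Rightarrow> ('r \<Rightarrow> real) \<Rightarrow> ('r \<Rightarrow> real) \<Rightarrow> 'r \<Rightarrow> real" where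
  "reflect B u x r = x r - 2 * (\<Sum>s\<in>B. u s * x s) / (\<Sum>s\<in>B. (u s)\<^sup>2) * u r"

lemma reflect_cong: "(\<And>s. s \<in> B \<Longrightarrow> u s = u' s) \<Longrightarrow> (\<And>s. s \<in> B \<Longrightarrow> x s = y s) \<Longrightarrow> r \<in> B \<Longrightarrow>
  reflect B u x r = reflect B u' y r"
  unfolding reflect_def by (simp cong: sum.cong)

lemma reflect_add: "reflect B u (\<lambda>s. x s + y s) r = reflect B u x r + reflect B u y r"
  by (simp add: reflect_def algebra_simps sum.distrib add_divide_distrib)

lemma sum_square_zero:
  "finite B \<Longrightarrow> (\<Sum>s\<in>B. (u s)\<^sup>2) = (0::real) \<Longrightarrow> s \<in> B \<Longrightarrow> u s = 0"
  by (simp add: sum_nonneg_eq_0_iff)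

lemma reflect_inner:
  assumes B: "finite B"
  shows "(\<Sum>r\<in>B. reflect B u x r * reflect B u y r) = (\<Sum>r\<in>B. x r * y r)"
proof (cases "(\<Sum>s\<in>B. (u s)\<^sup>2) = 0")
  case True
  then show ?thesis by (simp add: reflect_def)
next
  case False
  define N where "N = (\<Sum>s\<in>B. (u s)\<^sup>2)"
  define X where "X = (\<Sum>s\<in>B. u s * x s)"
  define Y where "Y = (\<Sum>s\<in>B. u s * y s)"
  have "reflect B u x r * reflect B u y r
    = x r * y r - (2 * Y / N) * (u r * x r) - (2 * X / N) * (u r * y r) + (4 * X * Y / N\<^sup>2) * (u r)\<^sup>2" for r
    unfolding reflect_def N_def[symmetric] X_def[symmetric] Y_def[symmetric]
    by (simp add: algebra_simps power2_eq_square)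
  then have "(\<Sum>r\<in>B. reflect B u x r * reflect B u y r)
    = (\<Sum>r\<in>B. x r * y r) - (2 * Y / N) * X - (2 * X / N) * Y + (4 * X * Y / N\<^sup>2) * N"
    by (simp add: sum.distrib sum_subtractf N_def X_def Y_def sum_distrib_left)
  moreover have "N \<noteq> 0" using False by (simp add: N_def)
  ultimately show ?thesis by (simp add: power2_eq_square field_simps)
qed

lemma reflect_reflect:
  assumes B: "finite B"
  shows "reflect B u (reflect B u x) r = x r"
proof (cases "(\<Sum>s\<in>B. (u s)\<^sup>2) = 0")
  case True
  then show ?thesis by (simp add: reflect_def)
next
  case False
  define N where "N = (\<Sum>s\<in>B. (u s)\<^sup>2)"
  define X where "X = (\<Sum>s\<in>B. u s * x s)"
  have N: "N \<noteq> 0" using False by (simp add: N_def)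
  have r: "reflect B u x r = x r - 2 * X / N * u r" for r
    by (simp add: reflect_def N_def X_def)
  have "u s * reflect B u x s = u s * x s - 2 * X / N * (u s)\<^sup>2" for s
    by (simp add: r algebra_simps power2_eq_square)
  then have "(\<Sum>s\<in>B. u s * reflect B u x s) = X - 2 * X / N * N"
    by (simp add: sum_subtractf X_def N_def sum_distrib_left)
  then have "(\<Sum>s\<in>B. u s * reflect B u x s) = - X" using N by simp
  then have "reflect B u (reflect B u x) r = reflect B u x r + 2 * X / N * u r"
    by (subst reflect_def) (simp add: N_def)
  then show ?thesis by (simp add: r)
qed

text \<open>The reflection along this vector exchanges \<open>w\<close> and \<open>\<bar>w\<bar> e\<^sub>b\<close>.\<close>

definition householder :: "'r set \<Rightarrow> 'r \<Rightarrow> ('r \<Rightarrow> real) \<Rightarrow> 'r \<Rightarrow> real" where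
  "householder B b w r = w r - (if r = b then sqrt (\<Sum>s\<in>B. (w s)\<^sup>2) else 0)"

lemma reflect_householder_pivot:
  assumes B: "finite B" "b \<in> B" and q: "(\<Sum>s\<in>B. (w s)\<^sup>2) > 0"
  shows "reflect B (householder B b w) x b = (\<Sum>s\<in>B. w s * x s) / sqrt (\<Sum>s\<in>B. (w s)\<^sup>2)"
proof -
  define n where "n = sqrt (\<Sum>s\<in>B. (w s)\<^sup>2)"
  define u where "u = householder B b w"
  define X where "X = (\<Sum>s\<in>B. w s * x s)"
  have n: "n > 0" "n\<^sup>2 = (\<Sum>s\<in>B. (w s)\<^sup>2)" using q by (auto simp: n_def)
  have u: "u r = w r - (if r = b then n else 0)" for r by (simp add: u_def householder_def n_def)
  have "(u s)\<^sup>2 = (w s)\<^sup>2 + (if s = b then n\<^sup>2 - 2 * n * w s else 0)" for s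
    by (simp add: u power2_eq_square algebra_simps)
  then have uu: "(\<Sum>s\<in>B. (u s)\<^sup>2) = 2 * n * (n - w b)"
    using B by (simp add: sum.distrib n(2)[symmetric]) (simp add: power2_eq_square algebra_simps)
  have "u s * x s = w s * x s - (if s = b then n * x s else 0)" for s
    by (simp add: u algebra_simps)
  then have ux: "(\<Sum>s\<in>B. u s * x s) = X - n * x b"
    using B by (simp add: sum_subtractf X_def)
  show ?thesis
  proof (cases "w b = n")
    case True
    \<comment> \<open>In this case \<open>w\<close> is already the positive multiple of the pivot
      direction: the Householder vector is zero on \<open>B\<close> and the reflection is the
      identity.\<close>
    then have "u s = 0" if "s \<in> B" for s
      using sum_square_zero[OF B(1) _ that, of u] uu by simp
    then have "X = n * x b" using ux by simp
    moreover have "reflect B u x b = x b" using True by (simp add: reflect_def u)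
    ultimately show ?thesis using n by (simp add: u_def[symmetric] X_def[symmetric] n_def[symmetric])
  next
    case False
    have "reflect B u x b = x b - 2 * (X - n * x b) / (2 * n * (n - w b)) * (w b - n)"
      unfolding reflect_def uu ux by (simp add: u)
    also have "2 * (X - n * x b) / (2 * n * (n - w b)) * (w b - n) = - (X - n * x b) / n"
      using n False by (simp add: field_simps)
    finally have "reflect B u x b = X / n" using n by (simp add: field_simps)
    then show ?thesis by (simp add: u_def[symmetric] X_def[symmetric] n_def[symmetric])
  qed
qed

text \<open>The pivot entry already carries the whole norm of \<open>w\<close>, and a reflection
  preserves the norm, so nothing is left for the other entries.\<close>

lemma reflect_householder_self:
  assumes B: "finite B" "b \<in> B" and q: "(\<Sum>s\<in>B. (w s)\<^sup>2) > 0" and r: "r \<in> B"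
  shows "reflect B (householder B b w) w r = (if r = b then sqrt (\<Sum>s\<in>B. (w s)\<^sup>2) else 0)"
proof -
  let ?y = "reflect B (householder B b w) w"
  have b: "?y b = sqrt (\<Sum>s\<in>B. (w s)\<^sup>2)"
    using q by (subst reflect_householder_pivot[OF B q])
      (simp add: power2_eq_square[symmetric] real_div_sqrt less_imp_le)
  have "(\<Sum>s\<in>B. (?y s)\<^sup>2) = (\<Sum>s\<in>B. (w s)\<^sup>2)"
    using reflect_inner[OF B(1), of "householder B b w" w w] by (simp add: power2_eq_square)
  moreover have "(\<Sum>s\<in>B. (?y s)\<^sup>2) = (?y b)\<^sup>2 + (\<Sum>s\<in>B - {b}. (?y s)\<^sup>2)"
    using B by (simp add: sum.remove)
  ultimately have "(\<Sum>s\<in>B - {b}. (?y s)\<^sup>2) = 0" using q b by (simp add: less_imp_le)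
  then show ?thesis using sum_square_zero[of "B - {b}" ?y r] B r b by auto
qed

text \<open>The Schur complement of the last column is the Gram matrix of the other columns
  projected orthogonally to \<open>w\<close>. In coordinates where \<open>w\<close> points along
  \<open>b\<close>, that projection is the deletion of row \<open>b\<close>.\<close>

lemma det_gram_Suc:
  assumes B: "finite B" "b \<in> B" and q: "(\<Sum>s\<in>B. (w s)\<^sup>2) > 0"
    and Yw: "\<And>r. r \<in> B \<Longrightarrow> Y (r, p) = w r"
    and YZ: "\<And>r c. r \<in> B \<Longrightarrow> c < p \<Longrightarrow> Y (r, c) = Z (r, c)"
    and Z': "\<And>r c. r \<in> B \<Longrightarrow> c < p \<Longrightarrow> Z' (r, c) = reflect B (householder B b w) (\<lambda>s. Z (s, c)) r"
  shows "Determinant.det (gram (Suc p) B Y) = (\<Sum>s\<in>B. (w s)\<^sup>2) * Determinant.det (gram p (B - {b}) Z')"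
proof -
  let ?q = "\<Sum>s\<in>B. (w s)\<^sup>2"
  let ?f = "\<lambda>(a, b). \<Sum>r\<in>B. Y (r, a) * Y (r, b)"
  have qp: "?f (p, p) = ?q" using Yw by (simp add: power2_eq_square)
  have "mat p p (\<lambda>(a, b). ?f (a, b) - ?f (a, p) * ?f (p, b) / ?q) = gram p (B - {b}) Z'"
  proof (rule eq_matI)
    fix a c assume "a < dim_row (gram p (B - {b}) Z')" "c < dim_col (gram p (B - {b}) Z')"
    then have ac: "a < p" "c < p" by (auto simp: gram_def)
    have "(\<Sum>r\<in>B - {b}. Z' (r, a) * Z' (r, c)) = (\<Sum>r\<in>B. Z' (r, a) * Z' (r, c)) - Z' (b, a) * Z' (b, c)"
      using B by (simp add: sum.remove)
    also have "(\<Sum>r\<in>B. Z' (r, a) * Z' (r, c)) = (\<Sum>r\<in>B. Z (r, a) * Z (r, c))"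
      using ac by (simp add: Z' reflect_inner[OF B(1)])
    also have "Z' (b, a) * Z' (b, c) = (\<Sum>r\<in>B. w r * Z (r, a)) * (\<Sum>r\<in>B. w r * Z (r, c)) / ?q"
      using ac q by (simp add: Z' B reflect_householder_pivot[OF B q] less_imp_le)
    finally show "mat p p (\<lambda>(a, b). ?f (a, b) - ?f (a, p) * ?f (p, b) / ?q) $$ (a, c) = gram p (B - {b}) Z' $$ (a, c)"
      using ac by (simp add: gram_def YZ Yw mult.commute)
  qed (auto simp: gram_def)
  then show ?thesis
    using q det_mat_Suc_Schur[of ?f p] unfolding gram_def[of "Suc p"] qp by simp
qed

subsection \<open>Moments of Gaussian quadratic forms\<close>

lemma nn_integral_gauss_restrict:
  assumes "J \<subseteq> I" "finite I" and [measurable]: "f \<in> borel_measurable (PiM J (\<lambda>_. borel))"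
  shows "(\<integral>\<^sup>+x. f (restrict x J) \<partial>gauss I) = (\<integral>\<^sup>+x. f x \<partial>gauss J)"
proof -
  interpret N: product_prob_space "\<lambda>_::'a. std_normal_distribution"
    by (rule product_prob_space_std_normal)
  have [measurable]: "(\<lambda>x. restrict x J) \<in> gauss I \<rightarrow>\<^sub>M gauss J"
    unfolding gauss_def by (rule measurable_restrict_subset[OF assms(1)])
  have "(\<integral>\<^sup>+x. f x \<partial>gauss J) = (\<integral>\<^sup>+x. f x \<partial>distr (gauss I) (gauss J) (\<lambda>x. restrict x J))"
    unfolding gauss_def using N.distr_restrict[OF assms(1,2)] by simp
  also have "\<dots> = (\<integral>\<^sup>+x. f (restrict x J) \<partial>gauss I)"
    by (rule nn_integral_distr) measurable
  finally show ?thesis ..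
qed

lemma nn_integral_gauss_reindex:
  assumes f: "inj_on f I" and g: "g \<in> borel_measurable (PiM I (\<lambda>_. borel))"
  shows "(\<integral>\<^sup>+x. g (\<lambda>i\<in>I. x (f i)) \<partial>gauss (f ` I)) = (\<integral>\<^sup>+x. g x \<partial>gauss I)"
proof -
  have t: "(\<lambda>x. \<lambda>i\<in>I. x (f i)) \<in> gauss (f ` I) \<rightarrow>\<^sub>M gauss I"
    unfolding gauss_def by (intro measurable_restrict measurable_component_singleton) auto
  have "distr (gauss (f ` I)) (gauss I) (\<lambda>x. \<lambda>i\<in>I. x (f i)) = gauss I"
    unfolding gauss_def
    by (rule distr_PiM_reindex[where M = "\<lambda>_. std_normal_distribution"])
      (use f in \<open>auto intro: prob_space_normal_density\<close>)
  then have "(\<integral>\<^sup>+x. g x \<partial>gauss I) = (\<integral>\<^sup>+x. g x \<partial>distr (gauss (f ` I)) (gauss I) (\<lambda>x. \<lambda>i\<in>I. x (f i)))"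
    by simp
  also have "\<dots> = (\<integral>\<^sup>+x. g (\<lambda>i\<in>I. x (f i)) \<partial>gauss (f ` I))"
    by (rule nn_integral_distr[OF t]) (simp add: g measurable_cong_sets[OF sets_gauss refl])
  finally show ?thesis ..
qed

lemma nn_integral_gauss_fold:
  assumes "I \<inter> J = {}" "finite I" "finite J"
    and f: "f \<in> borel_measurable (PiM (I \<union> J) (\<lambda>_. borel))"
  shows "(\<integral>\<^sup>+x. f x \<partial>gauss (I \<union> J)) = (\<integral>\<^sup>+x. (\<integral>\<^sup>+y. f (merge I J (x, y)) \<partial>gauss J) \<partial>gauss I)"
proof -
  interpret N: product_sigma_finite "\<lambda>_::'a. std_normal_distribution"
    by (rule product_sigma_finite_std_normal)
  have "f \<in> borel_measurable (PiM (I \<union> J) (\<lambda>_. std_normal_distribution))"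
    using f by (simp add: measurable_cong_sets[OF sets_PiM_cong refl, of "I \<union> J" "I \<union> J" "\<lambda>_. std_normal_distribution" "\<lambda>_. borel"])
  then show ?thesis unfolding gauss_def by (rule N.product_nn_integral_fold[OF assms(1-3)])
qed

lemma nn_integral_gauss_blocks:
  assumes "finite J" "\<And>j. j \<in> J \<Longrightarrow> finite (B j)" "disjoint_family_on B J"
    and "\<And>j. j \<in> J \<Longrightarrow> g j \<in> borel_measurable (PiM (B j) (\<lambda>_. borel))"
  shows "(\<integral>\<^sup>+x. (\<Prod>j\<in>J. g j (restrict x (B j))) \<partial>gauss (\<Union>j\<in>J. B j)) = (\<Prod>j\<in>J. \<integral>\<^sup>+x. g j x \<partial>gauss (B j))"
  using assms
proof (induction J rule: finite_induct)
  case empty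
  then show ?case using prob_space.emeasure_space_1[OF prob_space_gauss[of "{}"]] by simp
next
  case (insert j J)
  let ?R = "\<Union>j\<in>J. B j"
  have disj: "B j \<inter> ?R = {}" "disjoint_family_on B J"
    using insert.prems(2) insert.hyps by (auto simp: disjoint_family_on_def)
  have gm: "(\<lambda>x. g i (restrict x (B i))) \<in> borel_measurable (PiM K (\<lambda>_. borel))" if "i \<in> insert j J" "B i \<subseteq> K" for i K
    by (rule measurable_compose[OF measurable_restrict_subset[OF that(2)] insert.prems(3)[OF that(1)]])
  have "(\<integral>\<^sup>+x. (\<Prod>i\<in>insert j J. g i (restrict x (B i))) \<partial>gauss (\<Union>i\<in>insert j J. B i))
    = (\<integral>\<^sup>+x. \<integral>\<^sup>+y. (\<Prod>i\<in>insert j J. g i (restrict (merge (B j) ?R (x, y)) (B i))) \<partial>gauss ?R \<partial>gauss (B j))"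
    unfolding UN_insert using insert disj
    by (intro nn_integral_gauss_fold) (auto intro!: borel_measurable_prod_ennreal gm borel_measurable_times_ennreal)
  also have "\<dots> = (\<integral>\<^sup>+x. \<integral>\<^sup>+y. g j x * (\<Prod>i\<in>J. g i (restrict y (B i))) \<partial>gauss ?R \<partial>gauss (B j))"
  proof (intro nn_integral_cong)
    fix x y :: "'b \<Rightarrow> real" assume x: "x \<in> space (gauss (B j))"
    have 1: "restrict (merge (B j) ?R (x, y)) (B j) = x"
      using x by (auto simp: merge_def extensional_def fun_eq_iff restrict_def)
    have 2: "restrict (merge (B j) ?R (x, y)) (B i) = restrict y (B i)" if "i \<in> J" for i
      using disj(1) that by (auto simp: merge_def fun_eq_iff restrict_def)
    show "(\<Prod>i\<in>insert j J. g i (restrict (merge (B j) ?R (x, y)) (B i))) = g j x * (\<Prod>i\<in>J. g i (restrict y (B i)))"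
      using insert.hyps 1 2 by simp
  qed
  also have "\<dots> = (\<integral>\<^sup>+x. g j x * (\<integral>\<^sup>+y. (\<Prod>i\<in>J. g i (restrict y (B i))) \<partial>gauss ?R) \<partial>gauss (B j))"
    by (intro nn_integral_cong nn_integral_cmult) (auto intro!: borel_measurable_prod_ennreal gm simp: measurable_cong_sets[OF sets_gauss refl])
  also have "\<dots> = (\<integral>\<^sup>+x. g j x \<partial>gauss (B j)) * (\<integral>\<^sup>+y. (\<Prod>i\<in>J. g i (restrict y (B i))) \<partial>gauss ?R)"
    using insert.prems(3)[of j] by (intro nn_integral_multc) (auto simp: measurable_cong_sets[OF sets_gauss refl])
  also have "(\<integral>\<^sup>+y. (\<Prod>i\<in>J. g i (restrict y (B i))) \<partial>gauss ?R) = (\<Prod>j\<in>J. \<integral>\<^sup>+x. g j x \<partial>gauss (B j))"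
    using insert disj by (intro insert.IH) auto
  finally show ?case using insert.hyps by simp
qed

lemma powr_sum_nonempty: "finite A \<Longrightarrow> A \<noteq> {} \<Longrightarrow> (x::real) powr (\<Sum>i\<in>A. f i) = (\<Prod>i\<in>A. x powr f i)"
  by (induction A rule: finite_ne_induct) (simp_all add: powr_add)

lemma nn_integral_gauss_power:
  assumes B: "finite B" "B \<noteq> {}" and a: "real (card B) / 2 + a > 0"
  shows "(\<integral>\<^sup>+x. ennreal ((\<Sum>i\<in>B. (x i)\<^sup>2) powr a) \<partial>gauss B)
    = ennreal (2 powr a * Gamma (real (card B) / 2 + a) / Gamma (real (card B) / 2))"
  using nn_integral_gauss_radial[OF B, of "\<lambda>_. 1" a] a
    prob_space.emeasure_space_1[OF prob_space_gauss[of B]] by simp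

lemma sum_card_le:
  fixes B :: "nat \<Rightarrow> 'r set"
  assumes R: "finite R" and BR: "\<And>i. i < k \<Longrightarrow> B i \<subseteq> R" and disj: "disjoint_family_on B {..<k}"
  shows "(\<Sum>i<k. real (card (B i))) \<le> real (card R)"
proof -
  have "(\<Sum>i<k. card (B i)) = card (\<Union>i<k. B i)"
    using disj BR finite_subset[OF _ R] by (subst card_UN_disjoint) (auto simp: disjoint_family_on_def)
  also have "\<dots> \<le> card R" using BR R by (intro card_mono) auto
  finally show ?thesis by (metis of_nat_sum of_nat_le_iff)
qed

text \<open>The integrand is invariant under scaling, hence independent of the total sum of squares
  over \<open>R\<close>. Multiplying by the matching power of that total cancels the denominator and
  leaves independent chi-square moments; dividing by the moment of the total gives the formula, as
  for Dirichlet variables. Coordinates of \<open>R\<close> outside all blocks enter through the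
  total only.\<close>

lemma nn_integral_gauss_dirichlet:
  fixes B :: "nat \<Rightarrow> 'r set"
  assumes k: "k > 0" and R: "finite R" and BR: "\<And>i. i < k \<Longrightarrow> B i \<subseteq> R"
    and disj: "disjoint_family_on B {..<k}" and ne: "\<And>i. i < k \<Longrightarrow> B i \<noteq> {}"
    and a: "\<And>i. i < k \<Longrightarrow> real (card (B i)) / 2 + a i > 0"
  shows "(\<integral>\<^sup>+x. ennreal ((\<Prod>i<k. (\<Sum>r\<in>B i. (x r)\<^sup>2) powr a i) * (\<Sum>r\<in>R. (x r)\<^sup>2) powr (- (\<Sum>i<k. a i))) \<partial>gauss R)
    = ennreal ((\<Prod>i<k. Gamma (real (card (B i)) / 2 + a i) / Gamma (real (card (B i)) / 2)) *
        (Gamma (real (card R) / 2) / Gamma (real (card R) / 2 + (\<Sum>i<k. a i))))"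
proof -
  let ?a = "\<Sum>i<k. a i" and ?q = "\<lambda>B x. \<Sum>r\<in>B. ((x::'r \<Rightarrow> real) r)\<^sup>2"
  define f where "f x = ennreal ((\<Prod>i<k. ?q (B i) x powr a i) * ?q R x powr (- ?a))" for x
  define G where "G i = Gamma (real (card (B i)) / 2 + a i) / Gamma (real (card (B i)) / 2)" for i
  define c where "c = Gamma (real (card R) / 2 + ?a) / Gamma (real (card R) / 2)"
  have fB: "finite (B i)" if "i < k" for i using BR[OF that] R finite_subset by blast
  have cardB: "0 < card (B i)" if "i < k" for i using fB ne that by (simp add: card_gt_0_iff)
  have Rne: "R \<noteq> {}" using BR[OF k] ne[OF k] by auto
  have kne: "{..<k} \<noteq> {}" using k by auto
  have Gpos: "G i > 0" if "i < k" for i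
    unfolding G_def using a[OF that] cardB[OF that] by (intro divide_pos_pos Gamma_real_pos) auto
  note sum_card_le[OF R BR disj]
  moreover have "0 < (\<Sum>i<k. real (card (B i)) / 2 + a i)"
    using a kne by (intro sum_pos) auto
  ultimately have Ra: "real (card R) / 2 + ?a > 0"
    by (simp add: sum.distrib sum_divide_distrib[symmetric])
  have cardR: "card R > 0" using R Rne by (simp add: card_gt_0_iff)
  have cpos: "c > 0" unfolding c_def using Ra cardR by (intro divide_pos_pos Gamma_real_pos) auto
  have meas_q: "(\<lambda>x. ?q (B i) x) \<in> borel_measurable (PiM K (\<lambda>_. borel))" if "B i \<subseteq> K" for i K
    using that by (intro borel_measurable_sum borel_measurable_power measurable_component_singleton) auto
  have meas_qR: "(\<lambda>x. ?q R x) \<in> borel_measurable (PiM R (\<lambda>_. borel))"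
    by (intro borel_measurable_sum borel_measurable_power measurable_component_singleton) auto
  have f: "f \<in> borel_measurable (PiM R (\<lambda>_. borel))"
    unfolding f_def using meas_q BR meas_qR by measurable
  have hom: "f (\<lambda>i\<in>R. u * x i) = f x" if u: "u > 0" for u x
  proof -
    have q: "?q S (\<lambda>i\<in>R. u * x i) = u\<^sup>2 * ?q S x" if "S \<subseteq> R" for S
      using that by (auto simp: sum_distrib_left power_mult_distrib intro!: sum.cong)
    have "(\<Prod>i<k. ?q (B i) (\<lambda>i\<in>R. u * x i) powr a i) = (\<Prod>i<k. (u\<^sup>2 * ?q (B i) x) powr a i)"
      by (intro prod.cong refl, subst q) (auto dest: BR)
    then have "(\<Prod>i<k. ?q (B i) (\<lambda>i\<in>R. u * x i) powr a i) * ?q R (\<lambda>i\<in>R. u * x i) powr (- ?a)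
      = (\<Prod>i<k. (u\<^sup>2 * ?q (B i) x) powr a i) * (u\<^sup>2 * ?q R x) powr (- ?a)"
      unfolding q[OF subset_refl] by simp
    also have "\<dots> = ((u\<^sup>2) powr ?a * (u\<^sup>2) powr (- ?a)) * ((\<Prod>i<k. ?q (B i) x powr a i) * ?q R x powr (- ?a))"
      using kne by (simp add: powr_mult prod.distrib powr_sum_nonempty mult_ac)
    also have "(u\<^sup>2) powr ?a * (u\<^sup>2) powr (- ?a) = 1"
      using u by (simp add: powr_add[symmetric])
    finally show ?thesis unfolding f_def by simp
  qed
  have "ennreal (2 powr ?a * c) * (\<integral>\<^sup>+x. f x \<partial>gauss R) = (\<integral>\<^sup>+x. f x * ennreal (?q R x powr ?a) \<partial>gauss R)"
    using nn_integral_gauss_radial[OF R Rne f hom Ra] by (simp add: c_def)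
  \<comment> \<open>The nested restriction lets the coordinates outside all blocks be integrated out
    first and the blocks be separated afterwards.\<close>
  also have "\<dots> = (\<integral>\<^sup>+x. (\<Prod>i<k. ennreal (?q (B i) (restrict (restrict x (\<Union>i<k. B i)) (B i)) powr a i)) \<partial>gauss R)"
  proof (rule nn_integral_cong)
    fix x :: "'r \<Rightarrow> real"
    have r: "restrict (restrict x (\<Union>i<k. B i)) (B i) r = x r" if "i < k" "r \<in> B i" for i r
      using that by auto
    have "f x * ennreal (?q R x powr ?a) = ennreal (\<Prod>i<k. ?q (B i) x powr a i)"
    proof (cases "?q R x = 0")
      case True
      \<comment> \<open>At the origin both sides are 0, because \<open>0 powr a = 0\<close> for
        every exponent.\<close>
      then have "?q (B 0) x = 0"
        using sum_square_zero[OF R True] BR[OF k] by (intro sum.neutral) auto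
      then have P0: "(\<Prod>i<k. ?q (B i) x powr a i) = 0" using k by (intro prod_zero) auto
      show ?thesis unfolding f_def P0 by simp
    next
      case False
      have "?q R x powr (- ?a) * ?q R x powr ?a = 1"
        using False by (simp add: powr_add[symmetric])
      then show ?thesis
        unfolding f_def by (subst ennreal_mult[symmetric]) (auto simp: mult.assoc intro!: prod_nonneg mult_nonneg_nonneg)
    qed
    also have "\<dots> = (\<Prod>i<k. ennreal (?q (B i) x powr a i))" by (subst prod_ennreal) auto
    also have "\<dots> = (\<Prod>i<k. ennreal (?q (B i) (restrict (restrict x (\<Union>i<k. B i)) (B i)) powr a i))"
      using r by (intro prod.cong refl) simp
    finally show "f x * ennreal (?q R x powr ?a) = (\<Prod>i<k. ennreal (?q (B i) (restrict (restrict x (\<Union>i<k. B i)) (B i)) powr a i))" .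
  qed
  also have "\<dots> = (\<integral>\<^sup>+x. (\<Prod>i<k. ennreal (?q (B i) (restrict x (B i)) powr a i)) \<partial>gauss (\<Union>i<k. B i))"
  proof (rule nn_integral_gauss_restrict)
    have "(\<lambda>x. ?q (B i) (restrict x (B i))) \<in> borel_measurable (PiM (\<Union>i<k. B i) (\<lambda>_. borel))" if "i < k" for i
      by (rule measurable_compose[OF measurable_restrict_subset meas_q]) (use that in auto)
    then show "(\<lambda>x. \<Prod>i<k. ennreal (?q (B i) (restrict x (B i)) powr a i)) \<in> borel_measurable (PiM (\<Union>i<k. B i) (\<lambda>_. borel))"
      by (intro borel_measurable_prod_ennreal) auto
  qed (use BR R in auto)
  also have "\<dots> = (\<Prod>i<k. \<integral>\<^sup>+x. ennreal (?q (B i) x powr a i) \<partial>gauss (B i))"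
  proof (rule nn_integral_gauss_blocks[where g = "\<lambda>i x. ennreal (?q (B i) x powr a i)"])
    fix i assume "i \<in> {..<k}"
    show "(\<lambda>x. ennreal (?q (B i) x powr a i)) \<in> borel_measurable (PiM (B i) (\<lambda>_. borel))"
      using meas_q[of i "B i"] by measurable
  qed (use disj fB in auto)
  also have "\<dots> = (\<Prod>i<k. ennreal (2 powr a i * G i))"
    using a fB ne by (intro prod.cong refl) (simp add: nn_integral_gauss_power G_def)
  also have "\<dots> = ennreal (2 powr ?a * (\<Prod>i<k. G i))"
    using Gpos kne by (subst prod_ennreal) (auto simp: prod.distrib powr_sum_nonempty less_imp_le)
  finally have *: "ennreal (2 powr ?a * c) * (\<integral>\<^sup>+x. f x \<partial>gauss R) = ennreal (2 powr ?a * (\<Prod>i<k. G i))" .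
  have "(\<integral>\<^sup>+x. f x \<partial>gauss R) = ennreal (1 / (2 powr ?a * c)) * (ennreal (2 powr ?a * c) * (\<integral>\<^sup>+x. f x \<partial>gauss R))"
    using cpos by (simp add: mult.assoc[symmetric] ennreal_mult'[symmetric])
  also have "\<dots> = ennreal (1 / (2 powr ?a * c) * (2 powr ?a * (\<Prod>i<k. G i)))"
    unfolding * using cpos by (intro ennreal_mult'[symmetric]) auto
  also have "1 / (2 powr ?a * c) * (2 powr ?a * (\<Prod>i<k. G i)) = (\<Prod>i<k. G i) * (1 / c)"
    using cpos by simp
  finally show ?thesis unfolding f_def G_def c_def by simp
qed

subsection \<open>Moments of Gram determinant ratios\<close>

lemma measurable_reflect_map:
  assumes "\<And>r. r \<in> R \<Longrightarrow> finite (Bl (\<iota> r)) \<and> Bl (\<iota> r) \<subseteq> R"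
  shows "(\<lambda>Z. \<lambda>(r, c)\<in>R \<times> C. reflect (Bl (\<iota> r)) (u (\<iota> r)) (\<lambda>s. Z (s, c)) r)
    \<in> PiM (R \<times> C) (\<lambda>_. borel) \<rightarrow>\<^sub>M PiM (R \<times> C) (\<lambda>_. borel)"
proof (rule measurable_restrict)
  fix rc assume "rc \<in> R \<times> C"
  then obtain r c where rc: "rc = (r, c)" "r \<in> R" "c \<in> C" by auto
  have "(\<lambda>Z. Z (s, c)) \<in> borel_measurable (PiM (R \<times> C) (\<lambda>_. borel))" if "s \<in> Bl (\<iota> r) \<or> s = r" for s
    using that assms[OF rc(2)] rc by (intro measurable_component_singleton) auto
  then show "(\<lambda>Z. case rc of (r, c) \<Rightarrow> reflect (Bl (\<iota> r)) (u (\<iota> r)) (\<lambda>s. Z (s, c)) r) \<in> borel_measurable (PiM (R \<times> C) (\<lambda>_. borel))"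
    unfolding rc reflect_def prod.case by measurable
qed

text \<open>Here \<open>\<iota>\<close> sends a row to its block, and the reflection vectors are
  constants. The map is therefore a fixed isometry that acts in the same way on every
  column.\<close>

lemma nn_integral_gauss_reflect:
  fixes Bl :: "'j \<Rightarrow> 'r set" and C :: "'c set"
  assumes J: "finite J" "\<And>j. j \<in> J \<Longrightarrow> finite (Bl j)" "disjoint_family_on Bl J" and C: "finite C"
    and R: "R = (\<Union>j\<in>J. Bl j)" and \<iota>: "\<And>j r. j \<in> J \<Longrightarrow> r \<in> Bl j \<Longrightarrow> \<iota> r = j"
    and f: "f \<in> borel_measurable (PiM (R \<times> C) (\<lambda>_. borel))"
  shows "(\<integral>\<^sup>+Z. f (\<lambda>(r, c)\<in>R \<times> C. reflect (Bl (\<iota> r)) (u (\<iota> r)) (\<lambda>s. Z (s, c)) r) \<partial>gauss (R \<times> C))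
    = (\<integral>\<^sup>+Z. f Z \<partial>gauss (R \<times> C))"
proof (rule nn_integral_gauss_isometry)
  let ?T = "\<lambda>Z. \<lambda>(r, c)\<in>R \<times> C. reflect (Bl (\<iota> r)) (u (\<iota> r)) (\<lambda>s. Z (s, c)) r"
  have blk: "finite (Bl (\<iota> r))" "Bl (\<iota> r) \<subseteq> R" "r \<in> Bl (\<iota> r)" if "r \<in> R" for r
    using that J \<iota> by (auto simp: R)
  have same: "\<iota> s = \<iota> r" if "r \<in> R" "s \<in> Bl (\<iota> r)" for r s
    using that \<iota> by (auto simp: R)
  have fR: "finite R" using J by (auto simp: R)
  show "finite (R \<times> C)" using fR C by simp
  show "?T \<in> PiM (R \<times> C) (\<lambda>_. borel) \<rightarrow>\<^sub>M PiM (R \<times> C) (\<lambda>_. borel)"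
    by (rule measurable_reflect_map) (use blk in auto)
  have T: "?T W (r, c) = reflect (Bl (\<iota> r)) (u (\<iota> r)) (\<lambda>s. W (s, c)) r" if "r \<in> R" "c \<in> C" for W r c
    using that by simp
  show "\<exists>c'. \<forall>Z\<in>extensional (R \<times> C). (\<lambda>i\<in>R \<times> C. ?T Z i + Y i) = ?T (\<lambda>i\<in>R \<times> C. Z i + c' i)"
    if "Y \<in> extensional (R \<times> C)" for Y
  \<comment> \<open>Each block reflection is linear and its own inverse, so translating by
    \<open>Y\<close> after the map is translating by the image of \<open>Y\<close> before
    it.\<close>
  proof (rule exI[where x = "?T Y"], rule ballI, rule ext)
    fix Z :: "'r \<times> 'c \<Rightarrow> real" and i
    show "(\<lambda>i\<in>R \<times> C. ?T Z i + Y i) i = ?T (\<lambda>i\<in>R \<times> C. Z i + ?T Y i) i"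
    proof (cases "i \<in> R \<times> C")
      case True
      then obtain r c where rc: "i = (r, c)" "r \<in> R" "c \<in> C" by auto
      let ?H = "reflect (Bl (\<iota> r)) (u (\<iota> r))"
      define W where "W = (\<lambda>i\<in>R \<times> C. Z i + ?T Y i)"
      have W: "W (s, c) = Z (s, c) + ?H (\<lambda>s. Y (s, c)) s" if s: "s \<in> Bl (\<iota> r)" for s
      proof -
        have sR: "s \<in> R" using s blk(2)[OF rc(2)] by auto
        then have "W (s, c) = Z (s, c) + ?T Y (s, c)" unfolding W_def using rc(3) by (intro restrict_apply') simp
        then show ?thesis unfolding T[OF sR rc(3), of Y] same[OF rc(2) s] .
      qed
      have "?T W i = ?H (\<lambda>s. W (s, c)) r"
        unfolding rc(1) by (rule T[OF rc(2,3), of W])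
      also have "\<dots> = ?H (\<lambda>s. Z (s, c) + ?H (\<lambda>s. Y (s, c)) s) r"
        by (rule reflect_cong[OF refl W blk(3)[OF rc(2)]])
      also have "\<dots> = ?H (\<lambda>s. Z (s, c)) r + Y (r, c)"
        using blk(1)[OF rc(2)] by (simp only: reflect_add reflect_reflect)
      finally have 1: "?T W i = ?H (\<lambda>s. Z (s, c)) r + Y (r, c)" .
      have "(\<lambda>i\<in>R \<times> C. ?T Z i + Y i) i = ?T Z (r, c) + Y (r, c)"
        using True unfolding rc(1) by (rule restrict_apply')
      also have "\<dots> = ?T W i" unfolding 1 T[OF rc(2,3), of Z] ..
      finally show ?thesis unfolding W_def .
    next
      case False
      then show ?thesis by (simp only: restrict_apply if_False)
    qed
  qed
  show "(\<Sum>i\<in>R \<times> C. (?T Z i)\<^sup>2) = (\<Sum>i\<in>R \<times> C. (Z i)\<^sup>2)" for Z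
  proof -
    have "(\<Sum>i\<in>R \<times> C. (?T Z i)\<^sup>2) = (\<Sum>c\<in>C. \<Sum>r\<in>R. (reflect (Bl (\<iota> r)) (u (\<iota> r)) (\<lambda>s. Z (s, c)) r)\<^sup>2)"
      by (subst sum.swap) (simp add: sum.cartesian_product case_prod_unfold)
    also have "\<dots> = (\<Sum>c\<in>C. \<Sum>r\<in>R. (Z (r, c))\<^sup>2)"
    proof (rule sum.cong[OF refl])
      fix c
      have "(\<Sum>r\<in>R. (reflect (Bl (\<iota> r)) (u (\<iota> r)) (\<lambda>s. Z (s, c)) r)\<^sup>2)
        = (\<Sum>j\<in>J. \<Sum>r\<in>Bl j. (reflect (Bl (\<iota> r)) (u (\<iota> r)) (\<lambda>s. Z (s, c)) r)\<^sup>2)"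
        unfolding R using J by (intro sum.UNION_disjoint) (auto simp: disjoint_family_on_def)
      also have "\<dots> = (\<Sum>j\<in>J. \<Sum>r\<in>Bl j. (reflect (Bl j) (u j) (\<lambda>s. Z (s, c)) r)\<^sup>2)"
        using \<iota> by (intro sum.cong refl) auto
      also have "\<dots> = (\<Sum>j\<in>J. \<Sum>r\<in>Bl j. (Z (r, c))\<^sup>2)"
        unfolding power2_eq_square using J by (intro sum.cong[OF refl] reflect_inner)
      also have "\<dots> = (\<Sum>r\<in>R. (Z (r, c))\<^sup>2)"
        unfolding R using J by (intro sum.UNION_disjoint[symmetric]) (auto simp: disjoint_family_on_def)
      finally show "(\<Sum>r\<in>R. (reflect (Bl (\<iota> r)) (u (\<iota> r)) (\<lambda>s. Z (s, c)) r)\<^sup>2) = (\<Sum>r\<in>R. (Z (r, c))\<^sup>2)" .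
    qed
    also have "\<dots> = (\<Sum>i\<in>R \<times> C. (Z i)\<^sup>2)"
      by (subst sum.swap) (simp add: sum.cartesian_product case_prod_unfold)
    finally show ?thesis .
  qed
qed fact

lemma gram_cong:
  "(\<And>r c. r \<in> B \<Longrightarrow> c < p \<Longrightarrow> Y (r, c) = Z (r, c)) \<Longrightarrow> gram p B Y = gram p B Z"
  unfolding gram_def by (intro cong_mat refl) (auto intro!: sum.cong)

lemma borel_measurable_det_mat:
  fixes f :: "'x \<Rightarrow> nat \<Rightarrow> nat \<Rightarrow> real"
  assumes f: "\<And>a b. a < p \<Longrightarrow> b < p \<Longrightarrow> (\<lambda>x. f x a b) \<in> borel_measurable M"
  shows "(\<lambda>x. Determinant.det (mat p p (\<lambda>(a, b). f x a b))) \<in> borel_measurable M"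
proof -
  have "(\<lambda>x. Determinant.det (mat p p (\<lambda>(a, b). f x a b))) =
    (\<lambda>x. \<Sum>\<pi>\<in>{\<pi>. \<pi> permutes {0..<p}}. signof \<pi> * (\<Prod>i = 0..<p. f x i (\<pi> i)))"
    by (subst det_def'[OF mat_carrier]) (auto intro!: sum.cong prod.cong ext)
  then show ?thesis
  proof (simp only:, intro borel_measurable_sum borel_measurable_times borel_measurable_const borel_measurable_prod)
    fix \<pi> i assume *: "\<pi> \<in> {\<pi>. \<pi> permutes {0..<p}}" "i \<in> {0..<p}"
    then have "\<pi> i < p" using permutes_in_image[of \<pi> "{0..<p}" i] by auto
    then show "(\<lambda>x. f x i (\<pi> i)) \<in> borel_measurable M" using * f by auto
  qed
qed

lemma borel_measurable_det_gram:
  assumes "B \<subseteq> R"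
  shows "(\<lambda>Z. Determinant.det (gram p B Z)) \<in> borel_measurable (PiM (R \<times> {..<p}) (\<lambda>_. borel))"
  unfolding gram_def using assms
  by (intro borel_measurable_det_mat borel_measurable_sum borel_measurable_times measurable_component_singleton) auto

text \<open>General exponents make the family closed under powers: the moments of Bartlett's
  statistic are first moments of this function with rescaled \<open>a\<close>. The pooled set
  \<open>R\<close> is a separate parameter because it outgrows the union of the blocks during the
  induction.\<close>

definition gram_ratio :: "nat \<Rightarrow> nat \<Rightarrow> (nat \<Rightarrow> 'r set) \<Rightarrow> (nat \<Rightarrow> real) \<Rightarrow> 'r set \<Rightarrow> ('r \<times> nat \<Rightarrow> real) \<Rightarrow> real" where
  "gram_ratio k p B a R Z =
    (\<Prod>i<k. Determinant.det (gram p (B i) Z) powr a i) * Determinant.det (gram p R Z) powr (- (\<Sum>i<k. a i))"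

lemma borel_measurable_gram_ratio:
  assumes "\<And>i. i < k \<Longrightarrow> B i \<subseteq> R"
  shows "gram_ratio k p B a R \<in> borel_measurable (PiM (R \<times> {..<p}) (\<lambda>_. borel))"
  unfolding gram_ratio_def using assms
  by (intro borel_measurable_times borel_measurable_prod powr_real_measurable borel_measurable_det_gram borel_measurable_const) auto

lemma gram_ratio_cong:
  assumes "\<And>i. i < k \<Longrightarrow> B i \<subseteq> R" and "\<And>r c. r \<in> R \<Longrightarrow> c < p \<Longrightarrow> Y (r, c) = Z (r, c)"
  shows "gram_ratio k p B a R Y = gram_ratio k p B a R Z"
proof -
  have "gram p (B i) Y = gram p (B i) Z" if "i < k" for i
    using assms(1)[OF that] assms(2) by (intro gram_cong) auto
  moreover have "gram p R Y = gram p R Z" using assms(2) by (intro gram_cong) auto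
  ultimately show ?thesis by (simp add: gram_ratio_def)
qed

lemma Un_blocks_eq:
  fixes B :: "nat \<Rightarrow> 'r set"
  assumes "\<And>i. i < k \<Longrightarrow> B i \<subseteq> R"
  shows "(\<Union>j\<le>k. if j < k then B j else R - (\<Union>i<k. B i)) = R"
proof -
  have "(\<Union>j\<le>k. if j < k then B j else R - (\<Union>i<k. B i)) = (\<Union>j<k. B j) \<union> (R - (\<Union>i<k. B i))"
    by (auto simp: le_less)
  then show ?thesis using assms by auto
qed

text \<open>All reflections depend only on the fixed last column \<open>w\<close>. The array
  \<open>Z1\<close> is adapted to every block at once; the rotated column \<open>w1\<close> is then
  zero on each \<open>B i - {b i}\<close>, so the second reflection, which produces the pooled Schur
  complement, fixes every row that the block determinants still use.\<close>

lemma gram_ratio_Suc: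
  fixes B :: "nat \<Rightarrow> 'r set" and w :: "'r \<Rightarrow> real"
  assumes k: "k > 0" and R: "finite R" and BR: "\<And>i. i < k \<Longrightarrow> B i \<subseteq> R"
    and disj: "disjoint_family_on B {..<k}" and b: "\<And>i. i < k \<Longrightarrow> b i \<in> B i"
    and w: "\<And>i. i < k \<Longrightarrow> (\<Sum>r\<in>B i. (w r)\<^sup>2) > 0"
    and Bl: "Bl = (\<lambda>i. if i < k then B i else R - (\<Union>i<k. B i))"
    and \<iota>: "\<And>j r. j \<le> k \<Longrightarrow> r \<in> Bl j \<Longrightarrow> \<iota> r = j"
    and u: "u = (\<lambda>i. if i < k then householder (B i) (b i) w else (\<lambda>_. 0))"
    and Y: "\<And>r. r \<in> R \<Longrightarrow> Y (r, p) = w r" "\<And>r c. r \<in> R \<Longrightarrow> c < p \<Longrightarrow> Y (r, c) = Z (r, c)"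
    and Z1: "\<And>r c. r \<in> R \<Longrightarrow> c < p \<Longrightarrow> Z1 (r, c) = reflect (Bl (\<iota> r)) (u (\<iota> r)) (\<lambda>s. Z (s, c)) r"
    and w1: "w1 = (\<lambda>r. reflect (Bl (\<iota> r)) (u (\<iota> r)) w r)"
    and Z2: "\<And>r c. r \<in> R \<Longrightarrow> c < p \<Longrightarrow> Z2 (r, c) = reflect R (householder R (b 0) w1) (\<lambda>s. Z1 (s, c)) r"
  shows "gram_ratio k (Suc p) B a R Y =
    (\<Prod>i<k. (\<Sum>r\<in>B i. (w r)\<^sup>2) powr a i) * (\<Sum>r\<in>R. (w r)\<^sup>2) powr (- (\<Sum>i<k. a i)) *
    gram_ratio k p (\<lambda>i. B i - {b i}) a (R - {b 0}) Z2"
proof -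
  have fB: "finite (B i)" if "i < k" for i using BR[OF that] R finite_subset by blast
  have R_eq: "R = (\<Union>j\<le>k. Bl j)" unfolding Bl by (rule Un_blocks_eq[OF BR, symmetric])
  have \<iota>B: "\<iota> r = i" if "i < k" "r \<in> B i" for i r
    using \<iota>[of i r] that by (simp add: Bl)
  have ref_B: "reflect (Bl (\<iota> r)) (u (\<iota> r)) x r = reflect (B i) (householder (B i) (b i) w) x r"
    if "i < k" "r \<in> B i" for i r x
    using that by (simp add: \<iota>B Bl u)
  have ref_E: "reflect (Bl (\<iota> r)) (u (\<iota> r)) x r = x r" if "r \<in> Bl k" for r x
    using \<iota>[OF le_refl that] by (simp add: u reflect_def)
  have blocks: "(\<Sum>r\<in>R. h r) = (\<Sum>j\<le>k. \<Sum>r\<in>Bl j. h r)" for h :: "'r \<Rightarrow> real"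
    unfolding R_eq
  proof (rule sum.UNION_disjoint)
    show "\<forall>i\<in>{..k}. finite (Bl i)" using fB R by (auto simp: Bl)
    show "\<forall>i\<in>{..k}. \<forall>j\<in>{..k}. i \<noteq> j \<longrightarrow> Bl i \<inter> Bl j = {}" using \<iota> by (metis atMost_iff disjoint_iff)
  qed simp
  have inner: "(\<Sum>r\<in>R. reflect (Bl (\<iota> r)) (u (\<iota> r)) x r * reflect (Bl (\<iota> r)) (u (\<iota> r)) y r) = (\<Sum>r\<in>R. x r * y r)" for x y
    unfolding blocks
  proof (rule sum.cong[OF refl])
    fix j assume "j \<in> {..k}"
    then have j: "j \<le> k" by simp
    have "finite (Bl j)" using fB R by (auto simp: Bl)
    then show "(\<Sum>r\<in>Bl j. reflect (Bl (\<iota> r)) (u (\<iota> r)) x r * reflect (Bl (\<iota> r)) (u (\<iota> r)) y r) = (\<Sum>r\<in>Bl j. x r * y r)"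
      using \<iota>[OF j] by (simp add: reflect_inner)
  qed
  have w1_B: "w1 r = (if r = b i then sqrt (\<Sum>s\<in>B i. (w s)\<^sup>2) else 0)" if "i < k" "r \<in> B i" for i r
    unfolding w1 ref_B[OF that] by (rule reflect_householder_self[OF fB[OF that(1)] b[OF that(1)] w[OF that(1)] that(2)])
  have w1_sq: "(\<Sum>r\<in>R. (w1 r)\<^sup>2) = (\<Sum>r\<in>R. (w r)\<^sup>2)"
    using inner[of w w] by (simp add: w1 power2_eq_square)
  have b0: "b 0 \<in> R" using b[OF k] BR[OF k] by auto
  have bB: "b 0 \<notin> B i - {b i}" if "i < k" for i
    using \<iota>B[OF that, of "b 0"] \<iota>B[OF k b[OF k]] by auto
  have wR: "(\<Sum>r\<in>R. (w r)\<^sup>2) > 0"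
    using w[OF k] sum_mono2[OF R BR[OF k], of "\<lambda>r. (w r)\<^sup>2"] by simp
  have det_B: "Determinant.det (gram (Suc p) (B i) Y) = (\<Sum>s\<in>B i. (w s)\<^sup>2) * Determinant.det (gram p (B i - {b i}) Z2)"
    if i: "i < k" for i
  proof -
    have "Determinant.det (gram (Suc p) (B i) Y) = (\<Sum>s\<in>B i. (w s)\<^sup>2) * Determinant.det (gram p (B i - {b i}) Z1)"
      using BR[OF i] Y Z1 ref_B[OF i]
      by (intro det_gram_Suc[OF fB[OF i] b[OF i] w[OF i], where Z = Z]) auto
    also have "gram p (B i - {b i}) Z1 = gram p (B i - {b i}) Z2"
    proof (rule gram_cong)
      fix r c assume r: "r \<in> B i - {b i}" and c: "c < p"
      then have "r \<in> R" using BR[OF i] by auto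
      have "householder R (b 0) w1 r = 0"
        using r bB[OF i] w1_B[OF i, of r] by (auto simp: householder_def)
      then show "Z1 (r, c) = Z2 (r, c)"
        unfolding Z2[OF \<open>r \<in> R\<close> c] by (simp add: reflect_def)
    qed
    finally show ?thesis .
  qed
  \<comment> \<open>This is \<open>Y\<close> after the blockwise rotation, last column included. The
    rotation preserves the pooled Gram matrix, so the pooled Schur complement may be taken from
    \<open>Y1\<close>, whose last column is \<open>w1\<close>.\<close>
  define Y1 where "Y1 = (\<lambda>(r, c). if c = p then w1 r else Z1 (r, c))"
  have det_R: "Determinant.det (gram (Suc p) R Y) = (\<Sum>s\<in>R. (w s)\<^sup>2) * Determinant.det (gram p (R - {b 0}) Z2)"
  proof -
    have "gram (Suc p) R Y1 = gram (Suc p) R Y"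
    proof -
      have "Y1 (r, c) = reflect (Bl (\<iota> r)) (u (\<iota> r)) (\<lambda>s. Y (s, c)) r" if r: "r \<in> R" and c: "c < Suc p" for r c
      proof -
        have "Bl (\<iota> r) \<subseteq> R" "r \<in> Bl (\<iota> r)" using r \<iota> unfolding R_eq by auto
        moreover have "Y (s, c) = (if c = p then w s else Z (s, c))" if "s \<in> R" for s
          using Y that c by (auto simp: less_Suc_eq)
        ultimately have "reflect (Bl (\<iota> r)) (u (\<iota> r)) (\<lambda>s. Y (s, c)) r
          = reflect (Bl (\<iota> r)) (u (\<iota> r)) (\<lambda>s. if c = p then w s else Z (s, c)) r"
          by (intro reflect_cong) auto
        then show ?thesis using r c Z1[of r c] by (auto simp: Y1_def w1 less_Suc_eq)
      qed
      then have "(\<Sum>r\<in>R. Y1 (r, a) * Y1 (r, c)) = (\<Sum>r\<in>R. Y (r, a) * Y (r, c))" if "a < Suc p" "c < Suc p" for a c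
        using inner[of "\<lambda>s. Y (s, a)" "\<lambda>s. Y (s, c)"] that by simp
      then show ?thesis unfolding gram_def by (intro cong_mat refl) auto
    qed
    moreover have "Determinant.det (gram (Suc p) R Y1) = (\<Sum>s\<in>R. (w1 s)\<^sup>2) * Determinant.det (gram p (R - {b 0}) Z2)"
      using wR w1_sq Z2 by (intro det_gram_Suc[OF R b0, where Z = Z1]) (auto simp: Y1_def)
    ultimately show ?thesis by (simp add: w1_sq)
  qed
  show ?thesis
    unfolding gram_ratio_def det_R by (simp add: det_B powr_mult prod.distrib mult_ac)
qed


text \<open>The index \<open>k\<close> stands for the rows that lie in no block; it also guarantees
  that the \<open>LEAST\<close> in the witness ranges over a nonempty set.\<close>

lemma disjoint_family_on_index:
  fixes B :: "nat \<Rightarrow> 'r set"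
  assumes disj: "disjoint_family_on B {..<k}"
  shows "\<exists>\<iota>. \<forall>j\<le>k. \<forall>r\<in>(if j < k then B j else R - (\<Union>i<k. B i)). \<iota> r = j"
proof (intro exI[where x = "\<lambda>r. LEAST i. i = k \<or> i < k \<and> r \<in> B i"] allI impI ballI)
  fix j r assume j: "j \<le> k" and r: "r \<in> (if j < k then B j else R - (\<Union>i<k. B i))"
  show "(LEAST i. i = k \<or> i < k \<and> r \<in> B i) = j"
  proof (rule Least_equality)
    show "j = k \<or> j < k \<and> r \<in> B j" using j r by (auto split: if_splits)
    fix i assume i: "i = k \<or> i < k \<and> r \<in> B i"
    show "j \<le> i"
    proof (rule ccontr)
      assume "\<not> j \<le> i"
      then have "i < k" "r \<in> B i" "i \<noteq> j" using i j by auto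
      then show False using r disj by (auto simp: disjoint_family_on_def split: if_splits)
    qed
  qed
qed

text \<open>Given the last column, the reflections are fixed isometries, and the remaining columns
  keep their standard normal law. The inner integral is thus a function of the last column times a
  constant, and the two integrate separately. Each peeling lowers every degree of freedom by one,
  hence the shifts by \<open>j\<close>; the condition on \<open>a i\<close> is positivity of the
  smallest Gamma argument, at \<open>j = p - 1\<close>.\<close>

lemma nn_integral_gram_ratio:
  fixes B :: "nat \<Rightarrow> 'r set"
  assumes k: "k > 0" and R: "finite R" and BR: "\<And>i. i < k \<Longrightarrow> B i \<subseteq> R"
    and disj: "disjoint_family_on B {..<k}" and p: "\<And>i. i < k \<Longrightarrow> p \<le> card (B i)"
    and a: "\<And>i. i < k \<Longrightarrow> (real (card (B i)) - real p + 1) / 2 + a i > 0"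
  shows "(\<integral>\<^sup>+Z. ennreal (gram_ratio k p B a R Z) \<partial>gauss (R \<times> {..<p})) = ennreal (\<Prod>j<p.
    (\<Prod>i<k. Gamma ((real (card (B i)) - real j) / 2 + a i) / Gamma ((real (card (B i)) - real j) / 2)) *
    (Gamma ((real (card R) - real j) / 2) / Gamma ((real (card R) - real j) / 2 + (\<Sum>i<k. a i))))"
  using R BR disj p a
proof (induction p arbitrary: B R)
  case 0
  have "gram_ratio k 0 B a R Z = 1" for Z
    by (simp add: gram_ratio_def gram_def)
  then show ?case using prob_space.emeasure_space_1[OF prob_space_gauss[of "R \<times> {..<0::nat}"]]
    by (simp del: space_gauss)
next
  case (Suc p)
  note R = Suc.prems(1) and BR = Suc.prems(2) and disj = Suc.prems(3) and ca = Suc.prems(4) and a = Suc.prems(5)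
  have fB: "finite (B i)" if "i < k" for i using BR[OF that] R finite_subset by blast
  have Bne: "B i \<noteq> {}" if "i < k" for i using ca[OF that] by auto
  define b where "b i = (SOME r. r \<in> B i)" for i
  have b: "b i \<in> B i" if "i < k" for i
    unfolding b_def using Bne[OF that] by (simp add: some_in_eq)
  have b0: "b 0 \<in> R" using b[OF k] BR[OF k] by auto
  define Bl where "Bl = (\<lambda>i. if i < k then B i else R - (\<Union>i<k. B i))"
  obtain \<iota> where \<iota>: "\<And>j r. j \<le> k \<Longrightarrow> r \<in> Bl j \<Longrightarrow> \<iota> r = j"
    using disjoint_family_on_index[OF disj, of R] unfolding Bl_def by blast
  let ?B' = "\<lambda>i. B i - {b i}" and ?R' = "R - {b 0}"
  have B'R': "?B' i \<subseteq> ?R'" if "i < k" for i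
    using that BR[OF that] disjoint_family_onD[OF disj, of 0 i] b[OF k] k by (cases "i = 0") auto
  let ?V = "\<Prod>j<p.
    (\<Prod>i<k. Gamma ((real (card (?B' i)) - real j) / 2 + a i) / Gamma ((real (card (?B' i)) - real j) / 2)) *
    (Gamma ((real (card ?R') - real j) / 2) / Gamma ((real (card ?R') - real j) / 2 + (\<Sum>i<k. a i)))"
  have IH: "(\<integral>\<^sup>+Z. ennreal (gram_ratio k p ?B' a ?R' Z) \<partial>gauss (?R' \<times> {..<p})) = ennreal ?V"
  proof (rule Suc.IH)
    show "disjoint_family_on ?B' {..<k}" using disj by (auto simp: disjoint_family_on_def)
    fix i assume i: "i < k"
    then have "card (?B' i) = card (B i) - 1" using b fB by simp
    then show "p \<le> card (?B' i)" "(real (card (?B' i)) - real p + 1) / 2 + a i > 0"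
      using ca[OF i] a[OF i] by (auto simp: of_nat_diff)
  qed (use R B'R' in auto)
  define c where "c x = ennreal ((\<Prod>i<k. (\<Sum>r\<in>B i. (x r)\<^sup>2) powr a i) * (\<Sum>r\<in>R. (x r)\<^sup>2) powr (- (\<Sum>i<k. a i)))" for x
  have c_cong: "c x = c y" if "\<And>r. r \<in> R \<Longrightarrow> x r = y r" for x y
  proof -
    have "(\<Sum>r\<in>S. (x r)\<^sup>2) = (\<Sum>r\<in>S. (y r)\<^sup>2)" if "S \<subseteq> R" for S
      using that \<open>\<And>r. r \<in> R \<Longrightarrow> x r = y r\<close> by (intro sum.cong) auto
    then show ?thesis unfolding c_def using BR by simp
  qed
  have inner: "(\<integral>\<^sup>+Z. ennreal (gram_ratio k (Suc p) B a R (merge (R \<times> {p}) (R \<times> {..<p}) (W, Z))) \<partial>gauss (R \<times> {..<p}))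
      = c (\<lambda>r. W (r, p)) * ennreal ?V"
    if w: "\<And>i. i < k \<Longrightarrow> (\<Sum>r\<in>B i. (W (r, p))\<^sup>2) > 0" for W
  proof -
    define w where "w = (\<lambda>r. W (r, p))"
    define u where "u = (\<lambda>i. if i < k then householder (B i) (b i) w else (\<lambda>_. 0))"
    define w1 where "w1 = (\<lambda>r. reflect (Bl (\<iota> r)) (u (\<iota> r)) w r)"
    define T1 where "T1 Z = (\<lambda>(r, c)\<in>R \<times> {..<p}. reflect (Bl (\<iota> r)) (u (\<iota> r)) (\<lambda>s. Z (s, c)) r)" for Z
    define T2 where "T2 Z = (\<lambda>(r, c)\<in>R \<times> {..<p}. reflect R (householder R (b 0) w1) (\<lambda>s. Z (s, c)) r)" for Z
    define F where "F Z = ennreal (gram_ratio k p ?B' a ?R' (restrict Z (?R' \<times> {..<p})))" for Z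
    have F: "F \<in> borel_measurable (PiM (R \<times> {..<p}) (\<lambda>_. borel))"
      unfolding F_def using B'R'
      by (intro measurable_compose[OF _ measurable_ennreal] measurable_compose[OF measurable_restrict_subset borel_measurable_gram_ratio]) auto
    have T2: "T2 \<in> PiM (R \<times> {..<p}) (\<lambda>_. borel) \<rightarrow>\<^sub>M PiM (R \<times> {..<p}) (\<lambda>_. borel)"
      unfolding T2_def using measurable_reflect_map[where Bl = "\<lambda>_. R" and R = R and C = "{..<p}" and u = "\<lambda>_. householder R (b 0) w1"] R
      by simp
    have "ennreal (gram_ratio k (Suc p) B a R (merge (R \<times> {p}) (R \<times> {..<p}) (W, Z))) = c w * F (T2 (T1 Z))" for Z
    proof -
      have "gram_ratio k (Suc p) B a R (merge (R \<times> {p}) (R \<times> {..<p}) (W, Z)) =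
        (\<Prod>i<k. (\<Sum>r\<in>B i. (w r)\<^sup>2) powr a i) * (\<Sum>r\<in>R. (w r)\<^sup>2) powr (- (\<Sum>i<k. a i)) *
          gram_ratio k p ?B' a ?R' (T2 (T1 Z))"
      proof (rule gram_ratio_Suc[OF k R BR disj b _ Bl_def \<iota> u_def _ _ _ w1_def])
        show "0 < (\<Sum>r\<in>B i. (w r)\<^sup>2)" if "i < k" for i using w[OF that] by (simp add: w_def)
        show "merge (R \<times> {p}) (R \<times> {..<p}) (W, Z) (r, p) = w r" if "r \<in> R" for r
          using that by (simp add: merge_def w_def)
        show "merge (R \<times> {p}) (R \<times> {..<p}) (W, Z) (r, c) = Z (r, c)" if "r \<in> R" "c < p" for r c
          using that by (simp add: merge_def)
        show "T1 Z (r, c) = reflect (Bl (\<iota> r)) (u (\<iota> r)) (\<lambda>s. Z (s, c)) r" if "r \<in> R" "c < p" for r c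
          using that by (simp add: T1_def)
        show "T2 (T1 Z) (r, c) = reflect R (householder R (b 0) w1) (\<lambda>s. T1 Z (s, c)) r" if "r \<in> R" "c < p" for r c
          using that by (simp add: T2_def)
      qed auto
      also have "gram_ratio k p ?B' a ?R' (T2 (T1 Z)) = gram_ratio k p ?B' a ?R' (restrict (T2 (T1 Z)) (?R' \<times> {..<p}))"
        using B'R' by (intro gram_ratio_cong) auto
      finally show ?thesis
        unfolding c_def F_def by (simp only: ennreal_mult' prod_nonneg mult_nonneg_nonneg powr_ge_zero)
    qed
    then have "(\<integral>\<^sup>+Z. ennreal (gram_ratio k (Suc p) B a R (merge (R \<times> {p}) (R \<times> {..<p}) (W, Z))) \<partial>gauss (R \<times> {..<p}))
      = (\<integral>\<^sup>+Z. c w * F (T2 (T1 Z)) \<partial>gauss (R \<times> {..<p}))"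
      by simp
    \<comment> \<open>The inner reflection is removed first, with \<open>T2\<close> kept as part of
      the test function. Although \<open>T2\<close> is built from \<open>w1\<close>, it is constant
      with respect to \<open>Z\<close>.\<close>
    also have "\<dots> = (\<integral>\<^sup>+Z. c w * F (T2 Z) \<partial>gauss (R \<times> {..<p}))"
      unfolding T1_def
    proof (rule nn_integral_gauss_reflect[where J = "{..k}" and f = "\<lambda>Z. c w * F (T2 Z)"])
      show "finite (Bl j)" for j using fB R by (auto simp: Bl_def)
      show "disjoint_family_on Bl {..k}" unfolding disjoint_family_on_def using \<iota> by (metis atMost_iff disjoint_iff)
      show "R = (\<Union>j\<le>k. Bl j)" unfolding Bl_def by (rule Un_blocks_eq[OF BR, symmetric])
      show "(\<lambda>Z. c w * F (T2 Z)) \<in> borel_measurable (PiM (R \<times> {..<p}) (\<lambda>_. borel))"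
        by (intro borel_measurable_times_ennreal borel_measurable_const measurable_compose[OF T2 F])
    qed (use \<iota> in auto)
    also have "\<dots> = (\<integral>\<^sup>+Z. c w * F Z \<partial>gauss (R \<times> {..<p}))"
      unfolding T2_def
      by (rule nn_integral_gauss_reflect[where J = "{0::nat}" and Bl = "\<lambda>_. R" and \<iota> = "\<lambda>_. 0"
            and u = "\<lambda>_. householder R (b 0) w1" and f = "\<lambda>Z. c w * F Z"])
        (use R F in \<open>auto simp: disjoint_family_on_def\<close>)
    also have "\<dots> = c w * (\<integral>\<^sup>+Z. F Z \<partial>gauss (R \<times> {..<p}))"
      using F by (intro nn_integral_cmult) (simp add: measurable_cong_sets[OF sets_gauss refl])
    also have "(\<integral>\<^sup>+Z. F Z \<partial>gauss (R \<times> {..<p})) = ennreal ?V"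
      unfolding F_def IH[symmetric] using B'R' R
      by (intro nn_integral_gauss_restrict measurable_compose[OF _ measurable_ennreal] borel_measurable_gram_ratio) auto
    finally show ?thesis by (simp add: w_def)
  qed
  have split: "R \<times> {..<Suc p} = R \<times> {p} \<union> R \<times> {..<p}" by (auto simp: less_Suc_eq)
  have meas: "(\<lambda>Z. ennreal (gram_ratio k (Suc p) B a R Z)) \<in> borel_measurable (PiM (R \<times> {..<Suc p}) (\<lambda>_. borel))"
    using BR by (intro measurable_compose[OF _ measurable_ennreal] borel_measurable_gram_ratio)
  have cm: "c \<in> borel_measurable (PiM R (\<lambda>_. borel))"
  proof -
    have "(\<lambda>x. \<Sum>r\<in>S. (x r :: real)\<^sup>2) \<in> borel_measurable (PiM R (\<lambda>_. borel))" if "S \<subseteq> R" for S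
      using that by (intro borel_measurable_sum borel_measurable_power measurable_component_singleton) auto
    then show ?thesis unfolding c_def using BR
      by (intro measurable_compose[OF _ measurable_ennreal] borel_measurable_times borel_measurable_prod
        powr_real_measurable borel_measurable_const) auto
  qed
  have "(\<integral>\<^sup>+Z. ennreal (gram_ratio k (Suc p) B a R Z) \<partial>gauss (R \<times> {..<Suc p})) =
    (\<integral>\<^sup>+W. (\<integral>\<^sup>+Z. ennreal (gram_ratio k (Suc p) B a R (merge (R \<times> {p}) (R \<times> {..<p}) (W, Z))) \<partial>gauss (R \<times> {..<p})) \<partial>gauss (R \<times> {p}))"
    unfolding split using R meas[unfolded split] by (intro nn_integral_gauss_fold) auto
  also have "\<dots> = (\<integral>\<^sup>+W. c (\<lambda>r\<in>R. W (r, p)) * ennreal ?V \<partial>gauss (R \<times> {p}))"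
  proof (rule nn_integral_cong_AE)
    \<comment> \<open>A last column that vanishes on a block would have no direction to rotate onto
      the pivot; this is a null event.\<close>
    have "AE W in gauss (R \<times> {p}). \<forall>i\<in>{..<k}. (\<Sum>rc\<in>B i \<times> {p}. (W rc)\<^sup>2) > 0"
      using R BR Bne by (subst AE_finite_all) (auto intro!: AE_gauss_sum_squares_pos)
    then show "AE W in gauss (R \<times> {p}). (\<integral>\<^sup>+Z. ennreal (gram_ratio k (Suc p) B a R (merge (R \<times> {p}) (R \<times> {..<p}) (W, Z))) \<partial>gauss (R \<times> {..<p}))
      = c (\<lambda>r\<in>R. W (r, p)) * ennreal ?V"
    proof (rule AE_mp, intro AE_I2 impI)
      fix W :: "'r \<times> nat \<Rightarrow> real" assume "\<forall>i\<in>{..<k}. (\<Sum>rc\<in>B i \<times> {p}. (W rc)\<^sup>2) > 0"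
      moreover have "(\<Sum>rc\<in>B i \<times> {p}. (W rc)\<^sup>2) = (\<Sum>r\<in>B i. (W (r, p))\<^sup>2)" for i
        by (rule sum.reindex_bij_witness[of _ "\<lambda>r. (r, p)" fst]) auto
      ultimately have "(\<Sum>r\<in>B i. (W (r, p))\<^sup>2) > 0" if "i < k" for i
        using that by simp
      moreover have "c (\<lambda>r. W (r, p)) = c (\<lambda>r\<in>R. W (r, p))" by (intro c_cong) simp
      ultimately show "(\<integral>\<^sup>+Z. ennreal (gram_ratio k (Suc p) B a R (merge (R \<times> {p}) (R \<times> {..<p}) (W, Z))) \<partial>gauss (R \<times> {..<p}))
        = c (\<lambda>r\<in>R. W (r, p)) * ennreal ?V"
        by (simp only: inner)
    qed
  qed
  also have "\<dots> = (\<integral>\<^sup>+x. c x * ennreal ?V \<partial>gauss R)"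
  proof -
    have "(\<lambda>r. (r, p)) ` R = R \<times> {p}" by auto
    then show ?thesis
      using nn_integral_gauss_reindex[of "\<lambda>r. (r, p)" R "\<lambda>x. c x * ennreal ?V"] cm by (simp add: inj_on_def)
  qed
  also have "\<dots> = (\<integral>\<^sup>+x. c x \<partial>gauss R) * ennreal ?V"
    using cm by (intro nn_integral_multc) (simp add: measurable_cong_sets[OF sets_gauss refl])
  also have "(\<integral>\<^sup>+x. c x \<partial>gauss R) = ennreal ((\<Prod>i<k. Gamma (real (card (B i)) / 2 + a i) / Gamma (real (card (B i)) / 2)) *
        (Gamma (real (card R) / 2) / Gamma (real (card R) / 2 + (\<Sum>i<k. a i))))" (is "_ = ennreal ?G")
    unfolding c_def
  proof (rule nn_integral_gauss_dirichlet[OF k R BR disj Bne])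
    show "0 < real (card (B i)) / 2 + a i" if "i < k" for i
      using a[OF that] by (auto simp: field_simps)
  qed auto
  also have "ennreal ?G * ennreal ?V = ennreal (?G * ?V)"
  proof -
    have pos: "0 < card (B i)" if "i < k" for i using ca[OF that] by simp
    have apos: "0 < real (card (B i)) / 2 + a i" if "i < k" for i
      using a[OF that] by (auto simp: field_simps)
    then have "0 < (\<Sum>i<k. real (card (B i)) / 2 + a i)"
      using k by (intro sum_pos) auto
    then have Ra: "real (card R) / 2 + (\<Sum>i<k. a i) > 0"
      using sum_card_le[OF R BR disj] by (simp add: sum.distrib sum_divide_distrib[symmetric])
    have cR: "card R > 0" using R b0 by (auto simp: card_gt_0_iff)
    have "?G \<ge> 0"
    proof (intro mult_nonneg_nonneg prod_nonneg divide_nonneg_nonneg ballI less_imp_le[OF Gamma_real_pos])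
      fix i assume "i \<in> {..<k}"
      then show "0 < real (card (B i)) / 2 + a i" "0 < real (card (B i)) / 2" using pos apos by auto
    qed (use Ra cR in auto)
    then show ?thesis by (rule ennreal_mult'[symmetric])
  qed
  also have "?G * ?V = (\<Prod>j<Suc p.
    (\<Prod>i<k. Gamma ((real (card (B i)) - real j) / 2 + a i) / Gamma ((real (card (B i)) - real j) / 2)) *
    (Gamma ((real (card R) - real j) / 2) / Gamma ((real (card R) - real j) / 2 + (\<Sum>i<k. a i))))"
  proof -
    \<comment> \<open>Deleting one row turns index \<open>j\<close> of the induction hypothesis into
      \<open>Suc j\<close>; the Dirichlet factor split off now is the one with index 0.\<close>
    have cB: "real (card (?B' i)) - real j = real (card (B i)) - real (Suc j)" if "i < k" for i j
      using that b fB ca[OF that] by (simp add: of_nat_diff)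
    have cR: "real (card ?R') - real j = real (card R) - real (Suc j)" for j
    proof -
      have "card R \<ge> 1" using b0 R by (metis One_nat_def Suc_leI card_gt_0_iff empty_iff)
      then show ?thesis using b0 R by (simp add: of_nat_diff)
    qed
    show ?thesis
      unfolding prod.lessThan_Suc_shift[of _ p] cR
      by (intro arg_cong2[where f = "(*)"] prod.cong refl) (simp_all only: cB lessThan_iff, simp_all)
  qed
  finally show ?case .
qed

subsection \<open>Normal samples\<close>

definition qform :: "nat \<Rightarrow> real mat \<Rightarrow> (nat \<Rightarrow> real) \<Rightarrow> (nat \<Rightarrow> real) \<Rightarrow> real" where
  "qform p S x y = (\<Sum>a<p. \<Sum>b<p. x a * S $$ (a, b) * y b)"

lemma qform_diff_left: "qform p S (\<lambda>a. x a - y a) z = qform p S x z - qform p S y z"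
  by (simp add: qform_def algebra_simps sum_subtractf)

lemma qform_cmult_left: "qform p S (\<lambda>a. c * x a) z = c * qform p S x z"
  by (simp add: qform_def sum_distrib_left mult.assoc)

lemma qform_sum_left: "qform p S (\<lambda>a. \<Sum>i\<in>I. x i a) z = (\<Sum>i\<in>I. qform p S (x i) z)"
  by (cases "finite I", induction I rule: finite_induct)
    (simp_all add: qform_def algebra_simps sum.distrib)

lemma qform_sym:
  assumes "S\<^sup>T = S" "S \<in> carrier_mat p p"
  shows "qform p S x y = qform p S y x"
proof -
  have "S $$ (b, a) = S $$ (a, b)" if "a < p" "b < p" for a b
    using assms that by (metis carrier_matD index_transpose_mat(1))
  then show ?thesis
    unfolding qform_def by (subst sum.swap) (auto intro!: sum.cong)
qed

lemma qform_pos: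
  assumes S: "pos_def_mat p S" and x: "x a \<noteq> 0" "a < p"
  shows "qform p S x x > 0"
proof -
  have c: "S \<in> carrier_mat p p" using S by (simp add: pos_def_mat_def)
  have "vec p x \<noteq> 0\<^sub>v p" using x by (metis index_vec index_zero_vec(1))
  then have "vec p x \<bullet> (S *\<^sub>v vec p x) > 0" using S by (simp add: pos_def_mat_def)
  also have "vec p x \<bullet> (S *\<^sub>v vec p x) = qform p S x x"
    using c by (auto simp: scalar_prod_def qform_def sum_distrib_left mult.assoc atLeast0LessThan intro!: sum.cong)
  finally show ?thesis .
qed

text \<open>Gram-Schmidt for the inner product given by \<open>S\<close>. The triangular support
  keeps coordinate \<open>m\<close> of the new vector equal to 1, so the vector cannot vanish and
  positive definiteness allows its normalisation.\<close>

lemma pos_def_Gram_Schmidt: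
  assumes S: "pos_def_mat p S"
  shows "m \<le> p \<Longrightarrow> \<exists>t. (\<forall>i<m. \<forall>a>i. t i a = 0) \<and> (\<forall>i<m. \<forall>j<m. qform p S (t i) (t j) = (if i = j then 1 else 0))"
proof (induction m)
  case (Suc m)
  then have "\<exists>t. (\<forall>i<m. \<forall>a>i. t i a = 0) \<and> (\<forall>i<m. \<forall>j<m. qform p S (t i) (t j) = (if i = j then 1 else 0))"
    by simp
  then obtain t where ex: "(\<forall>i<m. \<forall>a>i. t i a = 0) \<and> (\<forall>i<m. \<forall>j<m. qform p S (t i) (t j) = (if i = j then 1 else 0))" ..
  have t0: "t i a = 0" if "i < m" "a > i" for i a using ex that by blast
  have t: "qform p S (t i) (t j) = (if i = j then 1 else 0)" if "i < m" "j < m" for i j using ex that by blast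
  have sym: "qform p S x y = qform p S y x" for x y
    using S by (intro qform_sym) (auto simp: pos_def_mat_def)
  define e where "e a = (if a = m then 1 else 0 :: real)" for a
  define v where "v a = e a - (\<Sum>i<m. qform p S e (t i) * t i a)" for a
  have vm: "v m = 1" using t0 by (simp add: v_def e_def)
  have v0: "v a = 0" if "a > m" for a using t0 that by (simp add: v_def e_def)
  have vt: "qform p S v (t j) = 0" if "j < m" for j
  proof -
    have "qform p S v (t j) = qform p S e (t j) - (\<Sum>i<m. qform p S e (t i) * qform p S (t i) (t j))"
      unfolding v_def by (simp add: qform_diff_left qform_sum_left qform_cmult_left)
    also have "(\<Sum>i<m. qform p S e (t i) * qform p S (t i) (t j)) = (\<Sum>i<m. if i = j then qform p S e (t i) else 0)"
      using t that by (intro sum.cong) auto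
    finally show ?thesis using that by simp
  qed
  define q where "q = qform p S v v"
  have q: "q > 0" unfolding q_def using vm Suc.prems by (intro qform_pos[OF S, of _ m]) auto
  define t' where "t' = t(m := (\<lambda>a. 1 / sqrt q * v a))"
  have new: "qform p S (t' m) x = 1 / sqrt q * qform p S v x" for x
    by (simp only: t'_def fun_upd_same qform_cmult_left)
  show ?case
  proof (intro exI[of _ t'] conjI allI impI)
    fix i a assume "i < Suc m" "a > i"
    then show "t' i a = 0" using t0 v0 by (auto simp: t'_def less_Suc_eq)
  next
    fix i j assume ij: "i < Suc m" "j < Suc m"
    have old: "t' i = t i" if "i < m" for i using that by (simp add: t'_def)
    have "qform p S v (t' m) = qform p S (t' m) v" by (rule sym)
    also have "\<dots> = 1 / sqrt q * q" unfolding new q_def ..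
    finally have vm': "qform p S v (t' m) = 1 / sqrt q * q" .
    have "1 / sqrt q * (1 / sqrt q * q) = 1" using q by (simp add: field_simps)
    then have mm: "qform p S (t' m) (t' m) = 1" unfolding new vm' .
    have mj: "qform p S (t' m) (t' j) = 0" if "j < m" for j
      unfolding new old[OF that] vt[OF that] by simp
    show "qform p S (t' i) (t' j) = (if i = j then 1 else 0)"
    proof (cases "i = m"; cases "j = m")
      assume "i \<noteq> m" "j = m"
      then have "qform p S (t' m) (t' i) = 0" using ij by (intro mj) simp
      then show ?thesis using \<open>i \<noteq> m\<close> \<open>j = m\<close> by (subst sym) simp
    next
      assume "i \<noteq> m" "j \<noteq> m"
      then have "i < m" "j < m" using ij by auto
      then show ?thesis by (simp only: old t)
    qed (use mm mj ij in auto)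
  qed
qed auto

lemma pos_def_mat_diagonalize:
  assumes S: "pos_def_mat p S"
  obtains T where "T \<in> carrier_mat p p" "T\<^sup>T * S * T = 1\<^sub>m p"
proof -
  obtain t where t: "\<And>i j. i < p \<Longrightarrow> j < p \<Longrightarrow> qform p S (t i) (t j) = (if i = j then 1 else 0)"
    using pos_def_Gram_Schmidt[OF S order_refl] by blast
  have c: "S \<in> carrier_mat p p" using S by (simp add: pos_def_mat_def)
  define T where "T = mat p p (\<lambda>(a, i). t i a)"
  have "T\<^sup>T * S * T = 1\<^sub>m p"
  proof (rule eq_matI)
    fix i j assume "i < dim_row (1\<^sub>m p :: real mat)" "j < dim_col (1\<^sub>m p :: real mat)"
    then have ij: "i < p" "j < p" by auto
    have "(T\<^sup>T * S * T) $$ (i, j) = (\<Sum>b<p. (\<Sum>a<p. t i a * S $$ (a, b)) * t j b)"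
      using ij c by (simp add: T_def scalar_prod_def atLeast0LessThan)
    also have "\<dots> = qform p S (t i) (t j)"
      unfolding qform_def by (subst sum.swap) (simp add: sum_distrib_right)
    finally show "(T\<^sup>T * S * T) $$ (i, j) = 1\<^sub>m p $$ (i, j)" using ij t by simp
  qed (use c in \<open>auto simp: T_def\<close>)
  then show thesis by (intro that[of T]) (auto simp: T_def)
qed

text \<open>With these identities the exponent of the normal density becomes a sum of squares in
  \<open>T\<^sup>T * y\<close>, and \<open>S * T\<close> is the map that undoes
  \<open>T\<^sup>T\<close>.\<close>

lemma pos_def_mat_inverse:
  assumes S: "pos_def_mat p S" and T: "T \<in> carrier_mat p p" and TST: "T\<^sup>T * S * T = 1\<^sub>m p"
  shows "the (mat_inverse S) = T * T\<^sup>T" and "S * T * T\<^sup>T = 1\<^sub>m p" and "T\<^sup>T * (S * T) = 1\<^sub>m p"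
proof -
  have c: "S \<in> carrier_mat p p" using S by (simp add: pos_def_mat_def)
  have Tt: "T\<^sup>T \<in> carrier_mat p p" using T by simp
  have ST: "S * T \<in> carrier_mat p p" using c T by simp
  show 1: "T\<^sup>T * (S * T) = 1\<^sub>m p" using TST assoc_mult_mat[OF Tt c T] by simp
  show 2: "S * T * T\<^sup>T = 1\<^sub>m p" by (rule mat_mult_left_right_inverse[OF Tt ST 1])
  have TT: "T * T\<^sup>T \<in> carrier_mat p p" using T by simp
  have 3: "S * (T * T\<^sup>T) = 1\<^sub>m p" using 2 assoc_mult_mat[OF c T Tt] by simp
  have 4: "(T * T\<^sup>T) * S = 1\<^sub>m p" by (rule mat_mult_left_right_inverse[OF c TT 3])
  have "S \<in> Units (ring_mat TYPE(real) p ())"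
    unfolding Units_def using c TT 3 4 by (auto simp: ring_mat_def)
  then obtain B where B: "mat_inverse S = Some B" using mat_inverse(1)[OF c, of "()"] by (cases "mat_inverse S") auto
  then have B': "B * S = 1\<^sub>m p" "B \<in> carrier_mat p p" using mat_inverse(2)[OF c] by auto
  have "B = B * (S * (T * T\<^sup>T))" unfolding 3 using right_mult_one_mat[OF B'(2)] by simp
  also have "\<dots> = B * S * (T * T\<^sup>T)" by (rule assoc_mult_mat[OF B'(2) c TT, symmetric])
  also have "\<dots> = T * T\<^sup>T" unfolding B'(1) by (rule left_mult_one_mat[OF TT])
  finally have "B = T * T\<^sup>T" .
  then show "the (mat_inverse S) = T * T\<^sup>T" using B by simp
qed

section \<open>Normal vectors as affine images of standard normal ones\<close>

definition affine_vec :: "nat \<Rightarrow> real vec \<Rightarrow> real mat \<Rightarrow> (nat \<Rightarrow> real) \<Rightarrow> nat \<Rightarrow> real" where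
  "affine_vec p m L z = (\<lambda>a\<in>{..<p}. m $ a + (\<Sum>i<p. L $$ (a, i) * z i))"

lemma sets_rvec_space [measurable_cong, simp]: "sets (rvec_space p) = sets (PiM {..<p} (\<lambda>_. borel))"
  unfolding rvec_space_def by (rule sets_PiM_cong) auto

lemma rvec_space_eq: "rvec_space p = lborel_Pi {..<p}"
  by (simp add: rvec_space_def lborel_Pi_def)

lemma measurable_affine_vec:
  "affine_vec p m L \<in> PiM {..<p} (\<lambda>_. borel) \<rightarrow>\<^sub>M PiM {..<p} (\<lambda>_. borel)"
  unfolding affine_vec_def by (intro measurable_restrict) measurable

lemma mat_mult_index_sum:
  "A \<in> carrier_mat p p \<Longrightarrow> B \<in> carrier_mat p p \<Longrightarrow> i < p \<Longrightarrow> j < p \<Longrightarrow>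
    (A * B) $$ (i, j) = (\<Sum>l<p. A $$ (i, l) * B $$ (l, j))"
  by (simp add: scalar_prod_def atLeast0LessThan)

text \<open>The determinant of \<open>S\<close> is never evaluated. The assumption that
  \<open>mvnormal\<close> is a probability measure fixes its normalising constant, and using its
  centred density as the test function in \<open>nn_integral_lborel_Pi_linear\<close> supplies the
  Jacobian of \<open>S * T\<close>.\<close>

lemma mvnormal_eq_distr_gauss:
  assumes S: "pos_def_mat p S" and T: "T \<in> carrier_mat p p" and TST: "T\<^sup>T * S * T = 1\<^sub>m p"
    and m: "m \<in> carrier_vec p" and prob: "prob_space (mvnormal p m S)"
  shows "mvnormal p m S = distr (gauss {..<p}) (rvec_space p) (affine_vec p m (S * T))"
proof -
  let ?I = "{..<p}"
  define L where "L = S * T"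
  have c: "S \<in> carrier_mat p p" using S by (simp add: pos_def_mat_def)
  have L: "L \<in> carrier_mat p p" using c T by (simp add: L_def)
  have Tt: "T\<^sup>T \<in> carrier_mat p p" using T by simp
  note inv = pos_def_mat_inverse[OF S T TST]
  \<comment> \<open>Multiplication by \<open>T\<^sup>T\<close>, the two-sided inverse of
    \<open>L\<close>.\<close>
  define K where "K y i = (\<Sum>a<p. T $$ (a, i) * y a)" for y i
  have KL: "K (\<lambda>a\<in>?I. (\<Sum>j<p. L $$ (a, j) * z j)) i = z i" if "i < p" for z i
  proof -
    have "K (\<lambda>a\<in>?I. (\<Sum>j<p. L $$ (a, j) * z j)) i = (\<Sum>j<p. (\<Sum>a<p. T\<^sup>T $$ (i, a) * L $$ (a, j)) * z j)"
      unfolding K_def sum_distrib_right using T that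
      by (subst sum.swap) (simp add: sum_distrib_left mult.assoc)
    also have "\<dots> = (\<Sum>j<p. (T\<^sup>T * L) $$ (i, j) * z j)"
      using that by (intro sum.cong refl) (simp add: mat_mult_index_sum[OF Tt L] del: index_transpose_mat)
    also have "\<dots> = (\<Sum>j<p. if j = i then z j else 0)"
      using that inv(3) by (intro sum.cong refl) (simp add: L_def)
    finally show ?thesis using that by simp
  qed
  have LK: "(\<Sum>j<p. L $$ (a, j) * K y j) = y a" if "a < p" for y a
  proof -
    have "(\<Sum>j<p. L $$ (a, j) * K y j) = (\<Sum>b<p. (\<Sum>j<p. L $$ (a, j) * T\<^sup>T $$ (j, b)) * y b)"
      unfolding K_def sum_distrib_right sum_distrib_left using T
      by (subst sum.swap) (simp add: mult.assoc)
    also have "\<dots> = (\<Sum>b<p. (L * T\<^sup>T) $$ (a, b) * y b)"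
      using that by (intro sum.cong refl) (simp add: mat_mult_index_sum[OF L Tt] del: index_transpose_mat)
    also have "\<dots> = (\<Sum>b<p. if b = a then y b else 0)"
      using that inv(2) by (intro sum.cong refl) (simp add: L_def)
    finally show ?thesis using that by simp
  qed
  define C where "C = 1 / sqrt ((2 * pi) ^ p * Determinant.det S)"
  define G where "G y = exp (- (\<Sum>i<p. (K y i)\<^sup>2) / 2)" for y
  have dens: "mvn_density p m S x = C * G (\<lambda>a. x a - m $ a)" for x
  proof -
    let ?y = "vec p x - m"
    have y: "?y \<in> carrier_vec p" using m by simp
    have "?y \<bullet> (the (mat_inverse S) *\<^sub>v ?y) = ?y \<bullet> (T *\<^sub>v (T\<^sup>T *\<^sub>v ?y))"
      using assoc_mult_mat_vec[OF T Tt y] inv(1) by simp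
    also have "\<dots> = (T\<^sup>T *\<^sub>v ?y) \<bullet> (T\<^sup>T *\<^sub>v ?y)"
      using T y by (subst transpose_vec_mult_scalar[OF T _ y, symmetric]) auto
    also have "\<dots> = (\<Sum>i<p. (K (\<lambda>a. x a - m $ a) i)\<^sup>2)"
      using T m by (auto simp: scalar_prod_def K_def power2_eq_square atLeast0LessThan intro!: sum.cong arg_cong2[where f = "(*)"])
    finally show ?thesis unfolding mvn_density_def by (simp add: G_def C_def)
  qed
  have K_meas[measurable]: "(\<lambda>y. K y i) \<in> borel_measurable (PiM ?I (\<lambda>_. borel))" for i
    unfolding K_def by measurable
  have G_meas[measurable]: "G \<in> borel_measurable (PiM ?I (\<lambda>_. borel))"
    unfolding G_def by measurable
  let ?Tm = "\<lambda>z. \<lambda>a\<in>?I. (\<Sum>j<p. L $$ (a, j) * z j)"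
  have Tm[measurable]: "?Tm \<in> PiM ?I (\<lambda>_. borel) \<rightarrow>\<^sub>M PiM ?I (\<lambda>_. borel)"
    by (intro measurable_restrict) measurable
  have GT: "G (?Tm z) = exp (- (\<Sum>i<p. (z i)\<^sup>2) / 2)" for z
    unfolding G_def using KL by simp
  have GTm: "G (\<lambda>a\<in>?I. - ?Tm z a) = exp (- (\<Sum>i<p. (z i)\<^sup>2) / 2)" for z
  proof -
    have "K (\<lambda>a\<in>?I. - ?Tm z a) i = - K (?Tm z) i" for i by (simp add: K_def sum_negf)
    then have "G (\<lambda>a\<in>?I. - ?Tm z a) = G (?Tm z)" unfolding G_def by (simp only: power2_minus)
    then show ?thesis by (simp only: GT)
  qed
  let ?c0 = "sqrt (2 * pi) ^ p"
  have c0: "?c0 > 0" by simp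
  have shift: "(\<integral>\<^sup>+x. F x * ennreal (mvn_density p m S x) \<partial>lborel_Pi ?I)
    = (\<integral>\<^sup>+y. F (\<lambda>a\<in>?I. y a + m $ a) * ennreal (C * G y) \<partial>lborel_Pi ?I)"
    if F[measurable]: "F \<in> borel_measurable (PiM ?I (\<lambda>_. borel))" for F
  proof (rule nn_integral_lborel_Pi_add'[where c = "\<lambda>a. - m $ a"])
    show "(\<lambda>y. F (\<lambda>a\<in>?I. y a + m $ a) * ennreal (C * G y)) \<in> borel_measurable (PiM ?I (\<lambda>_. borel))"
      by measurable
    fix x :: "nat \<Rightarrow> real" assume x: "x \<in> extensional ?I"
    have "(\<lambda>a\<in>?I. (\<lambda>a\<in>?I. x a + - m $ a) a + m $ a) = x"
      using x by (auto simp: fun_eq_iff extensional_def restrict_def)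
    moreover have "G (\<lambda>a\<in>?I. x a + - m $ a) = G (\<lambda>a. x a - m $ a)" by (simp add: G_def K_def)
    ultimately show "F x * ennreal (mvn_density p m S x)
      = F (\<lambda>a\<in>?I. (\<lambda>a\<in>?I. x a + - m $ a) a + m $ a) * ennreal (C * G (\<lambda>a\<in>?I. x a + - m $ a))"
      by (simp only: dens)
  qed simp
  have dens_meas[measurable]: "(\<lambda>x. mvn_density p m S x) \<in> borel_measurable (PiM ?I (\<lambda>_. borel))"
  proof -
    have "(\<lambda>x. C * G (\<lambda>a\<in>?I. x a - m $ a)) \<in> borel_measurable (PiM ?I (\<lambda>_. borel))" by measurable
    moreover have "G (\<lambda>a\<in>?I. x a - m $ a) = G (\<lambda>a. x a - m $ a)" for x by (simp add: G_def K_def)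
    ultimately show ?thesis by (simp add: dens)
  qed
  have mvn: "(\<integral>\<^sup>+x. F x \<partial>mvnormal p m S) = (\<integral>\<^sup>+y. F (\<lambda>a\<in>?I. y a + m $ a) * ennreal (C * G y) \<partial>lborel_Pi ?I)"
    if F[measurable]: "F \<in> borel_measurable (PiM ?I (\<lambda>_. borel))" for F
    unfolding shift[OF F, symmetric] mvnormal_def rvec_space_eq
    by (subst nn_integral_density) (auto simp: mult.commute)
  have CG1: "(\<integral>\<^sup>+y. ennreal (C * G y) \<partial>lborel_Pi ?I) = 1"
    using mvn[of "\<lambda>_. 1"] prob_space.emeasure_space_1[OF prob] by simp
  \<comment> \<open>Because \<open>ennreal\<close> sends negative reals to 0, a nonpositive constant
    would contradict the total mass 1.\<close>
  have C: "C > 0"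
  proof (rule ccontr)
    assume "\<not> C > 0"
    then have "ennreal (C * G y) = 0" for y
      by (intro ennreal_neg) (simp add: G_def mult_nonpos_nonneg)
    then show False using CG1 by simp
  qed
  have int_exp: "(\<integral>\<^sup>+z. ennreal (exp (- (\<Sum>i<p. (z i)\<^sup>2) / 2)) \<partial>lborel_Pi ?I) = ennreal ?c0"
  proof -
    have "1 = (\<integral>\<^sup>+z. 1 \<partial>gauss ?I)"
      using prob_space.emeasure_space_1[OF prob_space_gauss[of ?I]] by simp
    also have "\<dots> = (\<integral>\<^sup>+z. ennreal (1 / ?c0) * ennreal (exp (- (\<Sum>i<p. (z i)\<^sup>2) / 2)) \<partial>lborel_Pi ?I)"
      by (subst nn_integral_gauss) (auto intro!: nn_integral_cong simp: ennreal_mult'[symmetric])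
    also have "\<dots> = ennreal (1 / ?c0) * (\<integral>\<^sup>+z. ennreal (exp (- (\<Sum>i<p. (z i)\<^sup>2) / 2)) \<partial>lborel_Pi ?I)"
      by (rule nn_integral_cmult) measurable
    finally have "ennreal ?c0 * 1 = ennreal ?c0 * (ennreal (1 / ?c0) * (\<integral>\<^sup>+z. ennreal (exp (- (\<Sum>i<p. (z i)\<^sup>2) / 2)) \<partial>lborel_Pi ?I))"
      by simp
    also have "\<dots> = ennreal (?c0 * (1 / ?c0)) * (\<integral>\<^sup>+z. ennreal (exp (- (\<Sum>i<p. (z i)\<^sup>2) / 2)) \<partial>lborel_Pi ?I)"
      by (subst ennreal_mult') (simp_all add: mult.assoc)
    finally show ?thesis using c0 by simp
  qed
  have main: "(\<integral>\<^sup>+z. F (affine_vec p m L z) \<partial>gauss ?I) = (\<integral>\<^sup>+x. F x \<partial>mvnormal p m S)"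
    if F[measurable]: "F \<in> borel_measurable (PiM ?I (\<lambda>_. borel))" for F
  proof -
    let ?f = "\<lambda>y. F (\<lambda>a\<in>?I. y a + m $ a) * ennreal (C * G y)"
    have f_meas: "?f \<in> borel_measurable (PiM ?I (\<lambda>_. borel))" by measurable
    \<comment> \<open>The test function \<open>C * G\<close> has integral 1, and the integral of its
      pullback is \<open>C * sqrt (2 * pi) ^ p\<close>; this is how the Jacobian enters.\<close>
    have "(\<integral>\<^sup>+z. ?f (?Tm z) \<partial>lborel_Pi ?I) * (\<integral>\<^sup>+y. ennreal (C * G y) \<partial>lborel_Pi ?I)
      = (\<integral>\<^sup>+y. ?f y \<partial>lborel_Pi ?I) * (\<integral>\<^sup>+z. ennreal (C * G (\<lambda>a\<in>?I. - ?Tm z a)) \<partial>lborel_Pi ?I)"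
    proof (rule nn_integral_lborel_Pi_linear[OF _ Tm _ f_meas, where g = "\<lambda>y. ennreal (C * G y)"])
      fix y :: "nat \<Rightarrow> real" assume y: "y \<in> extensional ?I"
      show "\<exists>c'. \<forall>x\<in>extensional ?I. (\<lambda>i\<in>?I. ?Tm x i + y i) = ?Tm (\<lambda>i\<in>?I. x i + c' i)"
      proof (rule exI[where x = "K y"], intro ballI ext)
        fix x :: "nat \<Rightarrow> real" and i
        show "(\<lambda>i\<in>?I. ?Tm x i + y i) i = ?Tm (\<lambda>i\<in>?I. x i + K y i) i"
          using LK[of i y] by (simp add: distrib_left sum.distrib)
      qed
    qed auto
    also have "(\<integral>\<^sup>+z. ennreal (C * G (\<lambda>a\<in>?I. - ?Tm z a)) \<partial>lborel_Pi ?I) = ennreal C * ennreal ?c0"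
      unfolding GTm int_exp[symmetric] using C by (subst nn_integral_cmult[symmetric]) (auto simp: ennreal_mult')
    also have "(\<integral>\<^sup>+z. ?f (?Tm z) \<partial>lborel_Pi ?I) = ennreal (C * ?c0) * (\<integral>\<^sup>+z. F (affine_vec p m L z) \<partial>gauss ?I)"
    proof -
      have "F (\<lambda>a\<in>?I. ?Tm z a + m $ a) * ennreal (C * G (?Tm z))
        = ennreal (C * ?c0) * (ennreal (exp (- (\<Sum>i<p. (z i)\<^sup>2) / 2) / ?c0) * F (affine_vec p m L z))" for z
      proof -
        have 1: "(\<lambda>a\<in>?I. ?Tm z a + m $ a) = affine_vec p m L z"
          by (auto simp: affine_vec_def fun_eq_iff)
        have 2: "ennreal (C * G (?Tm z)) = ennreal (C * ?c0) * ennreal (exp (- (\<Sum>i<p. (z i)\<^sup>2) / 2) / ?c0)"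
          unfolding GT using C by (subst ennreal_mult'[symmetric]) auto
        show ?thesis unfolding 1 2 by (simp only: mult_ac)
      qed
      moreover have A: "(\<lambda>z. F (affine_vec p m L z)) \<in> borel_measurable (PiM ?I (\<lambda>_. borel))"
        by (rule measurable_compose[OF measurable_affine_vec F])
      ultimately show ?thesis
        by (subst nn_integral_gauss) (auto simp: nn_integral_cmult)
    qed
    finally have "ennreal (C * ?c0) * (\<integral>\<^sup>+z. F (affine_vec p m L z) \<partial>gauss ?I) = (\<integral>\<^sup>+x. F x \<partial>mvnormal p m S) * (ennreal C * ennreal ?c0)"
      unfolding CG1 mvn[OF F] by (simp only: mult_1_right)
    also have "ennreal C * ennreal ?c0 = ennreal (C * ?c0)" using C by (simp add: ennreal_mult')
    finally have "ennreal (1 / (C * ?c0)) * (ennreal (C * ?c0) * (\<integral>\<^sup>+z. F (affine_vec p m L z) \<partial>gauss ?I))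
      = ennreal (1 / (C * ?c0)) * (ennreal (C * ?c0) * (\<integral>\<^sup>+x. F x \<partial>mvnormal p m S))" by (simp only: mult.commute)
    moreover have "ennreal (1 / (C * ?c0)) * ennreal (C * ?c0) = 1"
      using C c0 by (subst ennreal_mult'[symmetric]) auto
    ultimately show ?thesis by (simp only: mult.assoc[symmetric] mult_1_left)
  qed
  show ?thesis
  proof (rule measure_eqI)
    show "sets (mvnormal p m S) = sets (distr (gauss ?I) (rvec_space p) (affine_vec p m (S * T)))"
      by (simp add: mvnormal_def)
    fix A assume "A \<in> sets (mvnormal p m S)"
    then have A[measurable]: "A \<in> sets (PiM ?I (\<lambda>_. borel))" by (simp add: mvnormal_def)
    have Am: "affine_vec p m L \<in> gauss ?I \<rightarrow>\<^sub>M rvec_space p"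
      using measurable_affine_vec by (simp add: measurable_cong_sets[OF sets_gauss sets_rvec_space])
    have "emeasure (distr (gauss ?I) (rvec_space p) (affine_vec p m L)) A
      = (\<integral>\<^sup>+x. indicator A x \<partial>distr (gauss ?I) (rvec_space p) (affine_vec p m L))" by simp
    also have "\<dots> = (\<integral>\<^sup>+z. indicator A (affine_vec p m L z) \<partial>gauss ?I)"
      by (rule nn_integral_distr[OF Am]) simp
    also have "\<dots> = (\<integral>\<^sup>+x. indicator A x \<partial>mvnormal p m S)" by (rule main) simp
    also have "\<dots> = emeasure (mvnormal p m S) A" using A by (simp add: mvnormal_def)
    finally show "emeasure (mvnormal p m S) A = emeasure (distr (gauss ?I) (rvec_space p) (affine_vec p m (S * T))) A"
      by (simp add: L_def)
  qed
qed

lemma measurable_gauss_rows: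
  fixes A :: "'r \<Rightarrow> (nat \<Rightarrow> real) \<Rightarrow> (nat \<Rightarrow> real)"
  assumes A: "\<And>r. A r \<in> PiM {..<p} (\<lambda>_. borel) \<rightarrow>\<^sub>M PiM {..<p} (\<lambda>_. borel)"
  shows "(\<lambda>Z. \<lambda>r\<in>R. A r (\<lambda>c\<in>{..<p}. Z (r, c))) \<in> gauss (R \<times> {..<p}) \<rightarrow>\<^sub>M PiM R (\<lambda>_. rvec_space p)"
proof (rule measurable_restrict)
  fix r assume r: "r \<in> R"
  have "(\<lambda>Z. \<lambda>c\<in>{..<p}. Z (r, c)) \<in> PiM (R \<times> {..<p}) (\<lambda>_. borel) \<rightarrow>\<^sub>M PiM {..<p} (\<lambda>_. borel)"
    using r by (intro measurable_restrict measurable_component_singleton) auto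
  from measurable_compose[OF this A[of r]]
  show "(\<lambda>Z. A r (\<lambda>c\<in>{..<p}. Z (r, c))) \<in> gauss (R \<times> {..<p}) \<rightarrow>\<^sub>M rvec_space p"
    unfolding measurable_cong_sets[OF sets_gauss sets_rvec_space] .
qed

text \<open>Testing on boxes suffices, and the indicator of a box of rows is a product of functions
  of disjoint sets of coordinates.\<close>

lemma PiM_distr_gauss_rows:
  fixes A :: "'r \<Rightarrow> (nat \<Rightarrow> real) \<Rightarrow> (nat \<Rightarrow> real)"
  assumes R: "finite R" and A: "\<And>r. A r \<in> PiM {..<p} (\<lambda>_. borel) \<rightarrow>\<^sub>M PiM {..<p} (\<lambda>_. borel)"
  shows "PiM R (\<lambda>r. distr (gauss {..<p}) (rvec_space p) (A r)) =
    distr (gauss (R \<times> {..<p})) (PiM R (\<lambda>_. rvec_space p)) (\<lambda>Z. \<lambda>r\<in>R. A r (\<lambda>c\<in>{..<p}. Z (r, c)))"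
    (is "_ = ?D")
proof -
  have A': "A r \<in> gauss {..<p} \<rightarrow>\<^sub>M rvec_space p" for r
    using A by (simp add: measurable_cong_sets[OF sets_gauss sets_rvec_space])
  interpret P: product_sigma_finite "\<lambda>r. distr (gauss {..<p}) (rvec_space p) (A r)"
    by (intro product_sigma_finite.intro prob_space_imp_sigma_finite prob_space.prob_space_distr prob_space_gauss A')
  have row: "(\<lambda>Z. \<lambda>c\<in>{..<p}. Z (r, c)) \<in> PiM K (\<lambda>_. borel) \<rightarrow>\<^sub>M PiM {..<p} (\<lambda>_. borel)" if "{r} \<times> {..<p} \<subseteq> K" for r K
    using that by (intro measurable_restrict measurable_component_singleton) auto
  have row_meas: "(\<lambda>Z. A r (\<lambda>c\<in>{..<p}. Z (r, c))) \<in> PiM K (\<lambda>_. borel) \<rightarrow>\<^sub>M PiM {..<p} (\<lambda>_. borel)" if "{r} \<times> {..<p} \<subseteq> K" for r K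
    by (rule measurable_compose[OF row[OF that] A])
  note D_meas = measurable_gauss_rows[OF A, where R = R]
  have "?D = PiM R (\<lambda>r. distr (gauss {..<p}) (rvec_space p) (A r))"
  proof (rule P.PiM_eqI[OF R])
    show "sets ?D = sets (PiM R (\<lambda>r. distr (gauss {..<p}) (rvec_space p) (A r)))"
      unfolding sets_distr by (rule sets_PiM_cong) auto
  next
    fix E assume "\<And>r. r \<in> R \<Longrightarrow> E r \<in> sets (distr (gauss {..<p}) (rvec_space p) (A r))"
    then have E: "E r \<in> sets (PiM {..<p} (\<lambda>_. borel))" if "r \<in> R" for r using that by simp
    have box: "Pi\<^sub>E R E \<in> sets (PiM R (\<lambda>_. rvec_space p))"
      using E by (intro sets_PiM_I_finite R) auto
    define g where "g r x = (indicator (E r) (A r (\<lambda>c\<in>{..<p}. x (r, c))) :: ennreal)" for r x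
    have g_meas: "g r \<in> borel_measurable (PiM ({r} \<times> {..<p}) (\<lambda>_. borel))" if "r \<in> R" for r
      unfolding g_def by (rule measurable_compose[OF row_meas]) (use E[OF that] in auto)
    have "emeasure ?D (Pi\<^sub>E R E) = (\<integral>\<^sup>+x. indicator (Pi\<^sub>E R E) x \<partial>?D)"
      using box by simp
    also have "\<dots> = (\<integral>\<^sup>+Z. indicator (Pi\<^sub>E R E) (\<lambda>r\<in>R. A r (\<lambda>c\<in>{..<p}. Z (r, c))) \<partial>gauss (R \<times> {..<p}))"
      by (rule nn_integral_distr[OF D_meas]) (use box in simp)
    also have "\<dots> = (\<integral>\<^sup>+Z. (\<Prod>r\<in>R. g r (restrict Z ({r} \<times> {..<p}))) \<partial>gauss (\<Union>r\<in>R. {r} \<times> {..<p}))"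
    proof -
      have RU: "R \<times> {..<p} = (\<Union>r\<in>R. {r} \<times> {..<p})" by auto
      have "indicator (Pi\<^sub>E R E) (\<lambda>r\<in>R. A r (\<lambda>c\<in>{..<p}. Z (r, c))) = (\<Prod>r\<in>R. g r (restrict Z ({r} \<times> {..<p})))" for Z
      proof -
        have "g r (restrict Z ({r} \<times> {..<p})) = indicator (E r) (A r (\<lambda>c\<in>{..<p}. Z (r, c)))" for r
          unfolding g_def by (intro arg_cong[where f = "\<lambda>v. indicator (E r) (A r v)"]) auto
        then show ?thesis
          using R by (auto simp: indicator_def PiE_def Pi_def intro!: prod_zero[symmetric] prod.neutral[symmetric])
      qed
      then show ?thesis unfolding RU by simp
    qed
    also have "\<dots> = (\<Prod>r\<in>R. \<integral>\<^sup>+x. g r x \<partial>gauss ({r} \<times> {..<p}))"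
      by (rule nn_integral_gauss_blocks[OF R _ _ g_meas]) (auto simp: disjoint_family_on_def)
    also have "\<dots> = (\<Prod>r\<in>R. emeasure (distr (gauss {..<p}) (rvec_space p) (A r)) (E r))"
    proof (rule prod.cong[OF refl])
      fix r assume r: "r \<in> R"
      have "(\<integral>\<^sup>+x. g r x \<partial>gauss ({r} \<times> {..<p})) = (\<integral>\<^sup>+x. indicator (E r) (A r x) \<partial>gauss {..<p})"
      proof -
        have "(\<lambda>c. (r, c)) ` {..<p} = {r} \<times> {..<p}" by auto
        moreover have "(\<lambda>x. indicator (E r) (A r x) :: ennreal) \<in> borel_measurable (PiM {..<p} (\<lambda>_. borel))"
          by (rule measurable_compose[OF A]) (use E[OF r] in auto)
        ultimately show ?thesis
          using nn_integral_gauss_reindex[of "\<lambda>c. (r, c)" "{..<p}" "\<lambda>x. indicator (E r) (A r x)"]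
          by (simp add: g_def inj_on_def)
      qed
      also have "\<dots> = (\<integral>\<^sup>+x. indicator (E r) x \<partial>distr (gauss {..<p}) (rvec_space p) (A r))"
        by (rule nn_integral_distr[OF A', symmetric]) (use E[OF r] in simp)
      also have "\<dots> = emeasure (distr (gauss {..<p}) (rvec_space p) (A r)) (E r)" using E[OF r] by simp
      finally show "(\<integral>\<^sup>+x. g r x \<partial>gauss ({r} \<times> {..<p})) = emeasure (distr (gauss {..<p}) (rvec_space p) (A r)) (E r)" .
    qed
    finally show "emeasure ?D (Pi\<^sub>E R E) = (\<Prod>r\<in>R. emeasure (distr (gauss {..<p}) (rvec_space p) (A r)) (E r))" .
  qed
  then show ?thesis ..
qed

section \<open>Scatter matrices and Bartlett's statistic as Gram determinants\<close>

lemma sscp_mat_affine: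
  fixes m :: "real vec"
  assumes L: "L \<in> carrier_mat p p" and N: "N > 0"
    and x: "\<And>j a. j < N \<Longrightarrow> a < p \<Longrightarrow> x j a = m $ a + (\<Sum>l<p. L $$ (a, l) * z j l)"
    and a: "a < p" and b: "b < p"
  shows "sscp_mat p N x $$ (a, b) = (\<Sum>l<p. \<Sum>l'<p. L $$ (a, l) * sscp_mat p N z $$ (l, l') * L $$ (b, l'))"
proof -
  have dev: "x j a - sample_mean N x a = (\<Sum>l<p. L $$ (a, l) * (z j l - sample_mean N z l))" if "j < N" "a < p" for j a
  proof -
    have "(\<Sum>j<N. x j a) = real N * m $ a + (\<Sum>l<p. L $$ (a, l) * (\<Sum>j<N. z j l))"
      using x that by (simp add: sum.distrib sum_distrib_left sum.swap[of _ "{..<N}" "{..<p}"])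
    then have "sample_mean N x a = m $ a + (\<Sum>l<p. L $$ (a, l) * sample_mean N z l)"
    proof -
      have "(\<Sum>l<p. L $$ (a, l) * s l) / real N = (\<Sum>l<p. L $$ (a, l) * (s l / real N))" for s
        by (simp add: sum_divide_distrib)
      then show ?thesis
        unfolding sample_mean_def \<open>(\<Sum>j<N. x j a) = _\<close> add_divide_distrib using N by simp
    qed
    then show ?thesis using x[OF that] by (simp add: right_diff_distrib sum_subtractf)
  qed
  have "sscp_mat p N x $$ (a, b) = (\<Sum>j<N. (\<Sum>l<p. L $$ (a, l) * (z j l - sample_mean N z l)) * (\<Sum>l'<p. L $$ (b, l') * (z j l' - sample_mean N z l')))"
    unfolding sscp_mat_def using a b dev by simp
  also have "\<dots> = (\<Sum>j<N. \<Sum>l<p. \<Sum>l'<p. L $$ (a, l) * ((z j l - sample_mean N z l) * (z j l' - sample_mean N z l')) * L $$ (b, l'))"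
    by (simp add: sum_product mult_ac)
  also have "\<dots> = (\<Sum>l<p. \<Sum>l'<p. \<Sum>j<N. L $$ (a, l) * ((z j l - sample_mean N z l) * (z j l' - sample_mean N z l')) * L $$ (b, l'))"
    by (rule trans[OF sum.swap sum.cong[OF refl sum.swap]])
  also have "\<dots> = (\<Sum>l<p. \<Sum>l'<p. L $$ (a, l) * sscp_mat p N z $$ (l, l') * L $$ (b, l'))"
    unfolding sscp_mat_def by (intro sum.cong refl) (simp add: sum_distrib_left sum_distrib_right)
  finally show ?thesis .
qed

lemma det_congruence:
  assumes L: "L \<in> carrier_mat p p" and S: "S \<in> carrier_mat p p" and A: "A \<in> carrier_mat p p"
    and eq: "\<And>a b. a < p \<Longrightarrow> b < p \<Longrightarrow> A $$ (a, b) = (\<Sum>l<p. \<Sum>l'<p. L $$ (a, l) * S $$ (l, l') * L $$ (b, l'))"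
  shows "Determinant.det A = (Determinant.det L)\<^sup>2 * Determinant.det S"
proof -
  have "A = L * S * L\<^sup>T"
  proof (rule eq_matI)
    fix a b assume "a < dim_row (L * S * L\<^sup>T)" "b < dim_col (L * S * L\<^sup>T)"
    then have ab: "a < p" "b < p" using L by auto
    have "(L * S * L\<^sup>T) $$ (a, b) = (\<Sum>l'<p. (\<Sum>l<p. L $$ (a, l) * S $$ (l, l')) * L $$ (b, l'))"
    proof -
      have "(L * S * L\<^sup>T) $$ (a, b) = (\<Sum>l'<p. (L * S) $$ (a, l') * L\<^sup>T $$ (l', b))"
        using ab L S by (intro mat_mult_index_sum) auto
      also have "\<dots> = (\<Sum>l'<p. (\<Sum>l<p. L $$ (a, l) * S $$ (l, l')) * L $$ (b, l'))"
        by (intro sum.cong refl arg_cong2[where f = "(*)"] mat_mult_index_sum[OF L S]) (use ab L in auto)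
      finally show ?thesis .
    qed
    also have "\<dots> = A $$ (a, b)"
      unfolding eq[OF ab] sum_distrib_right by (rule sum.swap)
    finally show "A $$ (a, b) = (L * S * L\<^sup>T) $$ (a, b)" ..
  qed (use L A in auto)
  then show ?thesis
    using det_mult[of "L * S" p "L\<^sup>T"] det_mult[OF L S] det_transpose[OF L] L S
    by (simp add: power2_eq_square)
qed

text \<open>Subtracting the sample mean is the same as rotating the constant vector onto the first
  observation and deleting that observation.\<close>

lemma sscp_mat_eq_gram:
  fixes Z Z' :: "('i \<times> nat) \<times> nat \<Rightarrow> real"
  assumes N: "N > 0" and B: "B = {i} \<times> {..<N}"
    and Z': "\<And>r c. r \<in> B \<Longrightarrow> c < p \<Longrightarrow> Z' (r, c) = reflect B (householder B (i, 0) (\<lambda>_. 1)) (\<lambda>s. Z (s, c)) r"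
  shows "sscp_mat p N (\<lambda>j c. Z ((i, j), c)) = gram p (B - {(i, 0)}) Z'"
proof (rule eq_matI)
  fix a b assume "a < dim_row (gram p (B - {(i, 0)}) Z')" "b < dim_col (gram p (B - {(i, 0)}) Z')"
  then have ab: "a < p" "b < p" by (auto simp: gram_def)
  let ?z = "\<lambda>j c. Z ((i, j), c)"
  have fB: "finite B" "(i, 0) \<in> B" using N by (auto simp: B)
  have sumB: "(\<Sum>r\<in>B. h r) = (\<Sum>j<N. h (i, j))" for h :: "'i \<times> nat \<Rightarrow> real"
    unfolding B by (rule sum.reindex_bij_witness[of _ "\<lambda>j. (i, j)" snd]) auto
  have one: "(\<Sum>r\<in>B. (1::real)\<^sup>2) = real N" by (simp add: B)
  have piv: "Z' ((i, 0), c) = sqrt (real N) * sample_mean N ?z c" if "c < p" for c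
  proof -
    have "Z' ((i, 0), c) = (\<Sum>s\<in>B. 1 * Z (s, c)) / sqrt (\<Sum>r\<in>B. (1::real)\<^sup>2)"
      unfolding Z'[OF fB(2) that] by (rule reflect_householder_pivot[OF fB]) (unfold one, use N in simp)
    also have "\<dots> = (\<Sum>j<N. ?z j c) / sqrt (real N)"
      unfolding one sumB by simp
    also have "\<dots> = sqrt (real N) * sample_mean N ?z c"
      using N by (simp add: sample_mean_def field_simps)
    finally show ?thesis .
  qed
  have "(\<Sum>r\<in>B - {(i, 0)}. Z' (r, a) * Z' (r, b)) = (\<Sum>r\<in>B. Z' (r, a) * Z' (r, b)) - Z' ((i, 0), a) * Z' ((i, 0), b)"
    using fB by (simp add: sum.remove)
  also have "(\<Sum>r\<in>B. Z' (r, a) * Z' (r, b)) = (\<Sum>j<N. ?z j a * ?z j b)"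
    using ab by (simp add: Z' reflect_inner[OF fB(1)] sumB)
  also have "Z' ((i, 0), a) * Z' ((i, 0), b) = real N * sample_mean N ?z a * sample_mean N ?z b"
    using ab by (simp add: piv)
  also have "(\<Sum>j<N. ?z j a * ?z j b) - real N * sample_mean N ?z a * sample_mean N ?z b
    = (\<Sum>j<N. (?z j a - sample_mean N ?z a) * (?z j b - sample_mean N ?z b))"
  proof -
    have s: "(\<Sum>j<N. ?z j c) = real N * sample_mean N ?z c" for c using N by (simp add: sample_mean_def)
    have "(\<Sum>j<N. (?z j a - sample_mean N ?z a) * (?z j b - sample_mean N ?z b))
      = (\<Sum>j<N. ?z j a * ?z j b) - (\<Sum>j<N. ?z j a) * sample_mean N ?z b - sample_mean N ?z a * (\<Sum>j<N. ?z j b)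
        + real N * (sample_mean N ?z a * sample_mean N ?z b)"
      by (simp add: algebra_simps sum.distrib sum_subtractf sum_distrib_left sum_distrib_right)
    then show ?thesis unfolding s by (simp add: algebra_simps)
  qed
  finally show "sscp_mat p N ?z $$ (a, b) = gram p (B - {(i, 0)}) Z' $$ (a, b)"
    using ab by (simp add: sscp_mat_def gram_def)
qed (auto simp: sscp_mat_def gram_def)

definition bartlett_const :: "nat \<Rightarrow> nat \<Rightarrow> (nat \<Rightarrow> nat) \<Rightarrow> real" where
  "bartlett_const p k N = (let m = real (\<Sum>i<k. N i) - real k in
    m powr (m * real p / 2) / (\<Prod>i<k. (real (N i) - 1) powr ((real (N i) - 1) * real p / 2)))"

text \<open>The exponents \<open>(N i - 1) / 2\<close> add up to the pooled exponent, so the factor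
  \<open>(Determinant.det L)\<^sup>2\<close> contributed by the linear map cancels, while the means
  drop out with the centring. Equality of the covariances enters as the use of one \<open>L\<close>
  for all samples.\<close>

lemma bartlett_Lambda_eq_gram_ratio:
  fixes Z :: "(nat \<times> nat) \<times> nat \<Rightarrow> real" and mu :: "nat \<Rightarrow> real vec"
  assumes k: "k > 0" and N: "\<And>i. i < k \<Longrightarrow> N i > 0"
    and L: "L \<in> carrier_mat p p" "Determinant.det L \<noteq> 0"
    and B: "B = (\<lambda>i. {i} \<times> {..<N i})"
    and x: "\<And>i j a. i < k \<Longrightarrow> j < N i \<Longrightarrow> a < p \<Longrightarrow> x i j a = mu i $ a + (\<Sum>l<p. L $$ (a, l) * Z ((i, j), l))"
    and Z': "\<And>i r c. i < k \<Longrightarrow> r \<in> B i \<Longrightarrow> c < p \<Longrightarrow>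
      Z' (r, c) = reflect (B i) (householder (B i) (i, 0) (\<lambda>_. 1)) (\<lambda>s. Z (s, c)) r"
  shows "bartlett_Lambda p k N x = bartlett_const p k N *
    gram_ratio k p (\<lambda>i. B i - {(i, 0)}) (\<lambda>i. (real (N i) - 1) / 2) (\<Union>i<k. B i - {(i, 0)}) Z'"
proof -
  let ?B = "\<lambda>i. B i - {(i, 0)}"
  let ?a = "\<lambda>i. (real (N i) - 1) / 2"
  have sum_a: "(\<Sum>i<k. ?a i) = (real (\<Sum>i<k. N i) - real k) / 2"
    by (simp add: sum_divide_distrib[symmetric] sum_subtractf)
  have kne: "{..<k} \<noteq> {}" using k by auto
  define S where "S i = sscp_mat p (N i) (\<lambda>j c. Z ((i, j), c))" for i
  have S: "S i = gram p (?B i) Z'" if "i < k" for i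
    unfolding S_def by (rule sscp_mat_eq_gram[OF N[OF that]]) (use B Z'[OF that] in auto)
  have A: "sscp_mat p (N i) (x i) $$ (a, b) = (\<Sum>l<p. \<Sum>l'<p. L $$ (a, l) * S i $$ (l, l') * L $$ (b, l'))"
    if "i < k" "a < p" "b < p" for i a b
    unfolding S_def using that x by (intro sscp_mat_affine[OF L(1) N]) auto
  have det_i: "Determinant.det (sscp_mat p (N i) (x i)) = (Determinant.det L)\<^sup>2 * Determinant.det (gram p (?B i) Z')" if "i < k" for i
    unfolding S[OF that, symmetric] using that A
    by (intro det_congruence[OF L(1)]) (auto simp: S_def sscp_mat_def)
  have gram_sum: "gram p (\<Union>i<k. ?B i) Z' $$ (a, b) = (\<Sum>i<k. gram p (?B i) Z' $$ (a, b))" if "a < p" "b < p" for a b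
    using that unfolding gram_def by simp (subst sum.UNION_disjoint, auto simp: B)
  have det_sum: "Determinant.det (mat p p (\<lambda>(a, b). \<Sum>i<k. sscp_mat p (N i) (x i) $$ (a, b)))
    = (Determinant.det L)\<^sup>2 * Determinant.det (gram p (\<Union>i<k. ?B i) Z')"
  proof (rule det_congruence[OF L(1)])
    fix a b assume ab: "a < p" "b < p"
    have "(\<Sum>l<p. \<Sum>l'<p. L $$ (a, l) * gram p (\<Union>i<k. ?B i) Z' $$ (l, l') * L $$ (b, l'))
      = (\<Sum>l<p. \<Sum>l'<p. \<Sum>i<k. L $$ (a, l) * S i $$ (l, l') * L $$ (b, l'))"
      by (intro sum.cong refl) (simp add: gram_sum S sum_distrib_left sum_distrib_right)
    also have "\<dots> = (\<Sum>l<p. \<Sum>i<k. \<Sum>l'<p. L $$ (a, l) * S i $$ (l, l') * L $$ (b, l'))"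
      by (intro sum.cong refl sum.swap)
    also have "\<dots> = (\<Sum>i<k. \<Sum>l<p. \<Sum>l'<p. L $$ (a, l) * S i $$ (l, l') * L $$ (b, l'))"
      by (rule sum.swap)
    also have "\<dots> = (\<Sum>i<k. sscp_mat p (N i) (x i) $$ (a, b))" using A ab by simp
    finally show "mat p p (\<lambda>(a, b). \<Sum>i<k. sscp_mat p (N i) (x i) $$ (a, b)) $$ (a, b)
      = (\<Sum>l<p. \<Sum>l'<p. L $$ (a, l) * gram p (\<Union>i<k. ?B i) Z' $$ (l, l') * L $$ (b, l'))" using ab by simp
  qed (auto simp: gram_def)
  let ?D = "(Determinant.det L)\<^sup>2"
  have D: "?D powr (\<Sum>i<k. ?a i) \<noteq> 0" using L(2) by simp
  have "(\<Prod>i<k. Determinant.det (sscp_mat p (N i) (x i)) powr ?a i)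
      = ?D powr (\<Sum>i<k. ?a i) * (\<Prod>i<k. Determinant.det (gram p (?B i) Z') powr ?a i)"
    using kne by (simp add: det_i powr_mult prod.distrib powr_sum_nonempty)
  moreover have "Determinant.det (mat p p (\<lambda>(a, b). \<Sum>i<k. sscp_mat p (N i) (x i) $$ (a, b))) powr (\<Sum>i<k. ?a i)
      = ?D powr (\<Sum>i<k. ?a i) * Determinant.det (gram p (\<Union>i<k. ?B i) Z') powr (\<Sum>i<k. ?a i)"
    unfolding det_sum by (rule powr_mult)
  ultimately have "(\<Prod>i<k. Determinant.det (sscp_mat p (N i) (x i)) powr ?a i)
      / Determinant.det (mat p p (\<lambda>(a, b). \<Sum>i<k. sscp_mat p (N i) (x i) $$ (a, b))) powr (\<Sum>i<k. ?a i)
    = (\<Prod>i<k. Determinant.det (gram p (?B i) Z') powr ?a i) / Determinant.det (gram p (\<Union>i<k. ?B i) Z') powr (\<Sum>i<k. ?a i)"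
    by (simp only: mult_divide_mult_cancel_left[OF D])
  also have "\<dots> = gram_ratio k p ?B ?a (\<Union>i<k. ?B i) Z'"
    unfolding gram_ratio_def powr_minus divide_inverse ..
  finally have eq: "(\<Prod>i<k. Determinant.det (sscp_mat p (N i) (x i)) powr ?a i)
      / Determinant.det (mat p p (\<lambda>(a, b). \<Sum>i<k. sscp_mat p (N i) (x i) $$ (a, b))) powr (\<Sum>i<k. ?a i)
    = gram_ratio k p ?B ?a (\<Union>i<k. ?B i) Z'" .
  show ?thesis
    unfolding bartlett_Lambda_def Let_def bartlett_const_def eq[unfolded sum_a] by (rule mult.commute)
qed

lemma borel_measurable_bartlett_Lambda:
  assumes x: "\<And>i j a. i < k \<Longrightarrow> j < N i \<Longrightarrow> a < p \<Longrightarrow> (\<lambda>\<omega>. x \<omega> i j a) \<in> borel_measurable M"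
  shows "(\<lambda>\<omega>. bartlett_Lambda p k N (x \<omega>)) \<in> borel_measurable M"
proof -
  have sscp: "(\<lambda>\<omega>. \<Sum>j<N i. (x \<omega> i j a - sample_mean (N i) (x \<omega> i) a) * (x \<omega> i j b - sample_mean (N i) (x \<omega> i) b)) \<in> borel_measurable M"
    if "i < k" "a < p" "b < p" for i a b
    unfolding sample_mean_def using x that
    by (intro borel_measurable_sum borel_measurable_times borel_measurable_diff borel_measurable_divide borel_measurable_const) auto
  have det: "(\<lambda>\<omega>. Determinant.det (sscp_mat p (N i) (x \<omega> i))) \<in> borel_measurable M" if "i < k" for i
    unfolding sscp_mat_def using sscp[OF that] by (rule borel_measurable_det_mat)
  have "(\<lambda>\<omega>. Determinant.det (mat p p (\<lambda>(a, b). \<Sum>i<k. sscp_mat p (N i) (x \<omega> i) $$ (a, b)))) \<in> borel_measurable M"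
  proof (rule borel_measurable_det_mat)
    fix a b assume ab: "a < p" "b < p"
    then show "(\<lambda>\<omega>. \<Sum>i<k. sscp_mat p (N i) (x \<omega> i) $$ (a, b)) \<in> borel_measurable M"
      using sscp by (intro borel_measurable_sum) (simp add: sscp_mat_def)
  qed
  then show ?thesis
    unfolding bartlett_Lambda_def Let_def using det
    by (intro borel_measurable_times borel_measurable_divide borel_measurable_prod powr_real_measurable borel_measurable_const) auto
qed

subsection \<open>Asymptotics of Gamma quotients\<close>

lemma nonneg_of_antimono_tendsto_0:
  fixes f f' :: "real \<Rightarrow> real"
  assumes d: "\<And>x. x > 0 \<Longrightarrow> (f has_real_derivative f' x) (at x)" and f': "\<And>x. x > 0 \<Longrightarrow> f' x \<le> 0"
    and lim: "(f \<longlongrightarrow> 0) at_top" and x: "x > 0"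
  shows "f x \<ge> 0"
proof (rule tendsto_upperbound[OF lim])
  show "eventually (\<lambda>y. f y \<le> f x) at_top"
    using eventually_ge_at_top[of x]
  proof eventually_elim
    case (elim y)
    show ?case
    proof (rule DERIV_nonpos_imp_nonincreasing[OF elim])
      fix z assume "x \<le> z"
      then have "z > 0" using x by simp
      then show "\<exists>y. (f has_real_derivative y) (at z) \<and> y \<le> 0" using d f' by blast
    qed
  qed
qed simp

text \<open>The quantity is the error of the trapezoid rule for the convex function
  \<open>1 / x\<close> on \<open>[y, y + 1]\<close>, and its upper bound is shaped to telescope in
  steps of 1. The error and its distance to the bound both tend to 0 at infinity, so a nonpositive
  derivative makes each of them nonnegative.\<close>

lemma trapezoid_ln:
  fixes y :: real
  assumes "y > 0"
  shows "ln (y + 1) - ln y \<le> (1 / y + 1 / (y + 1)) / 2"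
    and "(1 / y + 1 / (y + 1)) / 2 - (ln (y + 1) - ln y) \<le> (1 / y\<^sup>2 - 1 / (y + 1)\<^sup>2) / 4"
proof -
  let ?T = "\<lambda>y::real. (1 / y + 1 / (y + 1)) / 2 - (ln (y + 1) - ln y)"
  let ?T' = "\<lambda>y::real. - (1 / y - 1 / (y + 1))\<^sup>2 / 2"
  have dT: "(?T has_real_derivative ?T' x) (at x)" if "x > 0" for x
  proof -
    define u v where "u = 1 / x" and "v = 1 / (x + 1)"
    \<comment> \<open>Reciprocals of numbers at distance 1 satisfy this identity, which turns the
      derivatives into algebra in \<open>u\<close> and \<open>v\<close>.\<close>
    have uv: "u - v = u * v" using that by (auto simp: u_def v_def field_simps)
    have "(?T has_real_derivative ((- u\<^sup>2 - v\<^sup>2) / 2 - (v - u))) (at x)"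
      unfolding u_def v_def using that by (auto intro!: derivative_eq_intros simp: power2_eq_square)
    also have "(- u\<^sup>2 - v\<^sup>2) / 2 - (v - u) = - (u - v)\<^sup>2 / 2"
    proof -
      have "v - u = - (u * v)" using uv by simp
      then show ?thesis by (simp only:) (simp add: power2_eq_square field_simps)
    qed
    finally show ?thesis by (simp add: u_def v_def)
  qed
  have "?T y \<ge> 0"
    by (rule nonneg_of_antimono_tendsto_0[OF dT _ _ assms]) (auto, real_asymp)
  then show "ln (y + 1) - ln y \<le> (1 / y + 1 / (y + 1)) / 2" by simp
  let ?E = "\<lambda>y::real. (1 / y\<^sup>2 - 1 / (y + 1)\<^sup>2) / 4 - ?T y"
  have dE: "(?E has_real_derivative (- (1 / x ^ 3 - 1 / (x + 1) ^ 3) / 2 - ?T' x)) (at x)" if "x > 0" for x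
  proof -
    have 1: "((\<lambda>y::real. 1 / y\<^sup>2) has_real_derivative - 2 / x ^ 3) (at x)" if "x > 0" for x
      using that by (auto intro!: derivative_eq_intros simp: field_simps power2_eq_square power3_eq_cube)
    have 2: "((\<lambda>y::real. 1 / (y + 1)\<^sup>2) has_real_derivative (- 2 / (x + 1) ^ 3) * 1) (at x)"
      by (rule DERIV_chain2[OF 1]) (use that in \<open>auto intro!: derivative_eq_intros\<close>)
    show ?thesis
      by (rule DERIV_cong[OF DERIV_diff[OF DERIV_cdivide[OF DERIV_diff[OF 1[OF that] 2]] dT[OF that]]]) simp
  qed
  have "?E y \<ge> 0"
  proof (rule nonneg_of_antimono_tendsto_0[OF dE _ _ assms])
    fix x :: real assume x: "x > 0"
    define u v where "u = 1 / x" and "v = 1 / (x + 1)"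
    have uv: "u > 0" "v > 0" "u - v = u * v" using x by (auto simp: u_def v_def field_simps)
    have "(u - v)\<^sup>2 = (u - v) * (u * v)" by (simp add: uv(3) power2_eq_square)
    also have "\<dots> \<le> (u - v) * (u\<^sup>2 + u * v + v\<^sup>2)"
      using uv by (intro mult_left_mono) auto
    also have "\<dots> = u ^ 3 - v ^ 3" by (simp add: algebra_simps power2_eq_square power3_eq_cube)
    finally show "- (1 / x ^ 3 - 1 / (x + 1) ^ 3) / 2 - ?T' x \<le> 0"
    proof -
      have c: "1 / x ^ 3 = u ^ 3" "1 / (x + 1) ^ 3 = v ^ 3" by (simp_all add: u_def v_def power_one_over)
      assume "(u - v)\<^sup>2 \<le> u ^ 3 - v ^ 3"
      moreover have "b \<le> a \<Longrightarrow> - a / 2 - - b / 2 \<le> 0" for a b :: real by simp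
      ultimately show ?thesis unfolding c u_def[symmetric] v_def[symmetric] by blast
    qed
  qed (assumption, real_asymp)
  then show "(1 / y + 1 / (y + 1)) / 2 - (ln (y + 1) - ln y) \<le> (1 / y\<^sup>2 - 1 / (y + 1)\<^sup>2) / 4" by simp
qed

lemma Digamma_add_nat:
  fixes y :: real
  assumes "y > 0"
  shows "Digamma (y + real m) = Digamma y + (\<Sum>j<m. inverse (y + real j))"
proof (induction m)
  case (Suc m)
  have "Digamma (y + real m + 1) = Digamma (y + real m) + 1 / (y + real m)"
    using assms by (intro Digamma_plus1) linarith
  then show ?case using Suc by (simp add: add.assoc add.commute[of 1] inverse_eq_divide)
qed simp

text \<open>Along \<open>y, y + 1, ...\<close> the defect \<open>r\<close> changes in one step by
  exactly the trapezoid error. It therefore increases to its limit 0, and it decreases to 0 once the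
  telescoping bound is added.\<close>

lemma Digamma_bounds:
  fixes y :: real
  assumes y: "y > 0"
  shows "\<bar>Digamma y - ln y + 1 / (2 * y)\<bar> \<le> 1 / (4 * y\<^sup>2)"
proof -
  define r where "r y = Digamma y - ln y + 1 / (2 * y)" for y :: real
  have step: "r (x + 1) - r x = (1 / x + 1 / (x + 1)) / 2 - (ln (x + 1) - ln x)" if "x > 0" for x
  proof -
    have "Digamma (x + 1) = Digamma x + 1 / x" using that by (intro Digamma_plus1) simp
    moreover have "1 / (2 * x) = 1 / x / 2" "1 / (2 * (x + 1)) = 1 / (x + 1) / 2" by simp_all
    moreover have "D + u - l1 + v / 2 - (D - l0 + u / 2) = (u + v) / 2 - (l1 - l0)" for D u v l0 l1 :: real
      by (simp add: field_simps)
    ultimately show ?thesis unfolding r_def by (simp only:)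
  qed
  have lim: "(\<lambda>m. r (y + real m)) \<longlonglongrightarrow> 0"
  proof -
    have "(\<lambda>m. ln (real m) - (\<Sum>j<m. inverse (y + real j))) \<longlonglongrightarrow> Digamma y"
      using Digamma_LIMSEQ[of y] y by simp
    then have "(\<lambda>m. Digamma y - (ln (real m) - (\<Sum>j<m. inverse (y + real j)))) \<longlonglongrightarrow> Digamma y - Digamma y"
      by (intro tendsto_intros)
    then have "(\<lambda>m. Digamma (y + real m) - ln (real m)) \<longlonglongrightarrow> 0"
      by (simp add: Digamma_add_nat[OF y] algebra_simps)
    moreover have "(\<lambda>m. ln (real m) - ln (y + real m) + 1 / (2 * (y + real m))) \<longlonglongrightarrow> 0"
      by real_asymp
    ultimately have "(\<lambda>m. (Digamma (y + real m) - ln (real m)) + (ln (real m) - ln (y + real m) + 1 / (2 * (y + real m)))) \<longlonglongrightarrow> 0 + 0"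
      by (rule tendsto_add)
    moreover have "(D - l) + (l - l' + w) = D - l' + w" for D l l' w :: real by simp
    ultimately show ?thesis unfolding r_def by (simp only: add_0)
  qed
  have suc: "y + real (Suc m) = y + real m + 1" for m by simp
  have "incseq (\<lambda>m. r (y + real m))"
  proof (rule incseq_SucI)
    fix m
    have "0 \<le> r (y + real m + 1) - r (y + real m)"
      using y by (subst step) (simp, simp only: diff_ge_0_iff_ge, intro trapezoid_ln(1), simp)
    then show "r (y + real m) \<le> r (y + real (Suc m))" unfolding suc by simp
  qed
  from incseq_le[OF this lim, of 0] have upper: "r y \<le> 0" by simp
  have "decseq (\<lambda>m. r (y + real m) + 1 / (4 * (y + real m)\<^sup>2))"
  proof (rule decseq_SucI)
    fix m
    have "r (y + real m + 1) - r (y + real m) \<le> (1 / (y + real m)\<^sup>2 - 1 / (y + real m + 1)\<^sup>2) / 4"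
      using y by (subst step) (simp, intro trapezoid_ln(2), simp)
    also have "\<dots> = 1 / (4 * (y + real m)\<^sup>2) - 1 / (4 * (y + real m + 1)\<^sup>2)"
      by (simp add: diff_divide_distrib)
    finally show "r (y + real (Suc m)) + 1 / (4 * (y + real (Suc m))\<^sup>2) \<le> r (y + real m) + 1 / (4 * (y + real m)\<^sup>2)"
      unfolding suc by simp
  qed
  moreover have "(\<lambda>m. r (y + real m) + 1 / (4 * (y + real m)\<^sup>2)) \<longlonglongrightarrow> 0 + 0"
    by (intro tendsto_add lim) real_asymp
  ultimately have "0 \<le> r y + 1 / (4 * y\<^sup>2)"
    using decseq_ge[of "\<lambda>m. r (y + real m) + 1 / (4 * (y + real m)\<^sup>2)" 0 0] by simp
  with upper show ?thesis by (simp add: r_def)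
qed

text \<open>A mean value estimate on the interval from -1/2 to 1/2, where
  \<open>x + t \<ge> x / 2\<close>. The derivative splits into the digamma defect, the second-order
  error of the logarithm and the change of \<open>1 / (2 * x)\<close>; these contribute 1, 1/2 and
  1/2 to the constant 2. The factor \<bar>\<delta>\<bar> matters later: it supplies the
  \<open>1 / \<sigma>\<close> that makes the total error vanish.\<close>

lemma ln_Gamma_shift_bound:
  fixes x \<delta> :: real
  assumes x: "x \<ge> 1" and \<delta>: "\<bar>\<delta>\<bar> \<le> 1 / 2"
  shows "\<bar>ln_Gamma (x + \<delta>) - ln_Gamma x - \<delta> * (ln x - 1 / (2 * x)) - \<delta>\<^sup>2 / (2 * x)\<bar> \<le> 2 * \<bar>\<delta>\<bar> / x\<^sup>2"
proof -
  define \<phi> where "\<phi> t = ln_Gamma (x + t) - t * (ln x - 1 / (2 * x)) - t\<^sup>2 / (2 * x)" for t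
  define \<phi>' where "\<phi>' t = Digamma (x + t) - (ln x - 1 / (2 * x)) - t / x" for t
  have "norm (\<phi> \<delta> - \<phi> 0) \<le> 2 / x\<^sup>2 * norm (\<delta> - 0)"
  proof (rule field_differentiable_bound[of "{-1/2..1/2}"])
    fix t :: real assume t: "t \<in> {-1/2..1/2}"
    then have xt: "x + t > 0" using x by auto
    show "(\<phi> has_field_derivative \<phi>' t) (at t within {-1/2..1/2})"
      unfolding \<phi>_def \<phi>'_def using xt x by (auto intro!: derivative_eq_intros)
    have xt2: "x + t \<ge> x / 2" using t x by auto
    have "(x / 2)\<^sup>2 \<le> (x + t)\<^sup>2" using xt2 x by (intro power_mono) auto
    then have "1 / (4 * (x + t)\<^sup>2) \<le> 1 / x\<^sup>2"
      using x xt by (intro divide_left_mono) (auto simp: power_divide)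
    then have 1: "\<bar>Digamma (x + t) - ln (x + t) + 1 / (2 * (x + t))\<bar> \<le> 1 / x\<^sup>2"
      using Digamma_bounds[OF xt] by linarith
    have "\<bar>t / x\<bar> \<le> 1 / 2" using t x by (auto simp: abs_le_iff field_simps)
    then have "\<bar>ln (1 + t / x) - t / x\<bar> \<le> 2 * (t / x)\<^sup>2"
      by (rule abs_ln_one_plus_x_minus_x_bound)
    also have "\<dots> \<le> (1 / 2) / x\<^sup>2"
    proof -
      have "t\<^sup>2 \<le> (1 / 2)\<^sup>2" using t by (intro abs_le_square_iff[THEN iffD1]) auto
      then show ?thesis using x by (simp add: power_divide divide_simps)
    qed
    also have "ln (1 + t / x) = ln (x + t) - ln x"
    proof -
      have "1 + t / x = (x + t) / x" using x by (simp add: field_simps)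
      then show ?thesis using x xt by (simp add: ln_div)
    qed
    finally have 2: "\<bar>ln (x + t) - ln x - t / x\<bar> \<le> (1 / 2) / x\<^sup>2" .
    have 3: "\<bar>1 / (2 * x) - 1 / (2 * (x + t))\<bar> \<le> (1 / 2) / x\<^sup>2"
    proof -
      have "1 / (2 * x) - 1 / (2 * (x + t)) = t / (2 * x * (x + t))"
        using x xt by (simp add: field_simps)
      then have "\<bar>1 / (2 * x) - 1 / (2 * (x + t))\<bar> = \<bar>t\<bar> / (2 * x * (x + t))"
        using x xt by (simp add: abs_mult)
      also have "\<dots> \<le> (1 / 2) / (2 * x * (x / 2))"
        using t x xt2 by (intro frac_le mult_left_mono) auto
      finally show ?thesis by (simp add: power2_eq_square)
    qed
    have "\<phi>' t = (Digamma (x + t) - ln (x + t) + 1 / (2 * (x + t))) + (ln (x + t) - ln x - t / x) + (1 / (2 * x) - 1 / (2 * (x + t)))"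
      by (simp add: \<phi>'_def)
    then have "\<bar>\<phi>' t\<bar> \<le> 1 / x\<^sup>2 + (1 / 2) / x\<^sup>2 + (1 / 2) / x\<^sup>2" using 1 2 3 by linarith
    then show "norm (\<phi>' t) \<le> 2 / x\<^sup>2" by simp
  qed (use \<delta> in \<open>auto simp: abs_le_iff\<close>)
  then show ?thesis by (simp add: \<phi>_def algebra_simps)
qed

text \<open>Stirling's approximation of \<open>\<Sum>\<^sub>d\<^sub>\<le>\<^sub>x (ln (d/2) - 1/d)\<close> up to an additive constant.\<close>

definition stirling_sum :: "real \<Rightarrow> real" where
  "stirling_sum x = x * ln x - x - ln x / 2 - x * ln 2"

text \<open>Coefficients and error are rewritten as backward differences in \<open>d\<close>, so
  that the sum over the \<open>p\<close> Gamma factors telescopes. The constant 10 is 8 from the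
  shift estimate at \<open>d / 2\<close>, plus 1 for each of the two replaced coefficients, the
  second by \<open>\<delta>\<^sup>2 \<le> \<bar>\<delta>\<bar>\<close>.\<close>

lemma ln_Gamma_half_shift_bound:
  fixes d \<delta> :: real
  assumes d: "d \<ge> 2" and \<delta>: "\<bar>\<delta>\<bar> \<le> 1 / 2"
  shows "\<bar>ln_Gamma (d / 2 + \<delta>) - ln_Gamma (d / 2) - \<delta> * (stirling_sum d - stirling_sum (d - 1))
    - \<delta>\<^sup>2 * (ln d - ln (d - 1))\<bar> \<le> 10 * \<bar>\<delta>\<bar> * (1 / (d - 1) - 1 / d)"
proof -
  define e where "e = 1 / (d - 1) - 1 / d"
  define T where "T = (1 / (d - 1) + 1 / d) / 2 - (ln d - ln (d - 1))"
  have e: "e = 1 / (d * (d - 1))" "e > 0" using d by (auto simp: e_def field_simps)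
  have T: "0 \<le> T" "T \<le> (1 / (d - 1)\<^sup>2 - 1 / d\<^sup>2) / 4"
    using trapezoid_ln[of "d - 1"] d by (auto simp: T_def)
  \<comment> \<open>One order smaller than \<open>e\<close>, which compensates for the factor
    \<open>d - 3 / 2\<close> that multiplies \<open>T\<close> in \<open>B\<close>.\<close>
  have Te: "T \<le> e * (1 / (d - 1) + 1 / d) / 4"
    using T(2) by (simp add: e_def power2_eq_square algebra_simps)
  have inv: "1 / (d - 1) \<le> 1" "1 / d \<le> 1" using d by auto
  have T_le: "T \<le> e / 2"
  proof -
    have "e * (1 / (d - 1) + 1 / d) \<le> e * 2" using inv e(2) by (intro mult_left_mono) auto
    from order_trans[OF Te divide_right_mono[OF this, of 4]] show ?thesis by simp
  qed
  have A: "\<bar>ln_Gamma (d / 2 + \<delta>) - ln_Gamma (d / 2) - \<delta> * (ln (d / 2) - 1 / d) - \<delta>\<^sup>2 / d\<bar> \<le> 8 * \<bar>\<delta>\<bar> * e"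
  proof -
    have "\<bar>ln_Gamma (d / 2 + \<delta>) - ln_Gamma (d / 2) - \<delta> * (ln (d / 2) - 1 / d) - \<delta>\<^sup>2 / d\<bar> \<le> 2 * \<bar>\<delta>\<bar> / (d / 2)\<^sup>2"
      using ln_Gamma_shift_bound[of "d / 2" \<delta>] d \<delta> by simp
    also have "2 * \<bar>\<delta>\<bar> / (d / 2)\<^sup>2 = 8 * \<bar>\<delta>\<bar> * (1 / (d * d))" by (simp add: power2_eq_square)
    also have "1 / (d * d) \<le> e" unfolding e(1) using d by (intro divide_left_mono mult_left_mono) auto
    finally show ?thesis by (simp add: mult_left_mono)
  qed
  have B: "\<bar>(ln (d / 2) - 1 / d) - (stirling_sum d - stirling_sum (d - 1))\<bar> \<le> e"
  proof -
    have "(ln (d / 2) - 1 / d) - (stirling_sum d - stirling_sum (d - 1)) = 1 - 1 / d - (d - 3 / 2) * (ln d - ln (d - 1))"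
      using d by (simp add: stirling_sum_def ln_div) (simp add: field_simps)
    also have "ln d - ln (d - 1) = (1 / (d - 1) + 1 / d) / 2 - T" by (simp add: T_def)
    also have "1 - 1 / d - (d - 3 / 2) * ((1 / (d - 1) + 1 / d) / 2 - T) = e / 4 + (d - 3 / 2) * T"
      unfolding e(1) using d by (simp add: field_simps)
    finally have *: "(ln (d / 2) - 1 / d) - (stirling_sum d - stirling_sum (d - 1)) = e / 4 + (d - 3 / 2) * T" .
    have "(d - 3 / 2) * T \<le> (d - 3 / 2) * (e * (1 / (d - 1) + 1 / d) / 4)"
      using Te d by (intro mult_left_mono) auto
    also have "\<dots> = e * ((d - 3 / 2) * (1 / (d - 1) + 1 / d)) / 4" by simp
    also have "(d - 3 / 2) * (1 / (d - 1) + 1 / d) \<le> 2"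
      using d by (simp add: divide_simps) (simp add: algebra_simps)
    finally have "(d - 3 / 2) * T \<le> e / 2" using e(2) by simp
    moreover have "0 \<le> (d - 3 / 2) * T" using T d by auto
    ultimately show ?thesis unfolding * using e(2) by simp
  qed
  have C: "\<bar>1 / d - (ln d - ln (d - 1))\<bar> \<le> e"
  proof -
    have "1 / d - (ln d - ln (d - 1)) = T - e / 2" by (simp add: T_def e_def field_simps)
    then show ?thesis using T_le T(1) e(2) by linarith
  qed
  have "ln_Gamma (d / 2 + \<delta>) - ln_Gamma (d / 2) - \<delta> * (stirling_sum d - stirling_sum (d - 1)) - \<delta>\<^sup>2 * (ln d - ln (d - 1))
    = (ln_Gamma (d / 2 + \<delta>) - ln_Gamma (d / 2) - \<delta> * (ln (d / 2) - 1 / d) - \<delta>\<^sup>2 / d)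
      + \<delta> * ((ln (d / 2) - 1 / d) - (stirling_sum d - stirling_sum (d - 1)))
      + \<delta>\<^sup>2 * (1 / d - (ln d - ln (d - 1)))"
    by (simp add: algebra_simps)
  also have "\<bar>\<dots>\<bar> \<le> 8 * \<bar>\<delta>\<bar> * e + \<bar>\<delta>\<bar> * e + \<delta>\<^sup>2 * e"
  proof -
    have "\<bar>\<delta> * ((ln (d / 2) - 1 / d) - (stirling_sum d - stirling_sum (d - 1)))\<bar> \<le> \<bar>\<delta>\<bar> * e"
      unfolding abs_mult using B by (intro mult_left_mono) auto
    moreover have "\<bar>\<delta>\<^sup>2 * (1 / d - (ln d - ln (d - 1)))\<bar> \<le> \<delta>\<^sup>2 * e"
      unfolding abs_mult using C by (simp add: mult_left_mono)
    ultimately show ?thesis using A by linarith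
  qed
  also have "\<delta>\<^sup>2 * e \<le> \<bar>\<delta>\<bar> * e"
  proof -
    have "\<bar>\<delta>\<bar> * \<bar>\<delta>\<bar> \<le> \<bar>\<delta>\<bar> * 1" using \<delta> by (intro mult_left_mono) auto
    then show ?thesis using e(2) by (intro mult_right_mono) (auto simp: power2_eq_square)
  qed
  finally show ?thesis by (simp add: e_def)
qed

text \<open>The one-step estimates telescope along \<open>d = M - j\<close>; the assumption
  \<open>M - p \<ge> 1\<close> keeps even the last of these at least 2.\<close>

lemma sum_ln_Gamma_shift_bound:
  fixes M \<delta> :: real
  assumes M: "M - real p \<ge> 1" and \<delta>: "\<bar>\<delta>\<bar> \<le> 1 / 2"
  shows "\<bar>(\<Sum>j<p. ln_Gamma ((M - real j) / 2 + \<delta>) - ln_Gamma ((M - real j) / 2))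
    - \<delta> * (stirling_sum M - stirling_sum (M - real p)) - \<delta>\<^sup>2 * (ln M - ln (M - real p))\<bar> \<le> 10 * \<bar>\<delta>\<bar> / (M - real p)"
proof -
  have "\<bar>(\<Sum>j<p. ln_Gamma ((M - real j) / 2 + \<delta>) - ln_Gamma ((M - real j) / 2))
    - \<delta> * (stirling_sum M - stirling_sum (M - real p)) - \<delta>\<^sup>2 * (ln M - ln (M - real p))\<bar> \<le> 10 * \<bar>\<delta>\<bar> * (1 / (M - real p) - 1 / M)"
    using M
  proof (induction p)
    case (Suc p)
    have d: "M - real p \<ge> 2" using Suc.prems by simp
    have s: "M - real (Suc p) = M - real p - 1" by simp
    from ln_Gamma_half_shift_bound[OF d \<delta>] Suc.IH d show ?case
      unfolding s sum.lessThan_Suc by (simp add: algebra_simps abs_le_iff)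
  qed simp
  also have "\<dots> \<le> 10 * \<bar>\<delta>\<bar> * (1 / (M - real p))"
    using M by (intro mult_left_mono) auto
  finally show ?thesis by simp
qed

subsection \<open>The limit of the moment generating function\<close>

lemma nonneg_of_mono_0:
  fixes f f' :: "real \<Rightarrow> real"
  assumes d: "\<And>x. a \<le> x \<Longrightarrow> x \<le> b \<Longrightarrow> (f has_real_derivative f' x) (at x)"
    and f': "\<And>x. a \<le> x \<Longrightarrow> x \<le> b \<Longrightarrow> f' x \<ge> 0" and "f a = 0" "a \<le> b"
  shows "f b \<ge> 0"
  using DERIV_nonneg_imp_nondecreasing[of a b f] assms by metis

text \<open>\<open>- ln (1 - t) / t\<^sup>2 = 1 / t + ln_rem t\<close>; here \<open>1 / t\<close> is additive over the samples and \<open>ln_rem\<close> is increasing.\<close>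

definition ln_rem :: "real \<Rightarrow> real" where
  "ln_rem t = (- ln (1 - t) - t) / t\<^sup>2"

lemma ln_rem_ge_half:
  assumes "0 < t" "t < 1"
  shows "ln_rem t \<ge> 1 / 2"
proof -
  have "- ln (1 - t) - t - t\<^sup>2 / 2 \<ge> 0"
  proof (rule nonneg_of_mono_0[where f = "\<lambda>t. - ln (1 - t) - t - t\<^sup>2 / 2" and a = 0 and f' = "\<lambda>x. x\<^sup>2 / (1 - x)"])
    fix x :: real assume x: "0 \<le> x" "x \<le> t"
    then have "x < 1" using assms by simp
    then show "((\<lambda>t. - ln (1 - t) - t - t\<^sup>2 / 2) has_real_derivative x\<^sup>2 / (1 - x)) (at x)"
      by (auto intro!: derivative_eq_intros simp: field_simps power2_eq_square)
    show "x\<^sup>2 / (1 - x) \<ge> 0" using \<open>x < 1\<close> by simp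
  qed (use assms in auto)
  then show ?thesis using assms by (simp add: ln_rem_def field_simps)
qed

text \<open>Its power series, with terms \<open>t ^ j / (j + 2)\<close>, makes \<open>ln_rem\<close>
  visibly increasing. The proof cross-multiplies with the numerator at \<open>b\<close> frozen as
  \<open>c\<close>; the derivative in \<open>t\<close> then has the right sign as soon as
  \<open>2 * c \<le> b\<^sup>2 / (1 - b)\<close>, and this follows by a second differentiation
  argument.\<close>

lemma ln_rem_mono:
  assumes b: "0 < b" and t: "b \<le> t" "t < 1"
  shows "ln_rem b \<le> ln_rem t"
proof -
  define c where "c = - ln (1 - b) - b"
  have "b\<^sup>2 / (1 - b) - 2 * (- ln (1 - b) - b) \<ge> 0"
  proof (rule nonneg_of_mono_0[where f = "\<lambda>b. b\<^sup>2 / (1 - b) - 2 * (- ln (1 - b) - b)" and a = 0 and f' = "\<lambda>x. x\<^sup>2 / (1 - x)\<^sup>2"])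
    fix x :: real assume x: "0 \<le> x" "x \<le> b"
    then have "x < 1" using t by simp
    then show "((\<lambda>b. b\<^sup>2 / (1 - b) - 2 * (- ln (1 - b) - b)) has_real_derivative x\<^sup>2 / (1 - x)\<^sup>2) (at x)"
      by (auto intro!: derivative_eq_intros) (simp add: divide_simps, simp add: algebra_simps power2_eq_square)
  qed (use b in auto)
  then have c: "2 * c \<le> b\<^sup>2 / (1 - b)" by (simp add: c_def)
  have "b\<^sup>2 * (- ln (1 - t) - t) - t\<^sup>2 * c \<ge> 0"
  proof (rule nonneg_of_mono_0[where f = "\<lambda>t. b\<^sup>2 * (- ln (1 - t) - t) - t\<^sup>2 * c" and a = b and f' = "\<lambda>x. x * (b\<^sup>2 / (1 - x) - 2 * c)"])
    fix x :: real assume x: "b \<le> x" "x \<le> t"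
    then have x1: "x < 1" using t by simp
    then show "((\<lambda>t. b\<^sup>2 * (- ln (1 - t) - t) - t\<^sup>2 * c) has_real_derivative x * (b\<^sup>2 / (1 - x) - 2 * c)) (at x)"
      by (auto intro!: derivative_eq_intros) (simp add: divide_simps, simp add: algebra_simps power2_eq_square)
    have "b\<^sup>2 / (1 - b) \<le> b\<^sup>2 / (1 - x)" using x x1 by (intro divide_left_mono) auto
    then show "x * (b\<^sup>2 / (1 - x) - 2 * c) \<ge> 0" using c x b by (intro mult_nonneg_nonneg) auto
  qed (use t in \<open>auto simp: c_def\<close>)
  then show ?thesis using b t by (simp add: ln_rem_def c_def[symmetric] field_simps)
qed

text \<open>This captures the logarithmic growth of the variance when the ratio of dimension to
  degrees of freedom approaches 1.\<close>

lemma ln_rem_ge_ln: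
  assumes "0 < t" "t < 1"
  shows "ln_rem t \<ge> - ln (1 - t) - 1"
proof -
  have nn: "- ln (1 - t) - t \<ge> 0"
    using ln_add_one_self_le_self2[of "- t"] assms by simp
  have "(- ln (1 - t) - t) / 1 \<le> ln_rem t"
    unfolding ln_rem_def using assms nn by (intro divide_left_mono) (auto simp: power_le_one_iff)
  then show ?thesis using assms by simp
qed

text \<open>In terms of \<open>ln_rem\<close> the parts \<open>1 / t\<close> cancel, because the
  weights \<open>M j / m\<close> add up to 1, and the variance becomes
  \<open>a\<^sup>2 / 2 * ((\<Sum>j<k. ln_rem (A j)) - ln_rem a)\<close>. Every \<open>A j\<close> is
  at least the pooled ratio \<open>a\<close>, so by monotonicity one summand pays for
  \<open>ln_rem a\<close> and another one survives as the lower bound.\<close>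

lemma bartlett_sigma2_ge:
  fixes N :: "nat \<Rightarrow> nat"
  assumes k: "k \<ge> 2" and N: "\<And>i. i < k \<Longrightarrow> N i > p + 1" and p: "p \<ge> 1" and i: "i < k"
  shows "bartlett_sigma2 p k N \<ge> (real p / (real (\<Sum>i<k. N i) - real k))\<^sup>2 / 2 * ln_rem (real p / (real (N i) - 1))"
proof -
  define m where "m = real (\<Sum>i<k. N i) - real k"
  define M where "M i = real (N i) - 1" for i
  define a where "a = real p / m"
  define A where "A i = real p / M i" for i
  have M: "M i \<ge> real p + 1" if "i < k" for i using N[OF that] by (simp add: M_def)
  have m: "m = (\<Sum>i<k. M i)" by (simp add: m_def M_def sum_subtractf)
  have M_le: "M j \<le> m" if "j < k" for j
    unfolding m using that M by (intro member_le_sum) (auto intro: order_trans[of _ "real p + 1"])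
  have mpos: "m > real p" "m > 0" using M[OF i] M_le[OF i] by auto
  have Mpos: "M i > 0" "M i > real p" if "i < k" for i using M[OF that] by auto
  have A: "0 < A j" "A j < 1" "a \<le> A j" if "j < k" for j
    using p Mpos[OF that] mpos M_le[OF that] by (auto simp: A_def a_def intro!: divide_left_mono)
  have a: "0 < a" "a < 1" using p mpos by (auto simp: a_def)
  have lnA: "- ln (1 - A j) = (A j)\<^sup>2 * ln_rem (A j) + A j" if "j < k" for j
    using A[OF that] by (simp add: ln_rem_def)
  have lna: "ln (1 - a) = - (a\<^sup>2 * ln_rem a) - a" using a by (simp add: ln_rem_def)
  have w: "(M j / m)\<^sup>2 * (A j)\<^sup>2 = a\<^sup>2" "(M j / m)\<^sup>2 * A j = a * (M j / m)" if "j < k" for j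
    using Mpos[OF that] mpos by (auto simp: A_def a_def power2_eq_square)
  have "bartlett_sigma2 p k N = (1 / 2) * (ln (1 - a) + (\<Sum>j<k. (M j / m)\<^sup>2 * - ln (1 - A j)))"
    unfolding bartlett_sigma2_def Let_def m_def[symmetric] M_def[symmetric] a_def A_def by (simp add: sum_negf)
  also have "(\<Sum>j<k. (M j / m)\<^sup>2 * - ln (1 - A j)) = (\<Sum>j<k. a\<^sup>2 * ln_rem (A j) + a * (M j / m))"
  proof (rule sum.cong[OF refl])
    fix j assume "j \<in> {..<k}"
    then have j: "j < k" by simp
    have "(M j / m)\<^sup>2 * - ln (1 - A j) = ((M j / m)\<^sup>2 * (A j)\<^sup>2) * ln_rem (A j) + (M j / m)\<^sup>2 * A j"
      unfolding lnA[OF j] by (simp add: algebra_simps)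
    then show "(M j / m)\<^sup>2 * - ln (1 - A j) = a\<^sup>2 * ln_rem (A j) + a * (M j / m)"
      unfolding w[OF j] .
  qed
  also have "\<dots> = a\<^sup>2 * (\<Sum>j<k. ln_rem (A j)) + a"
    using mpos by (simp add: sum.distrib sum_distrib_left[symmetric] sum_divide_distrib[symmetric] m[symmetric])
  finally have eq: "bartlett_sigma2 p k N = a\<^sup>2 / 2 * ((\<Sum>j<k. ln_rem (A j)) - ln_rem a)"
    unfolding lna by (simp add: algebra_simps)
  have nn: "0 \<le> ln_rem (A j)" if "j < k" for j using ln_rem_ge_half[OF A(1,2)[OF that]] by simp
  \<comment> \<open>An index other than \<open>i\<close>, available since \<open>k \<ge> 2\<close>;
    its summand absorbs \<open>ln_rem a\<close>.\<close>
  define l where "l = (if i = 0 then 1 else 0::nat)"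
  have l: "l < k" "l \<noteq> i" using k by (auto simp: l_def)
  have "ln_rem (A i) + ln_rem (A l) = (\<Sum>j\<in>{i, l}. ln_rem (A j))" using l by simp
  also have "\<dots> \<le> (\<Sum>j<k. ln_rem (A j))" using i l nn by (intro sum_mono2) auto
  finally have "ln_rem (A i) + ln_rem (A l) \<le> (\<Sum>j<k. ln_rem (A j))" .
  moreover have "ln_rem a \<le> ln_rem (A l)" using a A[OF l(1)] by (intro ln_rem_mono)
  ultimately have "ln_rem (A i) \<le> (\<Sum>j<k. ln_rem (A j)) - ln_rem a" by linarith
  then show ?thesis unfolding eq a_def[symmetric] m_def[symmetric] M_def[symmetric] A_def[symmetric]
    by (intro mult_left_mono) auto
qed

text \<open>The logarithm of \<open>\<Gamma>\<^sub>p (M / 2 + \<delta>) / \<Gamma>\<^sub>p (M /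
  2)\<close> for the multivariate Gamma function \<open>\<Gamma>\<^sub>p\<close>.\<close>

definition ln_Gamma_ratio :: "nat \<Rightarrow> real \<Rightarrow> real \<Rightarrow> real" where
  "ln_Gamma_ratio p M \<delta> = (\<Sum>j<p. ln_Gamma ((M - real j) / 2 + \<delta>) - ln_Gamma ((M - real j) / 2))"

text \<open>The cumulant generating function of the centred log statistic at \<open>h\<close>, for
  small \<open>h\<close>. The first bracket is the logarithm of \<open>bartlett_const\<close> minus
  the centring; the rest comes from the Gamma quotients.\<close>

definition bartlett_log_mgf :: "nat \<Rightarrow> nat \<Rightarrow> (nat \<Rightarrow> nat) \<Rightarrow> real \<Rightarrow> real" where
  "bartlett_log_mgf p k N h = (let m = real (\<Sum>i<k. N i) - real k in
    h * (m * real p / 2 * ln m - (\<Sum>i<k. (real (N i) - 1) * real p / 2 * ln (real (N i) - 1)) - bartlett_mu p k N)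
    + (\<Sum>i<k. ln_Gamma_ratio p (real (N i) - 1) (h * (real (N i) - 1) / 2)) - ln_Gamma_ratio p m (h * m / 2))"

text \<open>The term with \<open>ln (1 - p / M)\<close> is the contribution of \<open>M\<close>
  degrees of freedom to \<open>bartlett_mu\<close>. The term linear in \<open>M\<close> will cancel
  because the degrees of freedom of the samples add up to the pooled one.\<close>

lemma stirling_sum_diff:
  assumes "0 < M - real p" 
  shows "M * (stirling_sum M - stirling_sum (M - real p)) / 2
    = M * real p / 2 * ln M - real p * (1 + ln 2) / 2 * M - M * (2 * M - 2 * real p - 1) * ln (1 - real p / M) / 4"
proof -
  have "1 - real p / M = (M - real p) / M" using assms by (simp add: field_simps)
  then have l: "ln (1 - real p / M) = ln (M - real p) - ln M" using assms by (simp add: ln_div)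
  show ?thesis unfolding l stirling_sum_def by (simp add: field_simps)
qed

text \<open>The centring is what cancels the terms linear in \<open>h\<close>, and the variance is
  what turns the quadratic ones into \<open>s\<^sup>2 / 2\<close>. Only the errors of
  \<open>sum_ln_Gamma_shift_bound\<close> remain, with shifts of size at most
  \<open>\<bar>s\<bar> / \<sigma> / 2\<close>, so 10 becomes 5.\<close>

lemma bartlett_log_mgf_bound:
  fixes N :: "nat \<Rightarrow> nat"
  assumes k: "k > 0" and N: "\<And>i. i < k \<Longrightarrow> N i > p + 1"
    and \<sigma>: "\<sigma> > 0" "\<sigma>\<^sup>2 = bartlett_sigma2 p k N" and s: "\<bar>s\<bar> \<le> \<sigma>"
    and m: "m = real (\<Sum>i<k. N i) - real k"
  shows "\<bar>bartlett_log_mgf p k N (s / (m * \<sigma>)) - s\<^sup>2 / 2\<bar>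
    \<le> 5 * \<bar>s\<bar> / \<sigma> * ((\<Sum>i<k. 1 / (real (N i) - 1 - real p)) + 1 / (m - real p))"
proof -
  define M where "M i = real (N i) - 1" for i
  define h where "h = s / (m * \<sigma>)"
  define D where "D x = stirling_sum x - stirling_sum (x - real p)" for x
  define E where "E x = ln x - ln (x - real p)" for x
  define R where "R x = ln_Gamma_ratio p x (h * x / 2) - (h * x / 2) * D x - (h * x / 2)\<^sup>2 * E x" for x
  have M: "M i \<ge> real p + 1" if "i < k" for i using N[OF that] by (simp add: M_def)
  have mM: "m = (\<Sum>i<k. M i)" by (simp add: m M_def sum_subtractf)
  have M_le: "M j \<le> m" if "j < k" for j
    unfolding mM using that M by (intro member_le_sum) (auto intro: order_trans[of _ "real p + 1"])
  have m_ge: "m \<ge> real p + 1" using M[OF k] M_le[OF k] by simp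
  have R: "\<bar>R x\<bar> \<le> 5 * \<bar>s\<bar> / \<sigma> * (1 / (x - real p))" if x: "real p + 1 \<le> x" "x \<le> m" for x
  proof -
    have x0: "0 < x" using x by simp
    have "\<bar>h * x / 2\<bar> = \<bar>s\<bar> / \<sigma> * (x / m) / 2"
      using x0 m_ge \<sigma> by (simp add: h_def abs_mult)
    also have "\<dots> \<le> \<bar>s\<bar> / \<sigma> * 1 / 2"
      using x0 x m_ge \<sigma> by (intro divide_right_mono mult_left_mono) auto
    finally have le: "\<bar>h * x / 2\<bar> \<le> \<bar>s\<bar> / \<sigma> / 2" by simp
    also have "\<dots> \<le> 1 / 2" using s \<sigma> by simp
    finally have "\<bar>R x\<bar> \<le> 10 * \<bar>h * x / 2\<bar> / (x - real p)"
      unfolding R_def D_def E_def ln_Gamma_ratio_def using x by (intro sum_ln_Gamma_shift_bound) auto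
    also have "\<dots> \<le> 10 * (\<bar>s\<bar> / \<sigma> / 2) / (x - real p)"
      using le x by (intro divide_right_mono mult_left_mono) auto
    finally show ?thesis by simp
  qed
  have lnE: "ln (1 - real p / x) = - E x" if "x \<ge> real p + 1" for x
  proof -
    have "1 - real p / x = (x - real p) / x" using that by (simp add: field_simps)
    then show ?thesis using that by (simp add: ln_div E_def)
  qed
  have lin: "h * (m * real p / 2 * ln m - (\<Sum>i<k. M i * real p / 2 * ln (M i)) - bartlett_mu p k N)
    + (\<Sum>i<k. (h * M i / 2) * D (M i)) - (h * m / 2) * D m = 0"
  proof -
    have mu: "bartlett_mu p k N = m * (2 * m - 2 * real p - 1) * ln (1 - real p / m) / 4
      - (\<Sum>i<k. M i * (2 * M i - 2 * real p - 1) * ln (1 - real p / M i) / 4)"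
    proof -
      have "2 * real (\<Sum>i<k. N i) - 2 * real p - 2 * real k - 1 = 2 * m - 2 * real p - 1" by (simp add: m)
      moreover have "2 * real (N i) - 2 * real p - 3 = 2 * M i - 2 * real p - 1" for i by (simp add: M_def)
      ultimately show ?thesis
        unfolding bartlett_mu_def Let_def m[symmetric] M_def[symmetric]
        by (simp only:) (simp add: sum_divide_distrib diff_divide_distrib)
    qed
    have DM: "(\<Sum>i<k. M i * D (M i) / 2) = (\<Sum>i<k. M i * real p / 2 * ln (M i)) - real p * (1 + ln 2) / 2 * m
      - (\<Sum>i<k. M i * (2 * M i - 2 * real p - 1) * ln (1 - real p / M i) / 4)"
    proof -
      have "(\<Sum>i<k. M i * D (M i) / 2) = (\<Sum>i<k. M i * real p / 2 * ln (M i) - real p * (1 + ln 2) / 2 * M i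
          - M i * (2 * M i - 2 * real p - 1) * ln (1 - real p / M i) / 4)"
      proof (rule sum.cong[OF refl])
        fix i assume "i \<in> {..<k}"
        then have "0 < M i - real p" using M[of i] by simp
        then show "M i * D (M i) / 2 = M i * real p / 2 * ln (M i) - real p * (1 + ln 2) / 2 * M i
          - M i * (2 * M i - 2 * real p - 1) * ln (1 - real p / M i) / 4"
          unfolding D_def by (rule stirling_sum_diff)
      qed
      then show ?thesis by (simp only: sum_subtractf sum_distrib_left[symmetric] mM[symmetric])
    qed
    have Dm: "m * D m / 2 = m * real p / 2 * ln m - real p * (1 + ln 2) / 2 * m
      - m * (2 * m - 2 * real p - 1) * ln (1 - real p / m) / 4"
      unfolding D_def using m_ge by (intro stirling_sum_diff) simp
    have "m * real p / 2 * ln m - (\<Sum>i<k. M i * real p / 2 * ln (M i)) - bartlett_mu p k N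
        + (\<Sum>i<k. M i * D (M i) / 2) - m * D m / 2 = 0"
      unfolding mu DM Dm by simp
    then have "h * (m * real p / 2 * ln m - (\<Sum>i<k. M i * real p / 2 * ln (M i)) - bartlett_mu p k N
        + (\<Sum>i<k. M i * D (M i) / 2) - m * D m / 2) = 0" by simp
    then show ?thesis by (simp add: algebra_simps sum_distrib_left)
  qed
  have quad: "(\<Sum>i<k. (h * M i / 2)\<^sup>2 * E (M i)) - (h * m / 2)\<^sup>2 * E m = s\<^sup>2 / 2"
  proof -
    have m0: "m > 0" using m_ge by simp
    define S where "S = (\<Sum>i<k. (M i / m)\<^sup>2 * E (M i))"
    have \<sigma>S: "\<sigma>\<^sup>2 = (1 / 2) * (- E m + S)"
      unfolding \<sigma>(2) bartlett_sigma2_def Let_def m[symmetric] M_def[symmetric] S_def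
      using lnE M m_ge by (simp add: sum_negf)
    have "m\<^sup>2 * S = (\<Sum>i<k. (M i)\<^sup>2 * E (M i))"
      unfolding S_def sum_distrib_left using m0 by (intro sum.cong) (auto simp: power_divide)
    then have *: "(\<Sum>i<k. (M i)\<^sup>2 * E (M i)) - m\<^sup>2 * E m = 2 * m\<^sup>2 * \<sigma>\<^sup>2"
      unfolding \<sigma>S by (simp add: algebra_simps)
    have "(\<Sum>i<k. (h * M i / 2)\<^sup>2 * E (M i)) - (h * m / 2)\<^sup>2 * E m = h\<^sup>2 / 4 * ((\<Sum>i<k. (M i)\<^sup>2 * E (M i)) - m\<^sup>2 * E m)"
      by (simp add: power_divide power_mult_distrib sum_distrib_left algebra_simps)
    also have "\<dots> = s\<^sup>2 / 2" unfolding * h_def using m0 \<sigma>(1) by (simp add: power_divide power_mult_distrib)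
    finally show ?thesis .
  qed
  have "bartlett_log_mgf p k N h = h * (m * real p / 2 * ln m - (\<Sum>i<k. M i * real p / 2 * ln (M i)) - bartlett_mu p k N)
    + (\<Sum>i<k. R (M i) + (h * M i / 2) * D (M i) + (h * M i / 2)\<^sup>2 * E (M i)) - (R m + (h * m / 2) * D m + (h * m / 2)\<^sup>2 * E m)"
    unfolding bartlett_log_mgf_def Let_def m[symmetric] M_def[symmetric] R_def by simp
  also have "\<dots> = (\<Sum>i<k. R (M i)) - R m + s\<^sup>2 / 2"
    using lin quad by (simp add: sum.distrib)
  finally have "\<bar>bartlett_log_mgf p k N h - s\<^sup>2 / 2\<bar> = \<bar>(\<Sum>i<k. R (M i)) - R m\<bar>" by simp
  also have "\<dots> \<le> (\<Sum>i<k. \<bar>R (M i)\<bar>) + \<bar>R m\<bar>"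
    using sum_abs[of "\<lambda>i. R (M i)" "{..<k}"] by linarith
  also have "\<dots> \<le> (\<Sum>i<k. 5 * \<bar>s\<bar> / \<sigma> * (1 / (M i - real p))) + 5 * \<bar>s\<bar> / \<sigma> * (1 / (m - real p))"
    using M M_le m_ge by (intro add_mono sum_mono R) auto
  also have "\<dots> = 5 * \<bar>s\<bar> / \<sigma> * ((\<Sum>i<k. 1 / (M i - real p)) + 1 / (m - real p))"
    by (simp only: sum_distrib_left distrib_left)
  finally show ?thesis unfolding h_def M_def .
qed

text \<open>Positivity of every \<open>y i\<close> keeps \<open>p / (n - k)\<close> away from 0 and
  thereby bounds the standard deviation below by a constant \<open>c\<close>. One interval of
  \<open>s\<close> then serves all large \<open>p\<close>.\<close>

lemma bartlett_log_mgf_tendsto: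
  fixes n :: "nat \<Rightarrow> nat \<Rightarrow> nat"
  assumes k: "k \<ge> 2" and n_gt: "\<And>p i. i < k \<Longrightarrow> n p i > p + 1"
    and y_lim: "\<And>i. i < k \<Longrightarrow> (\<lambda>p. real p / real (n p i)) \<longlonglongrightarrow> y i"
    and y_pos: "\<And>i. i < k \<Longrightarrow> 0 < y i"
  obtains c where "c > 0" "eventually (\<lambda>p. c \<le> sqrt (bartlett_sigma2 p k (n p))) sequentially"
    "\<And>s. \<bar>s\<bar> \<le> c \<Longrightarrow> (\<lambda>p. bartlett_log_mgf p k (n p)
        (s / ((real (\<Sum>i<k. n p i) - real k) * sqrt (bartlett_sigma2 p k (n p))))) \<longlonglongrightarrow> s\<^sup>2 / 2"
proof -
  define m where "m p = real (\<Sum>i<k. n p i) - real k" for p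
  define M where "M p i = real (n p i) - 1" for p i
  define \<sigma> where "\<sigma> p = sqrt (bartlett_sigma2 p k (n p))" for p
  have k0: "k > 0" using k by simp
  have M: "M p i \<ge> real p + 1" if "i < k" for p i using n_gt[OF that, of p] by (simp add: M_def)
  have mM: "m p = (\<Sum>i<k. M p i)" for p by (simp add: m_def M_def sum_subtractf)
  have M_le: "M p j \<le> m p" if "j < k" for p j
    unfolding mM using that M by (intro member_le_sum) (auto intro: order_trans[of _ "real p + 1"])
  have mpos: "m p > 0" for p using M[OF k0, of p] M_le[OF k0, of p] by simp
  define Y where "Y = (\<Sum>i<k. 1 / y i)"
  have Ypos: "Y > 0" unfolding Y_def using y_pos k0 by (intro sum_pos) auto
  \<comment> \<open>A lower bound for \<open>p / m\<close> with room to spare: the sum of the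
    \<open>n p i / p\<close> tends to \<open>Y\<close>, hence is eventually below
    \<open>Y + 1\<close>.\<close>
  define \<alpha> where "\<alpha> = 1 / (Y + 1)"
  have \<alpha>: "\<alpha> > 0" using Ypos by (simp add: \<alpha>_def)
  have a_ge: "eventually (\<lambda>p. \<alpha> \<le> real p / m p \<and> p \<ge> 1) sequentially"
  proof -
    have "(\<lambda>p. \<Sum>i<k. 1 / (real p / real (n p i))) \<longlonglongrightarrow> Y"
      unfolding Y_def using y_lim y_pos by (intro tendsto_sum tendsto_divide tendsto_const) force+
    then have "eventually (\<lambda>p. (\<Sum>i<k. 1 / (real p / real (n p i))) < Y + 1) sequentially"
      by (rule order_tendstoD) simp
    then show ?thesis using eventually_ge_at_top[of 1]
    proof eventually_elim
      case (elim p)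
      have "m p / real p \<le> (\<Sum>i<k. real (n p i) / real p)"
        using elim(2) by (simp add: m_def sum_divide_distrib[symmetric] divide_right_mono)
      also have "\<dots> = (\<Sum>i<k. 1 / (real p / real (n p i)))" by simp
      finally have "m p / real p \<le> Y + 1" using elim(1) by linarith
      then have "1 / (Y + 1) \<le> 1 / (m p / real p)"
        using mpos[of p] elim(2) Ypos by (intro divide_left_mono) auto
      then show ?case using elim(2) by (simp add: \<alpha>_def)
    qed
  qed
  have s2: "bartlett_sigma2 p k (n p) \<ge> \<alpha>\<^sup>2 / 2 * x"
    if "\<alpha> \<le> real p / m p \<and> p \<ge> 1" "i < k" "ln_rem (real p / M p i) \<ge> x" "x \<ge> 0" for p i x
  proof -
    have "\<alpha>\<^sup>2 / 2 * x \<le> (real p / m p)\<^sup>2 / 2 * ln_rem (real p / M p i)"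
      using that \<alpha> by (intro mult_mono divide_right_mono power_mono) auto
    also have "\<dots> \<le> bartlett_sigma2 p k (n p)"
      unfolding m_def M_def using that k n_gt by (intro bartlett_sigma2_ge) auto
    finally show ?thesis .
  qed
  have A01: "0 < real p / M p i \<and> real p / M p i < 1" if "p \<ge> 1" "i < k" for p i
    using M[OF that(2), of p] that(1) by auto
  have \<sigma>_ge: "eventually (\<lambda>p. \<alpha> / 2 \<le> \<sigma> p) sequentially"
    using a_ge
  proof eventually_elim
    case (elim p)
    have "\<alpha>\<^sup>2 / 2 * (1 / 2) \<le> bartlett_sigma2 p k (n p)"
      using elim A01[of p 0] k0 by (intro s2[of p 0] ln_rem_ge_half) auto
    then have "(\<alpha> / 2)\<^sup>2 \<le> bartlett_sigma2 p k (n p)" by (simp add: power_divide)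
    then show ?case unfolding \<sigma>_def using \<alpha> by (intro real_le_rsqrt)
  qed
  have X: "(\<lambda>p. 1 / (\<sigma> p * (M p i - real p))) \<longlonglongrightarrow> 0" if i: "i < k" for i
  proof (rule tendsto_sandwich[OF _ _ tendsto_const])
    \<comment> \<open>The two summands treat the two sizes of the gap \<open>M p i - p\<close>
      relative to \<open>sqrt p\<close>. A large gap needs only the constant lower bound on
      \<open>\<sigma>\<close>. A small gap forces \<open>1 - p / M p i \<le> 1 / sqrt p\<close>, so
      that \<open>\<sigma>\<close> is at least of order \<open>sqrt (ln p)\<close>, and a gap of 1
      is enough.\<close>
    let ?U = "\<lambda>p. (2 / \<alpha>) / sqrt (real p) + 1 / (\<alpha> * sqrt ((ln (real p) / 2 - 1) / 2))"
    have big: "eventually (\<lambda>p. ln (real p) > 2) sequentially" by real_asymp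
    show "eventually (\<lambda>p. 0 \<le> 1 / (\<sigma> p * (M p i - real p))) sequentially"
      using \<sigma>_ge
    proof eventually_elim
      case (elim p)
      then show ?case using M[OF i, of p] \<alpha> by auto
    qed
    show "eventually (\<lambda>p. 1 / (\<sigma> p * (M p i - real p)) \<le> ?U p) sequentially"
      using a_ge \<sigma>_ge big
    proof eventually_elim
      case (elim p)
      have \<sigma>pos: "\<sigma> p > 0" using elim(2) \<alpha> by simp
      have q: "M p i - real p \<ge> 1" using M[OF i, of p] by simp
      have p1: "p \<ge> 1" using elim(1) by simp
      have U: "0 < (2 / \<alpha>) / sqrt (real p)" "0 < 1 / (\<alpha> * sqrt ((ln (real p) / 2 - 1) / 2))"
        using \<alpha> p1 elim(3) by auto
      show ?case
      proof (cases "M p i - real p \<ge> sqrt (real p)")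
        case True
        have "1 / (\<sigma> p * (M p i - real p)) \<le> 1 / ((\<alpha> / 2) * sqrt (real p))"
          using True elim(2) \<alpha> p1 by (intro frac_le mult_mono) auto
        also have "\<dots> = (2 / \<alpha>) / sqrt (real p)" by simp
        finally show ?thesis using U by linarith
      next
        case False
        have Mp: "M p i > 0" "real p \<le> M p i" using M[OF i, of p] by auto
        have "1 - real p / M p i = (M p i - real p) / M p i" using Mp by (simp add: field_simps)
        also have "\<dots> \<le> sqrt (real p) / real p"
          using False Mp p1 q by (intro frac_le) auto
        also have "\<dots> = 1 / sqrt (real p)" using p1 by (simp add: field_simps)
        finally have "ln (1 - real p / M p i) \<le> ln (1 / sqrt (real p))"
          using A01[OF p1 i] by (intro ln_mono) auto
        also have "\<dots> = - ln (real p) / 2" using p1 by (simp add: ln_div ln_sqrt)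
        finally have "ln_rem (real p / M p i) \<ge> ln (real p) / 2 - 1"
          using ln_rem_ge_ln[of "real p / M p i"] A01[OF p1 i] by linarith
        then have "\<alpha>\<^sup>2 / 2 * (ln (real p) / 2 - 1) \<le> bartlett_sigma2 p k (n p)"
          using elim by (intro s2[of p i] i) auto
        then have "sqrt (\<alpha>\<^sup>2 * ((ln (real p) / 2 - 1) / 2)) \<le> \<sigma> p"
          unfolding \<sigma>_def by (intro real_sqrt_le_mono) simp
        then have "\<alpha> * sqrt ((ln (real p) / 2 - 1) / 2) \<le> \<sigma> p"
          using \<alpha> by (simp only: real_sqrt_mult real_sqrt_abs abs_of_pos)
        then have "\<alpha> * sqrt ((ln (real p) / 2 - 1) / 2) \<le> \<sigma> p * (M p i - real p)"
          using q \<sigma>pos by (smt (verit) mult_le_cancel_left1)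
        then have "1 / (\<sigma> p * (M p i - real p)) \<le> 1 / (\<alpha> * sqrt ((ln (real p) / 2 - 1) / 2))"
          using \<alpha> elim(3) \<sigma>pos q by (intro divide_left_mono) auto
        then show ?thesis using U by linarith
      qed
    qed
    show "?U \<longlonglongrightarrow> 0" using \<alpha> by real_asymp
  qed
  show thesis
  proof (rule that[of "\<alpha> / 2"])
    show "\<alpha> / 2 > 0" using \<alpha> by simp
    show "eventually (\<lambda>p. \<alpha> / 2 \<le> sqrt (bartlett_sigma2 p k (n p))) sequentially"
      using \<sigma>_ge by (simp add: \<sigma>_def)
    fix s :: real assume s: "\<bar>s\<bar> \<le> \<alpha> / 2"
    have "(\<lambda>p. bartlett_log_mgf p k (n p) (s / (m p * \<sigma> p)) - s\<^sup>2 / 2) \<longlonglongrightarrow> 0"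
    proof (rule Lim_null_comparison)
      show "eventually (\<lambda>p. norm (bartlett_log_mgf p k (n p) (s / (m p * \<sigma> p)) - s\<^sup>2 / 2)
        \<le> 5 * \<bar>s\<bar> * ((\<Sum>i<k. 1 / (\<sigma> p * (M p i - real p))) + 1 / (\<sigma> p * (M p 0 - real p)))) sequentially"
        using a_ge \<sigma>_ge
      proof eventually_elim
        case (elim p)
        have \<sigma>pos: "\<sigma> p > 0" using elim(2) \<alpha> by simp
        have "norm (bartlett_log_mgf p k (n p) (s / (m p * \<sigma> p)) - s\<^sup>2 / 2)
          \<le> 5 * \<bar>s\<bar> / \<sigma> p * ((\<Sum>i<k. 1 / (M p i - real p)) + 1 / (m p - real p))"
          unfolding M_def real_norm_def
        proof (rule bartlett_log_mgf_bound[OF k0 n_gt \<sigma>pos])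
          show "(\<sigma> p)\<^sup>2 = bartlett_sigma2 p k (n p)"
            using \<sigma>pos unfolding \<sigma>_def by (simp add: real_sqrt_pow2_iff less_imp_le)
          show "\<bar>s\<bar> \<le> \<sigma> p" using s elim(2) by simp
        qed (auto simp: m_def)
        also have "\<dots> \<le> 5 * \<bar>s\<bar> / \<sigma> p * ((\<Sum>i<k. 1 / (M p i - real p)) + 1 / (M p 0 - real p))"
          using \<sigma>pos M[OF k0, of p] M_le[OF k0, of p]
          by (intro mult_left_mono add_left_mono divide_left_mono) auto
        also have "\<dots> = 5 * \<bar>s\<bar> * ((\<Sum>i<k. 1 / (\<sigma> p * (M p i - real p))) + 1 / (\<sigma> p * (M p 0 - real p)))"
          by (simp add: sum_distrib_left distrib_left)
        finally show ?case .
      qed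
      have "(\<lambda>p. 5 * \<bar>s\<bar> * ((\<Sum>i<k. 1 / (\<sigma> p * (M p i - real p))) + 1 / (\<sigma> p * (M p 0 - real p)))) \<longlonglongrightarrow> 5 * \<bar>s\<bar> * ((\<Sum>i<k. 0) + 0)"
        by (intro tendsto_intros X) (use k0 in auto)
      then show "(\<lambda>p. 5 * \<bar>s\<bar> * ((\<Sum>i<k. 1 / (\<sigma> p * (M p i - real p))) + 1 / (\<sigma> p * (M p 0 - real p)))) \<longlonglongrightarrow> 0"
        by simp
    qed
    then have "(\<lambda>p. bartlett_log_mgf p k (n p) (s / (m p * \<sigma> p))) \<longlonglongrightarrow> s\<^sup>2 / 2"
      by (rule LIM_zero_cancel)
    then show "(\<lambda>p. bartlett_log_mgf p k (n p)
        (s / ((real (\<Sum>i<k. n p i) - real k) * sqrt (bartlett_sigma2 p k (n p))))) \<longlonglongrightarrow> s\<^sup>2 / 2"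
      unfolding m_def \<sigma>_def .
  qed
qed

subsection \<open>Weak convergence from moment generating functions\<close>

lemma sum_exp_series_le: "0 \<le> t \<Longrightarrow> (\<Sum>j<m. t ^ j / fact j) \<le> exp (t::real)"
proof -
  assume t: "0 \<le> t"
  have "(\<Sum>j<m. t ^ j /\<^sub>R fact j) \<le> exp t"
    unfolding exp_def using t by (intro sum_le_suminf summable_exp_generic) auto
  then show ?thesis by (simp add: divide_inverse mult.commute)
qed

lemma exp_abs_le: "exp (c * \<bar>x\<bar>) \<le> exp (c * x) + exp (- (c * x) :: real)"
  by (cases "x \<ge> 0") (auto intro: add_increasing add_increasing2)

text \<open>Around \<open>w\<close> the integrand is expanded in powers of \<open>z - w\<close>. On
  the disc of radius \<open>c - \<bar>Re w\<bar>\<close> the sums of the norms stay below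
  \<open>exp (c * \<bar>x\<bar>)\<close>, hence below the integrable sum of the two exponentials,
  and the series may be integrated term by term.\<close>

lemma holomorphic_on_exp_moment:
  fixes N :: "real measure"
  assumes sets: "sets N = sets borel"
    and int: "integrable N (\<lambda>x. exp (c * x))" "integrable N (\<lambda>x. exp (- (c * x)))"
  shows "(\<lambda>z. \<integral>x. exp (z * complex_of_real x) \<partial>N) holomorphic_on {z. \<bar>Re z\<bar> < c}"
proof -
  note [measurable_cong] = sets
  let ?F = "\<lambda>z. \<integral>x. exp (z * complex_of_real x) \<partial>N"
  let ?G = "\<lambda>x::real. exp (c * x) + exp (- (c * x))"
  have G: "integrable N ?G" using int by (rule Bochner_Integration.integrable_add)
  have ball: "?F holomorphic_on ball w (c - \<bar>Re w\<bar>)" for w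
  proof (rule power_series_holomorphic)
    fix z assume "z \<in> ball w (c - \<bar>Re w\<bar>)"
    then have d: "norm (z - w) + \<bar>Re w\<bar> < c" by (simp add: dist_norm norm_minus_commute)
    let ?d = "norm (z - w)"
    define f where "f j x = (complex_of_real x ^ j / fact j * exp (w * complex_of_real x)) * (z - w) ^ j" for j x
    have f_meas[measurable]: "f j \<in> borel_measurable N" for j unfolding f_def by measurable
    have norm_f: "norm (f j x) = (?d * \<bar>x\<bar>) ^ j / fact j * exp (Re w * x)" for j x
      by (simp add: f_def norm_mult norm_power norm_divide norm_exp_eq_Re power_mult_distrib norm_fact)
    have le: "(\<Sum>j<m. norm (f j x)) \<le> ?G x" for m x
    proof -
      have "(\<Sum>j<m. norm (f j x)) = (\<Sum>j<m. (?d * \<bar>x\<bar>) ^ j / fact j) * exp (Re w * x)"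
        by (simp add: norm_f sum_distrib_right)
      also have "\<dots> \<le> exp (?d * \<bar>x\<bar>) * exp (Re w * x)"
        by (intro mult_right_mono sum_exp_series_le) auto
      also have "\<dots> = exp (?d * \<bar>x\<bar> + Re w * x)" by (simp add: exp_add)
      also have "\<dots> \<le> exp (c * \<bar>x\<bar>)"
      proof -
        have "Re w * x \<le> \<bar>Re w\<bar> * \<bar>x\<bar>" by (metis abs_ge_self abs_mult)
        then have "?d * \<bar>x\<bar> + Re w * x \<le> (?d + \<bar>Re w\<bar>) * \<bar>x\<bar>" by (simp add: algebra_simps)
        also have "\<dots> \<le> c * \<bar>x\<bar>" using d by (intro mult_right_mono) auto
        finally show ?thesis by simp
      qed
      also have "\<dots> \<le> ?G x" by (rule exp_abs_le)
      finally show ?thesis .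
    qed
    have int_f: "integrable N (f j)" for j
    proof (rule Bochner_Integration.integrable_bound[OF G])
      have "norm (f j x) \<le> norm (?G x)" for x
        using le[of x "Suc j"] sum_nonneg[of "{..<j}" "\<lambda>j. norm (f j x)"] by simp
      then show "AE x in N. norm (f j x) \<le> norm (?G x)" by simp
    qed simp
    have summ: "summable (\<lambda>j. norm (f j x))" for x
      by (rule summableI_nonneg_bounded[OF _ le]) simp
    have summ': "summable (\<lambda>j. \<integral>x. norm (f j x) \<partial>N)"
    proof (rule summableI_nonneg_bounded)
      fix m
      have "(\<Sum>j<m. \<integral>x. norm (f j x) \<partial>N) = (\<integral>x. (\<Sum>j<m. norm (f j x)) \<partial>N)"
        using int_f by (intro Bochner_Integration.integral_sum[symmetric] integrable_norm)
      also have "\<dots> \<le> (\<integral>x. ?G x \<partial>N)"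
        using int_f G le by (intro integral_mono Bochner_Integration.integrable_sum integrable_norm) auto
      finally show "(\<Sum>j<m. \<integral>x. norm (f j x) \<partial>N) \<le> (\<integral>x. ?G x \<partial>N)" .
    qed simp
    have "(\<lambda>j. integral\<^sup>L N (f j)) sums (\<integral>x. (\<Sum>j. f j x) \<partial>N)"
      by (rule sums_integral[OF int_f _ summ']) (simp add: summ)
    moreover have "(\<Sum>j. f j x) = exp (z * complex_of_real x)" for x
    proof -
      have "(\<lambda>j. ((z - w) * complex_of_real x) ^ j /\<^sub>R fact j) sums exp ((z - w) * complex_of_real x)"
        by (rule exp_converges)
      then have "(\<lambda>j. ((z - w) * complex_of_real x) ^ j /\<^sub>R fact j * exp (w * complex_of_real x))
        sums (exp ((z - w) * complex_of_real x) * exp (w * complex_of_real x))"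
        by (rule sums_mult2)
      moreover have "((z - w) * complex_of_real x) ^ j /\<^sub>R fact j * exp (w * complex_of_real x) = f j x" for j
        by (simp only: f_def scaleR_conv_of_real power_mult_distrib) (simp add: divide_inverse mult_ac)
      moreover have "exp ((z - w) * complex_of_real x) * exp (w * complex_of_real x) = exp (z * complex_of_real x)"
        by (simp add: exp_add[symmetric] algebra_simps)
      ultimately show ?thesis using sums_unique by fastforce
    qed
    moreover have "integral\<^sup>L N (f j) = (\<integral>x. complex_of_real x ^ j / fact j * exp (w * complex_of_real x) \<partial>N) * (z - w) ^ j" for j
      unfolding f_def by simp
    ultimately show "(\<lambda>j. (\<integral>x. complex_of_real x ^ j / fact j * exp (w * complex_of_real x) \<partial>N) * (z - w) ^ j) sums ?F z"
      by simp
  qed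
  have op: "open {z::complex. \<bar>Re z\<bar> < c}"
    by (intro open_Collect_less continuous_intros)
  show ?thesis
  proof (subst holomorphic_on_open[OF op], rule ballI)
    fix w :: complex assume "w \<in> {z. \<bar>Re z\<bar> < c}"
    then have "w \<in> ball w (c - \<bar>Re w\<bar>)" by simp
    with ball[of w] show "\<exists>f'. (?F has_field_derivative f') (at w)"
      by (subst (asm) holomorphic_on_open) auto
  qed
qed

text \<open>Vitali's argument: the moment generating functions form a normal family on a strip, and
  every limit function is determined by its values on the real axis.\<close>

lemma weak_conv_m_mgf:
  fixes N :: "nat \<Rightarrow> real measure"
  assumes distr: "\<And>n. real_distribution (N n)" and c: "c > 0"
    and int: "eventually (\<lambda>n. integrable (N n) (\<lambda>x. exp (c * x)) \<and> integrable (N n) (\<lambda>x. exp (- (c * x)))) sequentially"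
    and mgf: "\<And>s. \<bar>s\<bar> \<le> c \<Longrightarrow> (\<lambda>n. \<integral>x. exp (s * x) \<partial>N n) \<longlonglongrightarrow> exp (s\<^sup>2 / 2)"
  shows "weak_conv_m N std_normal_distribution"
proof (rule levy_continuity[OF distr])
  show "real_distribution std_normal_distribution" by (rule real_dist_normal_dist)
  fix t :: real
  let ?S = "{z::complex. \<bar>Re z\<bar> < c}"
  define F where "F n z = (\<integral>x. exp (z * complex_of_real x) \<partial>N n)" for n z
  let ?C = "exp (c\<^sup>2 / 2) + 1"
  have "eventually (\<lambda>n. (\<integral>x. exp (c * x) \<partial>N n) < ?C) sequentially"
    using mgf[of c] c by (intro order_tendstoD(2)) auto
  moreover have "eventually (\<lambda>n. (\<integral>x. exp (- (c * x)) \<partial>N n) < ?C) sequentially"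
    using mgf[of "- c"] c by (intro order_tendstoD(2)) auto
  ultimately have "eventually (\<lambda>n. integrable (N n) (\<lambda>x. exp (c * x)) \<and> integrable (N n) (\<lambda>x. exp (- (c * x))) \<and>
      (\<integral>x. exp (c * x) \<partial>N n) < ?C \<and> (\<integral>x. exp (- (c * x)) \<partial>N n) < ?C) sequentially"
    using int by eventually_elim auto
  then obtain n0 where n0: "\<And>n. n \<ge> n0 \<Longrightarrow> integrable (N n) (\<lambda>x. exp (c * x))"
      "\<And>n. n \<ge> n0 \<Longrightarrow> integrable (N n) (\<lambda>x. exp (- (c * x)))"
      "\<And>n. n \<ge> n0 \<Longrightarrow> (\<integral>x. exp (c * x) \<partial>N n) < ?C" "\<And>n. n \<ge> n0 \<Longrightarrow> (\<integral>x. exp (- (c * x)) \<partial>N n) < ?C"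
    unfolding eventually_sequentially by blast
  have sets: "sets (N n) = sets borel" for n
    using distr[of n] by (simp add: real_distribution_def real_distribution_axioms_def)
  have hol: "F n holomorphic_on ?S" if "n \<ge> n0" for n
    unfolding F_def using n0(1,2)[OF that] by (rule holomorphic_on_exp_moment[OF sets])
  \<comment> \<open>The two endpoint moments bound the whole strip uniformly; this is the hypothesis
    of Montel's theorem.\<close>
  have bound: "norm (F n z) \<le> 2 * ?C" if n: "n \<ge> n0" and z: "z \<in> ?S" for n z
  proof -
    have [measurable_cong]: "sets (N n) = sets borel" by (rule sets)
    have le: "norm (exp (z * complex_of_real x)) \<le> exp (c * x) + exp (- (c * x))" for x
    proof -
      have "Re z * x \<le> \<bar>Re z\<bar> * \<bar>x\<bar>" by (metis abs_ge_self abs_mult)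
      also have "\<dots> \<le> c * \<bar>x\<bar>" using z by (intro mult_right_mono) auto
      finally have "norm (exp (z * complex_of_real x)) \<le> exp (c * \<bar>x\<bar>)" by (simp add: norm_exp_eq_Re)
      then show ?thesis by (rule order_trans[OF _ exp_abs_le])
    qed
    have G: "integrable (N n) (\<lambda>x. exp (c * x) + exp (- (c * x)))"
      using n0(1,2)[OF n] by (rule Bochner_Integration.integrable_add)
    have iF: "integrable (N n) (\<lambda>x. exp (z * complex_of_real x))"
    proof (rule Bochner_Integration.integrable_bound[OF G])
      show "AE x in N n. norm (exp (z * complex_of_real x)) \<le> norm (exp (c * x) + exp (- (c * x)))"
        using le by (intro AE_I2) (auto intro: order_trans)
    qed measurable
    have "norm (F n z) \<le> (\<integral>x. exp (c * x) + exp (- (c * x)) \<partial>N n)"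
      unfolding F_def by (rule Bochner_Integration.integral_norm_bound_integral[OF iF G le])
    also have "\<dots> \<le> 2 * ?C" using n0[OF n] by simp
    finally show ?thesis .
  qed
  have "(\<lambda>n. F n (\<i> * t)) \<longlonglongrightarrow> exp (- (t\<^sup>2) / 2)"
  proof (rule ccontr)
    assume "\<not> ?thesis"
    then obtain e where e: "e > 0" and "\<not> eventually (\<lambda>n. dist (F n (\<i> * t)) (exp (- (t\<^sup>2) / 2)) < e) sequentially"
      unfolding tendsto_iff by blast
    then have fr: "\<exists>n\<ge>m. e \<le> dist (F n (\<i> * t)) (exp (- (t\<^sup>2) / 2))" for m
      unfolding eventually_sequentially by (meson not_less)
    \<comment> \<open>The indices that would stay at distance \<open>e\<close> if convergence
      failed. A normal-family subsequence inside this set converges, and identifying its limit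
      yields the contradiction.\<close>
    define A where "A = {n. n \<ge> n0 \<and> e \<le> dist (F n (\<i> * t)) (exp (- (t\<^sup>2) / 2))}"
    have "infinite A"
      unfolding infinite_nat_iff_unbounded_le
    proof
      fix m show "\<exists>n\<ge>m. n \<in> A" using fr[of "max m n0"] by (auto simp: A_def)
    qed
    define r where "r = enumerate A"
    have r: "strict_mono r" "r n \<in> A" for n
      unfolding r_def using \<open>infinite A\<close> by (auto intro: strict_mono_enumerate enumerate_in_set)
    then have r0: "r n \<ge> n0" for n using r(2)[of n] by (simp add: A_def)
    have op: "open ?S" by (intro open_Collect_less continuous_intros)
    have "?S = {z. Re z < c} \<inter> {z. Re z > - c}" by auto
    then have conn: "connected ?S"
      by (simp add: convex_connected convex_Int convex_halfspace_Re_lt convex_halfspace_Re_gt)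
    obtain g r' where g: "g holomorphic_on ?S" "strict_mono r'" "\<And>z. z \<in> ?S \<Longrightarrow> (\<lambda>n. F (r (r' n)) z) \<longlonglongrightarrow> g z"
    proof (rule Montel[OF op, of "range (\<lambda>n. F (r n))" "\<lambda>n. F (r n)"])
      show "h holomorphic_on ?S" if "h \<in> range (\<lambda>n. F (r n))" for h
        using that hol r0 by auto
      show "\<exists>B. \<forall>h\<in>range (\<lambda>n. F (r n)). \<forall>z\<in>K. norm (h z) \<le> B" if "compact K" "K \<subseteq> ?S" for K
        using bound r0 that(2) by (intro exI[of _ "2 * ?C"]) blast
    qed (auto intro: that)
    have rr': "filterlim (\<lambda>n. r (r' n)) sequentially sequentially"
      using filterlim_compose[OF filterlim_subseq[OF r(1)] filterlim_subseq[OF g(2)]] by simp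
    have real: "g (of_real s) = exp ((of_real s)\<^sup>2 / 2)" if s: "0 < s" "s < c" for s
    proof (rule LIMSEQ_unique)
      show "(\<lambda>n. F (r (r' n)) (of_real s)) \<longlonglongrightarrow> g (of_real s)" using s by (intro g(3)) auto
      have "F n (of_real s) = of_real (\<integral>x. exp (s * x) \<partial>N n)" for n
      proof -
        have "(\<lambda>x. exp (of_real s * complex_of_real x)) = (\<lambda>x. complex_of_real (exp (s * x)))"
          by (simp add: exp_of_real[symmetric])
        then show ?thesis unfolding F_def by (simp only: integral_complex_of_real)
      qed
      moreover have "(\<lambda>n. complex_of_real (\<integral>x. exp (s * x) \<partial>N (r (r' n)))) \<longlonglongrightarrow> of_real (exp (s\<^sup>2 / 2))"
        using s by (intro tendsto_of_real filterlim_compose[OF mgf rr']) auto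
      ultimately show "(\<lambda>n. F (r (r' n)) (of_real s)) \<longlonglongrightarrow> exp ((of_real s)\<^sup>2 / 2)"
        by (simp add: exp_of_real[symmetric])
    qed
    have "(\<lambda>z. g z - exp (z\<^sup>2 / 2)) (\<i> * t) = 0"
    \<comment> \<open>The zeros on the real interval accumulate at 0, an interior point of the
      connected strip, which contains the whole imaginary axis.\<close>
    proof (rule analytic_continuation[where f = "\<lambda>z. g z - exp (z\<^sup>2 / 2)" and S = ?S and U = "of_real ` {0<..<c}" and \<xi> = 0])
      show "(\<lambda>z. g z - exp (z\<^sup>2 / 2)) holomorphic_on ?S" by (intro holomorphic_intros g(1)) auto
      show "0 islimpt complex_of_real ` {0<..<c}"
      proof (rule islimptI)
        fix T :: "complex set" assume "0 \<in> T" "open T"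
        then obtain e where e: "e > 0" "ball 0 e \<subseteq> T" using open_contains_ball by blast
        let ?s = "min (e / 2) (c / 2)"
        have "complex_of_real ?s \<in> ball 0 e" using e c by (simp add: norm_of_real del: of_real_divide) 
        then show "\<exists>y\<in>complex_of_real ` {0<..<c}. y \<in> T \<and> y \<noteq> 0"
          using e c by (intro bexI[of _ "complex_of_real ?s"]) (auto simp: min_def)
      qed
    qed (use op conn c real in auto)
    then have gt: "g (\<i> * t) = exp (- (t\<^sup>2) / 2)"
      by (simp add: power_mult_distrib exp_of_real[symmetric])
    have "(\<lambda>n. F (r (r' n)) (\<i> * t)) \<longlonglongrightarrow> exp (- (t\<^sup>2) / 2)"
      using g(3)[of "\<i> * t"] c unfolding gt by simp
    then have "eventually (\<lambda>n. dist (F (r (r' n)) (\<i> * t)) (exp (- (t\<^sup>2) / 2)) < e) sequentially"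
      using e by (rule tendstoD)
    then obtain m where "dist (F (r (r' m)) (\<i> * t)) (exp (- (t\<^sup>2) / 2)) < e"
      unfolding eventually_sequentially by blast
    moreover have "r (r' m) \<in> A" by (rule r(2))
    ultimately show False by (simp add: A_def)
  qed
  moreover have "F n (\<i> * t) = char (N n) t" for n
    unfolding F_def char_def by (simp add: mult.assoc)
  ultimately show "(\<lambda>n. char (N n) t) \<longlonglongrightarrow> char std_normal_distribution t"
    by (simp add: char_std_normal_distribution)
qed

subsection \<open>The central limit theorem\<close>

lemma sscp_mat_cong:
  assumes "\<And>j a. j < N \<Longrightarrow> a < p \<Longrightarrow> x j a = y j a"
  shows "sscp_mat p N x = sscp_mat p N y"
proof -
  have "sample_mean N x a = sample_mean N y a" if "a < p" for a
    using assms that by (simp add: sample_mean_def)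
  then show ?thesis unfolding sscp_mat_def using assms by (intro cong_mat refl) (auto intro!: sum.cong)
qed

lemma bartlett_Lambda_cong:
  assumes "\<And>i j a. i < k \<Longrightarrow> j < N i \<Longrightarrow> a < p \<Longrightarrow> x i j a = y i j a"
  shows "bartlett_Lambda p k N x = bartlett_Lambda p k N y"
proof -
  have "sscp_mat p (N i) (x i) = sscp_mat p (N i) (y i)" if "i < k" for i
    using assms that by (intro sscp_mat_cong) auto
  then show ?thesis unfolding bartlett_Lambda_def Let_def by simp
qed

text \<open>The arbitrary test function \<open>\<phi>\<close> expresses an equality of laws. One
  reflection per sample, built from the constant vector, trades the centring for the loss of a row,
  which leaves \<open>N i - 1\<close> independent standard normal rows.\<close>

lemma nn_integral_bartlett_Lambda:
  fixes X :: "nat \<Rightarrow> nat \<Rightarrow> 'a \<Rightarrow> nat \<Rightarrow> real" and \<phi> :: "real \<Rightarrow> ennreal"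
  assumes prob: "prob_space M" and k: "k > 0" and N: "\<And>i. i < k \<Longrightarrow> N i > 0"
    and indep: "prob_space.indep_vars M (\<lambda>_. rvec_space p) (\<lambda>(i, j). X i j) (SIGMA i:{..<k}. {..<N i})"
    and normal: "\<And>i j. i < k \<Longrightarrow> j < N i \<Longrightarrow> distr M (rvec_space p) (X i j) = mvnormal p (mu i) S"
    and mu: "\<And>i. i < k \<Longrightarrow> mu i \<in> carrier_vec p" and S: "pos_def_mat p S"
    and \<phi>: "\<phi> \<in> borel_measurable borel"
    and B: "B = (\<lambda>i. {i} \<times> {..<N i} - {(i, 0)})" and R': "R' = (\<Union>i<k. B i)"
  shows "(\<integral>\<^sup>+\<omega>. \<phi> (bartlett_Lambda p k N (\<lambda>i j. X i j \<omega>)) \<partial>M) =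
    (\<integral>\<^sup>+Z. \<phi> (bartlett_const p k N * gram_ratio k p B (\<lambda>i. (real (N i) - 1) / 2) R' Z) \<partial>gauss (R' \<times> {..<p}))"
proof -
  interpret prob_space M by (rule prob)
  define R where "R = (SIGMA i:{..<k}. {..<N i})"
  define X' where "X' = (\<lambda>(i, j). X i j)"
  have RU: "R = (\<Union>i\<in>{..<k}. {i} \<times> {..<N i})" by (auto simp: R_def)
  have fR: "finite R" unfolding R_def by (intro finite_SigmaI) auto
  have Rne: "R \<noteq> {}" using k N[OF k] by (auto simp: R_def)
  have rv: "X' r \<in> M \<rightarrow>\<^sub>M rvec_space p" if "r \<in> R" for r
    using indep that unfolding indep_vars_def2 R_def X'_def by auto
  obtain T where T: "T \<in> carrier_mat p p" "T\<^sup>T * S * T = 1\<^sub>m p"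
    using pos_def_mat_diagonalize[OF S] by blast
  define L where "L = S * T"
  have cS: "S \<in> carrier_mat p p" using S by (simp add: pos_def_mat_def)
  have L: "L \<in> carrier_mat p p" using cS T by (simp add: L_def)
  have "Determinant.det (T\<^sup>T) * Determinant.det L = 1"
    using pos_def_mat_inverse(3)[OF S T] det_mult[of "T\<^sup>T" p L] L T by (simp add: L_def)
  then have detL: "Determinant.det L \<noteq> 0" by auto
  have mvn: "distr M (rvec_space p) (X' r) = distr (gauss {..<p}) (rvec_space p) (affine_vec p (mu (fst r)) L)" if r: "r \<in> R" for r
  proof -
    obtain i j where ij: "r = (i, j)" "i < k" "j < N i" using r by (auto simp: R_def)
    have eq: "distr M (rvec_space p) (X' r) = mvnormal p (mu i) S"
      using normal[OF ij(2,3)] by (simp add: X'_def ij)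
    \<comment> \<open>Being the law of a random vector, the normal measure has mass 1; this replaces
      the evaluation of its Gaussian integral.\<close>
    have "prob_space (mvnormal p (mu i) S)"
      unfolding eq[symmetric] by (rule prob_space_distr[OF rv[OF r]])
    then show ?thesis
      unfolding eq L_def unfolding ij(1) fst_conv by (rule mvnormal_eq_distr_gauss[OF S T mu[OF ij(2)]])
  qed
  have law: "distr M (PiM R (\<lambda>_. rvec_space p)) (\<lambda>\<omega>. \<lambda>r\<in>R. X' r \<omega>)
    = distr (gauss (R \<times> {..<p})) (PiM R (\<lambda>_. rvec_space p)) (\<lambda>Z. \<lambda>r\<in>R. affine_vec p (mu (fst r)) L (\<lambda>c\<in>{..<p}. Z (r, c)))"
  proof -
    have "indep_vars (\<lambda>_. rvec_space p) X' R" using indep by (simp add: R_def X'_def)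
    then have "distr M (PiM R (\<lambda>_. rvec_space p)) (\<lambda>\<omega>. \<lambda>r\<in>R. X' r \<omega>) = PiM R (\<lambda>r. distr M (rvec_space p) (X' r))"
      using indep_vars_iff_distr_eq_PiM'[OF Rne rv] by simp
    also have "\<dots> = PiM R (\<lambda>r. distr (gauss {..<p}) (rvec_space p) (affine_vec p (mu (fst r)) L))"
      by (intro PiM_cong refl mvn)
    finally show ?thesis
      unfolding PiM_distr_gauss_rows[OF fR, of "\<lambda>r. affine_vec p (mu (fst r)) L", OF measurable_affine_vec] .
  qed
  define \<Phi> where "\<Phi> x = \<phi> (bartlett_Lambda p k N (\<lambda>i j. x (i, j)))" for x
  have \<Phi>: "\<Phi> \<in> borel_measurable (PiM R (\<lambda>_. rvec_space p))"
    unfolding \<Phi>_def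
  proof (rule measurable_compose[OF borel_measurable_bartlett_Lambda \<phi>])
    fix i j a assume "i < k" "j < N i" "a < p"
    then have "(\<lambda>x. x (i, j)) \<in> PiM R (\<lambda>_. rvec_space p) \<rightarrow>\<^sub>M rvec_space p" "(\<lambda>v. v a) \<in> borel_measurable (rvec_space p)"
      by (auto simp: R_def measurable_cong_sets[OF sets_rvec_space refl] intro!: measurable_component_singleton)
    then show "(\<lambda>x. x (i, j) a) \<in> borel_measurable (PiM R (\<lambda>_. rvec_space p))"
      by (rule measurable_compose)
  qed
  let ?c = "bartlett_const p k N" and ?a = "\<lambda>i. (real (N i) - 1) / 2"
  define u where "u i = householder ({i} \<times> {..<N i}) (i, 0) (\<lambda>_. 1)" for i :: nat
  define TZ where "TZ Z = (\<lambda>(r, c)\<in>R \<times> {..<p}. reflect ({fst r} \<times> {..<N (fst r)}) (u (fst r)) (\<lambda>s. Z (s, c)) r)" for Z :: "(nat \<times> nat) \<times> nat \<Rightarrow> real"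
  define F where "F Z = \<phi> (?c * gram_ratio k p B ?a R' (restrict Z (R' \<times> {..<p})))" for Z
  have BR': "B i \<subseteq> R'" if "i < k" for i using that by (auto simp: R')
  have R'R: "R' \<subseteq> R" by (auto simp: R' B R_def)
  have g_meas: "(\<lambda>Z. \<phi> (?c * gram_ratio k p B ?a R' Z)) \<in> borel_measurable (PiM (R' \<times> {..<p}) (\<lambda>_. borel))"
    by (rule measurable_compose[OF _ \<phi>]) (intro borel_measurable_times borel_measurable_const borel_measurable_gram_ratio BR')
  have F: "F \<in> borel_measurable (PiM (R \<times> {..<p}) (\<lambda>_. borel))"
    unfolding F_def using R'R by (intro measurable_compose[OF measurable_restrict_subset g_meas]) auto
  have "(\<integral>\<^sup>+\<omega>. \<phi> (bartlett_Lambda p k N (\<lambda>i j. X i j \<omega>)) \<partial>M) = (\<integral>\<^sup>+\<omega>. \<Phi> (\<lambda>r\<in>R. X' r \<omega>) \<partial>M)"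
    unfolding \<Phi>_def by (intro nn_integral_cong arg_cong[where f = \<phi>] bartlett_Lambda_cong) (auto simp: R_def X'_def)
  also have "\<dots> = (\<integral>\<^sup>+x. \<Phi> x \<partial>distr M (PiM R (\<lambda>_. rvec_space p)) (\<lambda>\<omega>. \<lambda>r\<in>R. X' r \<omega>))"
    using \<Phi> by (intro nn_integral_distr[symmetric] measurable_restrict rv) auto
  also have "\<dots> = (\<integral>\<^sup>+Z. \<Phi> (\<lambda>r\<in>R. affine_vec p (mu (fst r)) L (\<lambda>c\<in>{..<p}. Z (r, c))) \<partial>gauss (R \<times> {..<p}))"
    unfolding law using \<Phi>
    by (intro nn_integral_distr measurable_gauss_rows[where A = "\<lambda>r. affine_vec p (mu (fst r)) L"] measurable_affine_vec) auto
  also have "\<dots> = (\<integral>\<^sup>+Z. F (TZ Z) \<partial>gauss (R \<times> {..<p}))"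
  proof (rule nn_integral_cong)
    fix Z :: "(nat \<times> nat) \<times> nat \<Rightarrow> real"
    have "bartlett_Lambda p k N (\<lambda>i j. (\<lambda>r\<in>R. affine_vec p (mu (fst r)) L (\<lambda>c\<in>{..<p}. Z (r, c))) (i, j))
      = ?c * gram_ratio k p (\<lambda>i. {i} \<times> {..<N i} - {(i, 0)}) ?a (\<Union>i<k. {i} \<times> {..<N i} - {(i, 0)}) (TZ Z)"
    proof (rule bartlett_Lambda_eq_gram_ratio[OF k N L detL refl])
      show "(\<lambda>r\<in>R. affine_vec p (mu (fst r)) L (\<lambda>c\<in>{..<p}. Z (r, c))) (i, j) a = mu i $ a + (\<Sum>l<p. L $$ (a, l) * Z ((i, j), l))"
        if "i < k" "j < N i" "a < p" for i j a
        using that by (simp add: R_def affine_vec_def)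
      show "TZ Z (r, c) = reflect ({i} \<times> {..<N i}) (householder ({i} \<times> {..<N i}) (i, 0) (\<lambda>_. 1)) (\<lambda>s. Z (s, c)) r"
        if "i < k" "r \<in> {i} \<times> {..<N i}" "c < p" for i r c
      proof -
        have "r \<in> R" "fst r = i" using that by (auto simp: R_def)
        then show ?thesis using that by (simp add: TZ_def u_def)
      qed
    qed
    also have "\<dots> = ?c * gram_ratio k p B ?a R' (restrict (TZ Z) (R' \<times> {..<p}))"
      unfolding B[symmetric] R'[symmetric]
      by (intro arg_cong2[where f = "(*)"] refl gram_ratio_cong BR') auto
    finally show "\<Phi> (\<lambda>r\<in>R. affine_vec p (mu (fst r)) L (\<lambda>c\<in>{..<p}. Z (r, c))) = F (TZ Z)"
      unfolding \<Phi>_def F_def by simp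
  qed
  also have "\<dots> = (\<integral>\<^sup>+Z. F Z \<partial>gauss (R \<times> {..<p}))"
    unfolding TZ_def
    by (rule nn_integral_gauss_reflect[where J = "{..<k}" and Bl = "\<lambda>i. {i} \<times> {..<N i}" and \<iota> = fst])
      (use F RU in \<open>auto simp: disjoint_family_on_def\<close>)
  also have "\<dots> = (\<integral>\<^sup>+Z. \<phi> (?c * gram_ratio k p B ?a R' Z) \<partial>gauss (R' \<times> {..<p}))"
    unfolding F_def using R'R fR by (intro nn_integral_gauss_restrict g_meas) auto
  finally show ?thesis .
qed

lemma Gamma_ratio_exp:
  fixes x :: real
  assumes "x > 0" "x + \<delta> > 0"
  shows "Gamma (x + \<delta>) / Gamma x = exp (ln_Gamma (x + \<delta>) - ln_Gamma x)"
    and "Gamma x / Gamma (x + \<delta>) = exp (- (ln_Gamma (x + \<delta>) - ln_Gamma x))"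
  using assms by (simp_all add: Gamma_real_pos_exp exp_diff exp_minus divide_inverse)

lemma gram_ratio_nonzero_iff:
  "gram_ratio k p B a R Z \<noteq> 0 \<longleftrightarrow>
    (\<forall>i<k. Determinant.det (gram p (B i) Z) \<noteq> 0) \<and> Determinant.det (gram p R Z) \<noteq> 0"
  by (auto simp: gram_ratio_def)

text \<open>The logarithm is linear in the exponents, so exponential moments of the log ratio are
  instances of the moment formula with exponents \<open>h * a i\<close>.\<close>

lemma exp_ln_gram_ratio:
  assumes nz: "\<And>i. i < k \<Longrightarrow> Determinant.det (gram p (B i) Z) \<noteq> 0" "Determinant.det (gram p R Z) \<noteq> 0"
  shows "exp (h * ln (gram_ratio k p B a R Z)) = gram_ratio k p B (\<lambda>i. h * a i) R Z"
proof -
  let ?d = "\<lambda>i. Determinant.det (gram p (B i) Z)" and ?D = "Determinant.det (gram p R Z)"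
  have "gram_ratio k p B b R Z = exp ((\<Sum>i<k. b i * ln (?d i)) - (\<Sum>i<k. b i) * ln ?D)" for b
    using nz by (simp add: gram_ratio_def powr_def exp_sum exp_diff exp_minus divide_inverse)
  then show ?thesis
    by (simp add: sum_distrib_left right_diff_distrib mult.assoc)
qed

text \<open>Since \<open>0 powr 0 = 0\<close>, the ratio with all exponents 0 is the indicator of
  the event that no determinant vanishes, and the moment formula evaluates its integral to
  1.\<close>

lemma AE_gauss_det_gram_nonzero:
  fixes B :: "nat \<Rightarrow> 'r set"
  assumes k: "k > 0" and R: "finite R" and BR: "\<And>i. i < k \<Longrightarrow> B i \<subseteq> R"
    and disj: "disjoint_family_on B {..<k}" and p: "\<And>i. i < k \<Longrightarrow> p \<le> card (B i)"
  shows "AE Z in gauss (R \<times> {..<p}). (\<forall>i<k. Determinant.det (gram p (B i) Z) \<noteq> 0) \<and> Determinant.det (gram p R Z) \<noteq> 0"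
proof -
  interpret G: prob_space "gauss (R \<times> {..<p})" by (rule prob_space_gauss)
  let ?g = "gram_ratio k p B (\<lambda>_. 0) R"
  have gm: "?g \<in> borel_measurable (gauss (R \<times> {..<p}))"
    using borel_measurable_gram_ratio[OF BR] by (simp add: measurable_cong_sets[OF sets_gauss refl])
  define A where "A = {Z \<in> space (gauss (R \<times> {..<p})). ?g Z \<noteq> 0}"
  have A: "A \<in> sets (gauss (R \<times> {..<p}))" unfolding A_def using gm by measurable
  have "card (B i) \<le> card R" if "i < k" for i using BR[OF that] R by (rule card_mono[rotated])
  then have cR: "p \<le> card R" using k p[of 0] by (meson order_trans)
  have Gp: "Gamma ((real c - real j) / 2) \<noteq> 0" if "j < p" "p \<le> c" for c j
  proof -
    have "(real c - real j) / 2 > 0" using that by simp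
    then show ?thesis using Gamma_real_pos by (metis less_irrefl)
  qed
  have "emeasure (gauss (R \<times> {..<p})) A = (\<integral>\<^sup>+Z. ennreal (?g Z) \<partial>gauss (R \<times> {..<p}))"
  proof -
    have "ennreal (?g Z) = indicator A Z" if "Z \<in> space (gauss (R \<times> {..<p}))" for Z
    proof (cases "?g Z = 0")
      case False
      then have nz: "\<forall>i<k. Determinant.det (gram p (B i) Z) \<noteq> 0" "Determinant.det (gram p R Z) \<noteq> 0"
        by (simp_all add: gram_ratio_nonzero_iff)
      have "(\<Prod>i<k. Determinant.det (gram p (B i) Z) powr 0) = 1"
        by (intro prod.neutral) (use nz(1) in auto)
      then have "?g Z = 1" using nz(2) unfolding gram_ratio_def by simp
      then show ?thesis using that by (simp add: A_def)
    qed (simp add: A_def)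
    then have "(\<integral>\<^sup>+Z. ennreal (?g Z) \<partial>gauss (R \<times> {..<p})) = (\<integral>\<^sup>+Z. indicator A Z \<partial>gauss (R \<times> {..<p}))"
      by (intro nn_integral_cong)
    then show ?thesis using A by simp
  qed
  also have "\<dots> = ennreal (\<Prod>j<p.
    (\<Prod>i<k. Gamma ((real (card (B i)) - real j) / 2 + 0) / Gamma ((real (card (B i)) - real j) / 2)) *
    (Gamma ((real (card R) - real j) / 2) / Gamma ((real (card R) - real j) / 2 + (\<Sum>i<k. 0))))"
  proof (rule nn_integral_gram_ratio[OF k R BR disj p])
    show "0 < (real (card (B i)) - real p + 1) / 2 + 0" if "i < k" for i using p[OF that] by simp
  qed
  also have "(\<Prod>j<p.
    (\<Prod>i<k. Gamma ((real (card (B i)) - real j) / 2 + 0) / Gamma ((real (card (B i)) - real j) / 2)) *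
    (Gamma ((real (card R) - real j) / 2) / Gamma ((real (card R) - real j) / 2 + (\<Sum>i<k. 0)))) = 1"
  proof (intro prod.neutral ballI)
    fix j assume j: "j \<in> {..<p}"
    have "(\<Prod>i<k. Gamma ((real (card (B i)) - real j) / 2 + 0) / Gamma ((real (card (B i)) - real j) / 2)) = 1"
      by (intro prod.neutral ballI) (use Gp[OF _ p] j in simp)
    then show "(\<Prod>i<k. Gamma ((real (card (B i)) - real j) / 2 + 0) / Gamma ((real (card (B i)) - real j) / 2)) *
      (Gamma ((real (card R) - real j) / 2) / Gamma ((real (card R) - real j) / 2 + (\<Sum>i<k. 0))) = 1"
      using Gp[OF _ cR, of j] j by simp
  qed
  finally have em: "emeasure (gauss (R \<times> {..<p})) A = 1" by simp
  then have "G.prob A = 1" by (simp add: G.emeasure_eq_measure)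
  then have "AE Z in gauss (R \<times> {..<p}). Z \<in> A" using G.AE_in_set_eq_1[OF A] by simp
  then show ?thesis
    by (rule AE_mp) (auto simp: A_def gram_ratio_nonzero_iff)
qed

text \<open>The assumption \<open>\<bar>s\<bar> \<le> \<sigma>\<close> keeps every shift
  \<open>h * x / 2\<close> with \<open>0 \<le> x \<le> m\<close> between -1/2 and 1/2, while
  \<open>N i > p + 1\<close> makes all unshifted Gamma arguments at least 1; hence the moments
  involved are finite.\<close>

lemma nn_integral_exp_bartlett:
  fixes X :: "nat \<Rightarrow> nat \<Rightarrow> 'a \<Rightarrow> nat \<Rightarrow> real"
  assumes prob: "prob_space M" and k: "k > 0" and N: "\<And>i. i < k \<Longrightarrow> N i > p + 1"
    and indep: "prob_space.indep_vars M (\<lambda>_. rvec_space p) (\<lambda>(i, j). X i j) (SIGMA i:{..<k}. {..<N i})"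
    and normal: "\<And>i j. i < k \<Longrightarrow> j < N i \<Longrightarrow> distr M (rvec_space p) (X i j) = mvnormal p (mu i) S"
    and mu: "\<And>i. i < k \<Longrightarrow> mu i \<in> carrier_vec p" and S: "pos_def_mat p S"
    and \<sigma>: "\<sigma> > 0" "\<bar>s\<bar> \<le> \<sigma>" and m: "m = real (\<Sum>i<k. N i) - real k"
  shows "(\<integral>\<^sup>+\<omega>. ennreal (exp (s * ((ln (bartlett_Lambda p k N (\<lambda>i j. X i j \<omega>)) - bartlett_mu p k N) / (m * \<sigma>)))) \<partial>M)
    = ennreal (exp (bartlett_log_mgf p k N (s / (m * \<sigma>))))"
proof -
  define h where "h = s / (m * \<sigma>)"
  define q where "q i = real (N i) - 1" for i
  let ?mu = "bartlett_mu p k N" and ?c = "bartlett_const p k N" and ?a = "\<lambda>i. (real (N i) - 1) / 2"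
  define B where "B = (\<lambda>i. {i} \<times> {..<N i} - {(i, 0::nat)})"
  define R' where "R' = (\<Union>i<k. B i)"
  have q: "q i \<ge> real p + 1" if "i < k" for i using N[OF that] by (simp add: q_def)
  have mq: "m = (\<Sum>i<k. q i)" by (simp add: m q_def sum_subtractf)
  have q_le: "q i \<le> m" if "i < k" for i
    unfolding mq using that q by (intro member_le_sum) (auto intro: order_trans[of _ "real p + 1"])
  have m_ge: "m \<ge> real p + 1" using q[OF k] q_le[OF k] by simp
  have card_B: "real (card (B i)) = q i" if "i < k" for i
  proof -
    have "card (B i) = N i - 1" unfolding B_def using N[OF that] by (subst card_Diff_singleton) auto
    then show ?thesis using N[OF that] by (simp add: q_def of_nat_diff)
  qed
  have disj: "disjoint_family_on B {..<k}" by (auto simp: disjoint_family_on_def B_def)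
  have fR': "finite R'" by (auto simp: R'_def B_def)
  have card_R': "real (card R') = m"
  proof -
    have "card R' = (\<Sum>i<k. card (B i))"
      unfolding R'_def using disj by (subst card_UN_disjoint) (auto simp: disjoint_family_on_def B_def)
    then show ?thesis using card_B by (simp add: mq)
  qed
  have BR': "B i \<subseteq> R'" if "i < k" for i using that by (auto simp: R'_def)
  have p_le: "p \<le> card (B i)" if "i < k" for i
    using card_B[OF that] q[OF that] by linarith
  define \<delta> where "\<delta> x = h * x / 2" for x
  have \<delta>: "\<bar>\<delta> x\<bar> \<le> 1 / 2" if "0 \<le> x" "x \<le> m" for x
  proof -
    have "\<bar>\<delta> x\<bar> = (\<bar>s\<bar> / \<sigma>) * (x / m) / 2"
      using that m_ge \<sigma> by (simp add: \<delta>_def h_def abs_mult)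
    also have "\<dots> \<le> 1 * 1 / 2"
      using that m_ge \<sigma> by (intro divide_right_mono mult_mono) auto
    finally show ?thesis by simp
  qed
  have N1: "N i \<noteq> Suc 0" if "i < k" for i using N[OF that] by simp
  have c_pos: "?c > 0"
    unfolding bartlett_const_def Let_def m[symmetric] using m_ge N1
    by (intro divide_pos_pos prod_pos) auto
  have ln_c: "ln ?c = m * real p / 2 * ln m - (\<Sum>i<k. q i * real p / 2 * ln (q i))"
  proof -
    have nz: "q i powr (q i * real p / 2) \<noteq> 0" if "i < k" for i using q[OF that] by simp
    have "ln ?c = ln (m powr (m * real p / 2)) - ln (\<Prod>i<k. q i powr (q i * real p / 2))"
      unfolding bartlett_const_def Let_def m[symmetric] q_def[symmetric] using m_ge nz by (subst ln_div) auto
    also have "ln (\<Prod>i<k. q i powr (q i * real p / 2)) = (\<Sum>i<k. ln (q i powr (q i * real p / 2)))"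
      using nz by (intro ln_prod) auto
    finally show ?thesis by (simp add: ln_powr)
  qed
  define \<phi> where "\<phi> x = ennreal (exp (h * (ln x - ?mu)))" for x
  have \<phi>: "\<phi> \<in> borel_measurable borel" unfolding \<phi>_def by measurable
  have "(\<integral>\<^sup>+\<omega>. ennreal (exp (s * ((ln (bartlett_Lambda p k N (\<lambda>i j. X i j \<omega>)) - ?mu) / (m * \<sigma>)))) \<partial>M)
    = (\<integral>\<^sup>+\<omega>. \<phi> (bartlett_Lambda p k N (\<lambda>i j. X i j \<omega>)) \<partial>M)"
    by (simp add: \<phi>_def h_def)
  also have "\<dots> = (\<integral>\<^sup>+Z. \<phi> (?c * gram_ratio k p B ?a R' Z) \<partial>gauss (R' \<times> {..<p}))"
    by (rule nn_integral_bartlett_Lambda[OF prob k _ indep normal mu S \<phi> B_def R'_def]) (use N in force)+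
  also have "\<dots> = (\<integral>\<^sup>+Z. ennreal (exp (h * (ln ?c - ?mu))) * ennreal (gram_ratio k p B (\<lambda>i. \<delta> (q i)) R' Z) \<partial>gauss (R' \<times> {..<p}))"
  proof (rule nn_integral_cong_AE)
    have "AE Z in gauss (R' \<times> {..<p}). (\<forall>i<k. Determinant.det (gram p (B i) Z) \<noteq> 0) \<and> Determinant.det (gram p R' Z) \<noteq> 0"
      by (rule AE_gauss_det_gram_nonzero[OF k fR' BR' disj p_le])
    then show "AE Z in gauss (R' \<times> {..<p}). \<phi> (?c * gram_ratio k p B ?a R' Z)
      = ennreal (exp (h * (ln ?c - ?mu))) * ennreal (gram_ratio k p B (\<lambda>i. \<delta> (q i)) R' Z)"
    proof (rule AE_mp, intro AE_I2 impI)
    fix Z assume nz: "(\<forall>i<k. Determinant.det (gram p (B i) Z) \<noteq> 0) \<and> Determinant.det (gram p R' Z) \<noteq> 0"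
    then have g: "gram_ratio k p B ?a R' Z \<noteq> 0" by (simp add: gram_ratio_nonzero_iff)
    have "exp (h * (ln (?c * gram_ratio k p B ?a R' Z) - ?mu))
      = exp (h * (ln ?c - ?mu)) * exp (h * ln (gram_ratio k p B ?a R' Z))"
      using c_pos g by (simp add: ln_mult exp_add[symmetric] algebra_simps)
    also have "exp (h * ln (gram_ratio k p B ?a R' Z)) = gram_ratio k p B (\<lambda>i. \<delta> (q i)) R' Z"
      using exp_ln_gram_ratio[of k p B Z R' h ?a] nz by (simp add: \<delta>_def q_def)
    finally show "\<phi> (?c * gram_ratio k p B ?a R' Z)
      = ennreal (exp (h * (ln ?c - ?mu))) * ennreal (gram_ratio k p B (\<lambda>i. \<delta> (q i)) R' Z)"
      unfolding \<phi>_def by (simp only: ennreal_mult' exp_ge_zero)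
    qed
  qed
  also have "\<dots> = ennreal (exp (h * (ln ?c - ?mu))) * (\<integral>\<^sup>+Z. ennreal (gram_ratio k p B (\<lambda>i. \<delta> (q i)) R' Z) \<partial>gauss (R' \<times> {..<p}))"
    using borel_measurable_gram_ratio[OF BR'] by (intro nn_integral_cmult) (simp add: measurable_cong_sets[OF sets_gauss refl])
  also have "(\<integral>\<^sup>+Z. ennreal (gram_ratio k p B (\<lambda>i. \<delta> (q i)) R' Z) \<partial>gauss (R' \<times> {..<p}))
    = ennreal (\<Prod>j<p. (\<Prod>i<k. Gamma ((real (card (B i)) - real j) / 2 + \<delta> (q i)) / Gamma ((real (card (B i)) - real j) / 2)) *
    (Gamma ((real (card R') - real j) / 2) / Gamma ((real (card R') - real j) / 2 + (\<Sum>i<k. \<delta> (q i)))))"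
  proof (rule nn_integral_gram_ratio[OF k fR' BR' disj p_le])
    fix i assume i: "i < k"
    have "\<bar>\<delta> (q i)\<bar> \<le> 1 / 2" using q[OF i] q_le[OF i] by (intro \<delta>) auto
    then show "0 < (real (card (B i)) - real p + 1) / 2 + \<delta> (q i)"
      using q[OF i] unfolding card_B[OF i] by (auto simp: abs_le_iff field_simps)
  qed
  also have "(\<Prod>j<p. (\<Prod>i<k. Gamma ((real (card (B i)) - real j) / 2 + \<delta> (q i)) / Gamma ((real (card (B i)) - real j) / 2)) *
      (Gamma ((real (card R') - real j) / 2) / Gamma ((real (card R') - real j) / 2 + (\<Sum>i<k. \<delta> (q i)))))
    = exp ((\<Sum>i<k. ln_Gamma_ratio p (q i) (\<delta> (q i))) - ln_Gamma_ratio p m (\<delta> m))"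
  proof -
    define G where "G x j = ln_Gamma ((x - real j) / 2 + \<delta> x) - ln_Gamma ((x - real j) / 2)" for x j
    \<comment> \<open>As \<open>\<delta>\<close> is linear and the degrees of freedom add up, the
      pooled exponent is the shift belonging to \<open>m\<close>.\<close>
    have \<delta>m: "(\<Sum>i<k. \<delta> (q i)) = \<delta> m"
      by (simp add: \<delta>_def mq sum_distrib_left sum_divide_distrib)
    have pos: "(x - real j) / 2 > 0" "(x - real j) / 2 + \<delta> x > 0" if "j < p" "real p + 1 \<le> x" "x \<le> m" for x j
    proof -
      have "\<bar>\<delta> x\<bar> \<le> 1 / 2" using that by (intro \<delta>) auto
      then have "- (1 / 2) \<le> \<delta> x" by (simp add: abs_le_iff)
      moreover have h: "1 \<le> (x - real j) / 2" using that by simp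
      ultimately have "1 + - (1 / 2) \<le> (x - real j) / 2 + \<delta> x" by (intro add_mono)
      then show "(x - real j) / 2 + \<delta> x > 0" by (rule less_le_trans[rotated]) simp
      show "(x - real j) / 2 > 0" by (rule less_le_trans[OF _ h]) simp
    qed
    have "(\<Prod>j<p. (\<Prod>i<k. Gamma ((real (card (B i)) - real j) / 2 + \<delta> (q i)) / Gamma ((real (card (B i)) - real j) / 2)) *
      (Gamma ((real (card R') - real j) / 2) / Gamma ((real (card R') - real j) / 2 + (\<Sum>i<k. \<delta> (q i)))))
      = (\<Prod>j<p. (\<Prod>i<k. exp (G (q i) j)) * exp (- G m j))"
      unfolding card_R' \<delta>m
    proof (intro prod.cong refl arg_cong2[where f = "(*)"])
      fix j i assume "j \<in> {..<p}" "i \<in> {..<k}"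
      then show "Gamma ((real (card (B i)) - real j) / 2 + \<delta> (q i)) / Gamma ((real (card (B i)) - real j) / 2) = exp (G (q i) j)"
        using card_B[of i] pos[of j "q i"] q[of i] q_le[of i] by (simp add: G_def Gamma_ratio_exp(1))
    next
      fix j assume "j \<in> {..<p}"
      then show "Gamma ((m - real j) / 2) / Gamma ((m - real j) / 2 + \<delta> m) = exp (- G m j)"
        using pos[of j m] m_ge by (simp only: G_def Gamma_ratio_exp(2) lessThan_iff order_refl)
    qed
    also have "\<dots> = exp (\<Sum>j<p. (\<Sum>i<k. G (q i) j) + - G m j)"
      by (simp only: exp_sum[OF finite_lessThan] exp_add)
    also have "(\<Sum>j<p. (\<Sum>i<k. G (q i) j) + - G m j) = (\<Sum>i<k. \<Sum>j<p. G (q i) j) - (\<Sum>j<p. G m j)"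
      by (simp only: sum.distrib sum_negf diff_conv_add_uminus) (subst sum.swap, rule refl)
    finally show ?thesis unfolding G_def ln_Gamma_ratio_def .
  qed
  also have "ennreal (exp (h * (ln ?c - ?mu))) * ennreal (exp ((\<Sum>i<k. ln_Gamma_ratio p (q i) (\<delta> (q i))) - ln_Gamma_ratio p m (\<delta> m)))
    = ennreal (exp (bartlett_log_mgf p k N h))"
    unfolding bartlett_log_mgf_def Let_def m[symmetric] q_def[symmetric] ln_c[symmetric]
    \<delta>_def add_diff_eq[symmetric] exp_add by (subst ennreal_mult'[symmetric]) simp_all
  finally show ?thesis unfolding h_def .
qed

theorem theorem4:
  fixes k :: nat
    and n :: "nat \<Rightarrow> nat \<Rightarrow> nat"
    and y :: "nat \<Rightarrow> real"
    and M :: "nat \<Rightarrow> 'a measure"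
    and X :: "nat \<Rightarrow> nat \<Rightarrow> nat \<Rightarrow> 'a \<Rightarrow> (nat \<Rightarrow> real)"
    and mu :: "nat \<Rightarrow> nat \<Rightarrow> real vec"
    and Sig :: "nat \<Rightarrow> nat \<Rightarrow> real mat"
  assumes k2: "k \<ge> 2"
    and n_gt: "\<And>p i. i < k \<Longrightarrow> n p i > p + 1"
    and y_lim: "\<And>i. i < k \<Longrightarrow> (\<lambda>p. real p / real (n p i)) \<longlonglongrightarrow> y i"
    and y_range: "\<And>i. i < k \<Longrightarrow> 0 < y i \<and> y i \<le> 1"
    and prob: "\<And>p. prob_space (M p)"
    and indep: "\<And>p. prob_space.indep_vars (M p) (\<lambda>_. rvec_space p)
                   (\<lambda>(i, j). X p i j) (SIGMA i:{..<k}. {..<n p i})"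
    and normal: "\<And>p i j. i < k \<Longrightarrow> j < n p i \<Longrightarrow>
                   distr (M p) (rvec_space p) (X p i j) = mvnormal p (mu p i) (Sig p i)"
    and mu_dim: "\<And>p i. i < k \<Longrightarrow> mu p i \<in> carrier_vec p"
    and Sig_pd: "\<And>p i. i < k \<Longrightarrow> pos_def_mat p (Sig p i)"
    and H0: "\<And>p i. i < k \<Longrightarrow> Sig p i = Sig p 0"
  shows "(\<forall>p\<ge>1. bartlett_sigma2 p k (n p) > 0) \<and>
    weak_conv_m
      (\<lambda>p. distr (M p) borel
         (\<lambda>\<omega>. (ln (bartlett_Lambda p k (n p) (\<lambda>i j. X p i j \<omega>)) - bartlett_mu p k (n p))
               / ((real (\<Sum>i<k. n p i) - real k) * sqrt (bartlett_sigma2 p k (n p)))))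
      std_normal_distribution"
proof
  have k0: "k > 0" using k2 by simp
  \<comment> \<open>For \<open>p = 0\<close> every logarithm is \<open>ln 1\<close> and the variance
    is 0, so positivity starts at 1.\<close>
  show "\<forall>p\<ge>1. bartlett_sigma2 p k (n p) > 0"
  proof (intro allI impI)
    fix p :: nat assume p: "p \<ge> 1"
    define m where "m = real (\<Sum>i<k. n p i) - real k"
    have "real (n p 0) - 1 > real p" using n_gt[OF k0, of p] by simp
    then have "0 < real p / (real (n p 0) - 1)" "real p / (real (n p 0) - 1) < 1" using p by auto
    then have l: "ln_rem (real p / (real (n p 0) - 1)) > 0"
      using ln_rem_ge_half[of "real p / (real (n p 0) - 1)"] by linarith
    have "k < (\<Sum>i<k. n p i)"
    proof -
      have "(\<Sum>i<k. 1) < (\<Sum>i<k. n p i)"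
        using n_gt k0 by (intro sum_strict_mono) (auto intro: le_less_trans[of _ "p + 1"])
      then show ?thesis by simp
    qed
    then have "m > 0" unfolding m_def by (simp only: diff_gt_0_iff_gt of_nat_less_iff)
    then have "0 < (real p / m)\<^sup>2 / 2 * ln_rem (real p / (real (n p 0) - 1))"
      using p l by (intro mult_pos_pos) auto
    also have "\<dots> \<le> bartlett_sigma2 p k (n p)"
      unfolding m_def using k2 n_gt p k0 by (intro bartlett_sigma2_ge) auto
    finally show "bartlett_sigma2 p k (n p) > 0" .
  qed
  let ?m = "\<lambda>p. real (\<Sum>i<k. n p i) - real k" and ?\<sigma> = "\<lambda>p. sqrt (bartlett_sigma2 p k (n p))"
  define Y where "Y p \<omega> = (ln (bartlett_Lambda p k (n p) (\<lambda>i j. X p i j \<omega>)) - bartlett_mu p k (n p)) / (?m p * ?\<sigma> p)" for p \<omega>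
  have Y: "Y p \<in> borel_measurable (M p)" for p
  proof -
    have "(\<lambda>\<omega>. X p i j \<omega> a) \<in> borel_measurable (M p)" if "i < k" "j < n p i" "a < p" for i j a
    proof -
      have "X p i j \<in> M p \<rightarrow>\<^sub>M rvec_space p"
        using indep[of p] that unfolding prob_space.indep_vars_def2[OF prob] by auto
      moreover have "(\<lambda>v. v a) \<in> borel_measurable (rvec_space p)"
        using that by (auto simp: measurable_cong_sets[OF sets_rvec_space refl] intro!: measurable_component_singleton)
      ultimately show ?thesis by (rule measurable_compose)
    qed
    from borel_measurable_bartlett_Lambda[where x = "\<lambda>\<omega> i j. X p i j \<omega>", OF this]
    have [measurable]: "(\<lambda>\<omega>. bartlett_Lambda p k (n p) (\<lambda>i j. X p i j \<omega>)) \<in> borel_measurable (M p)" .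
    show ?thesis unfolding Y_def by measurable
  qed
  obtain c where c: "c > 0" "eventually (\<lambda>p. c \<le> ?\<sigma> p) sequentially"
    "\<And>s. \<bar>s\<bar> \<le> c \<Longrightarrow> (\<lambda>p. bartlett_log_mgf p k (n p) (s / (?m p * ?\<sigma> p))) \<longlonglongrightarrow> s\<^sup>2 / 2"
  proof (rule bartlett_log_mgf_tendsto[where k = k and n = n and y = y, OF k2 n_gt y_lim])
    show "0 < y i" if "i < k" for i using y_range[OF that] by simp
  next
    fix c assume A: "c > 0" "eventually (\<lambda>p. c \<le> ?\<sigma> p) sequentially"
      "\<And>s. \<bar>s\<bar> \<le> c \<Longrightarrow> (\<lambda>p. bartlett_log_mgf p k (n p) (s / (?m p * ?\<sigma> p))) \<longlonglongrightarrow> s\<^sup>2 / 2"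
    show thesis by (rule that[OF A])
  qed
  \<comment> \<open>The side condition \<open>c \<le> ?\<sigma> p\<close> brings \<open>s\<close>
    into the range of the exact moment formula, so the identity is available for all large
    \<open>p\<close> only.\<close>
  have mgf: "integrable (distr (M p) borel (Y p)) (\<lambda>x. exp (s * x)) \<and>
      (\<integral>x. exp (s * x) \<partial>distr (M p) borel (Y p)) = exp (bartlett_log_mgf p k (n p) (s / (?m p * ?\<sigma> p)))"
    if s: "\<bar>s\<bar> \<le> c" "c \<le> ?\<sigma> p" for s p
  proof -
    have "(\<integral>\<^sup>+\<omega>. ennreal (exp (s * Y p \<omega>)) \<partial>M p) = ennreal (exp (bartlett_log_mgf p k (n p) (s / (?m p * ?\<sigma> p))))"
      unfolding Y_def
    \<comment> \<open>By the null hypothesis \<open>Sig p 0\<close> serves as the common covariance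
      matrix of all samples.\<close>
    proof (rule nn_integral_exp_bartlett[OF prob k0 n_gt indep, where mu = "mu p" and S = "Sig p 0"])
      show "distr (M p) (rvec_space p) (X p i j) = mvnormal p (mu p i) (Sig p 0)" if "i < k" "j < n p i" for i j
        unfolding H0[OF that(1), of p, symmetric] by (rule normal[OF that])
      show "pos_def_mat p (Sig p 0)" by (rule Sig_pd[OF k0])
      show "0 < ?\<sigma> p" using s c(1) by linarith
      show "\<bar>s\<bar> \<le> ?\<sigma> p" using s by linarith
    qed (assumption | rule mu_dim refl)+
    moreover have "(\<lambda>\<omega>. exp (s * Y p \<omega>)) \<in> borel_measurable (M p)" using Y by measurable
    ultimately have "integrable (M p) (\<lambda>\<omega>. exp (s * Y p \<omega>)) \<and>
      (\<integral>\<omega>. exp (s * Y p \<omega>) \<partial>M p) = exp (bartlett_log_mgf p k (n p) (s / (?m p * ?\<sigma> p)))"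
      by (subst (asm) nn_integral_eq_integrable) auto
    then show ?thesis using Y by (simp add: integrable_distr_eq integral_distr)
  qed
  have "weak_conv_m (\<lambda>p. distr (M p) borel (Y p)) std_normal_distribution"
  proof (rule weak_conv_m_mgf[OF _ c(1)])
    show "real_distribution (distr (M p) borel (Y p))" for p
      using prob_space.real_distribution_distr[OF prob Y] .
    show "eventually (\<lambda>p. integrable (distr (M p) borel (Y p)) (\<lambda>x. exp (c * x)) \<and>
        integrable (distr (M p) borel (Y p)) (\<lambda>x. exp (- (c * x)))) sequentially"
      using c(2)
    proof eventually_elim
      case (elim p)
      then show ?case using mgf[of c p] mgf[of "- c" p] c(1) by simp
    qed
    fix s :: real assume s: "\<bar>s\<bar> \<le> c"
    have "(\<lambda>p. exp (bartlett_log_mgf p k (n p) (s / (?m p * ?\<sigma> p)))) \<longlonglongrightarrow> exp (s\<^sup>2 / 2)"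
      by (intro tendsto_exp c(3) s)
    moreover have "eventually (\<lambda>p. exp (bartlett_log_mgf p k (n p) (s / (?m p * ?\<sigma> p))) = (\<integral>x. exp (s * x) \<partial>distr (M p) borel (Y p))) sequentially"
      using c(2) by eventually_elim (use mgf s in auto)
    ultimately show "(\<lambda>p. \<integral>x. exp (s * x) \<partial>distr (M p) borel (Y p)) \<longlonglongrightarrow> exp (s\<^sup>2 / 2)"
      by (rule Lim_transform_eventually)
  qed
  then show "weak_conv_m
      (\<lambda>p. distr (M p) borel
         (\<lambda>\<omega>. (ln (bartlett_Lambda p k (n p) (\<lambda>i j. X p i j \<omega>)) - bartlett_mu p k (n p))
               / ((real (\<Sum>i<k. n p i) - real k) * sqrt (bartlett_sigma2 p k (n p)))))
      std_normal_distribution"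
    unfolding Y_def .
qed

end
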